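(* Let $N \ge 2$, let $\Omega \subset \mathbb{R}^N$ be a bounded domain, and let $R = \sup_{x \in \Omega} |x|$. For $r \in (0,R)$ let $m(r) = \mathcal{H}^{N-1}(\{x \in \Omega : |x| = r\})$. If $$m_0 := \limsup_{r \to 0} \frac{m(r)}{r^{N-1}} < \omega_{N-1}$$ and $$m_R := \limsup_{r \to R} \frac{m(r)}{(R-r)^{N-1}} < \infty,$$ then $$C_N(\Omega) > \left( \frac{N-1}{N} \right)^N.$$
   Context: A domain is a nonempty connected open set. $\mathcal{H}^{N-1}$ is the $(N-1)$-dimensional Hausdorff measure, and $\omega_{N-1}$ is the surface area of the unit sphere $S^{N-1} \subset \mathbb{R}^N$. For a bounded domain $\Omega \subset \mathbb{R}^N$ with $R = \sup_{x \in \Omega}|x|$, define $$C_N(\Omega) = \inf_{u \in W^{1,N}_0(\Omega),\ u \not\equiv 0} \frac{\int_\Omega |\nabla u|^N\,dx}{\int_\Omega \frac{|u(x)|^N}{|x|^N \left( \log \frac{R}{|x|} \right)^N}\,dx}.$$ It is not assumed that $0 \in \Omega$. *)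

theory Defs
  imports "HOL-Analysis.Analysis"
begin

section \<open>Hausdorff measure\<close>

text \<open>
  The usual normalisation is used, under which \<open>n\<close>-dimensional Hausdorff measure on
  \<open>n\<close>-dimensional Euclidean space is Lebesgue measure.  Covering sets are required to be bounded
  since \<^const>\<open>diameter\<close> is unspecified on unbounded sets; the empty set is singled out so that
  the definition is also correct for \<open>k = 0\<close>, where \<open>0 ^ 0 = 1\<close>.
\<close>

definition hausdorff_premeasure :: "nat \<Rightarrow> real \<Rightarrow> 'a::metric_space set \<Rightarrow> ennreal" where
  "hausdorff_premeasure k d A =
    (INF C \<in> {C :: nat \<Rightarrow> 'a set. A \<subseteq> (\<Union>i. C i) \<and> (\<forall>i. bounded (C i) \<and> diameter (C i) \<le> d)}.
      \<Sum>i. if C i = {} then 0 else ennreal (unit_ball_vol (real k) * (diameter (C i) / 2) ^ k))"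

definition hausdorff_measure :: "nat \<Rightarrow> 'a::metric_space set \<Rightarrow> ennreal" where
  "hausdorff_measure k A = (SUP d \<in> {0<..}. hausdorff_premeasure k d A)"


section \<open>Test functions\<close>

primrec k_times_cont_differentiable :: "nat \<Rightarrow> ('a::euclidean_space \<Rightarrow> real) \<Rightarrow> bool" where
  "k_times_cont_differentiable 0 f \<longleftrightarrow> continuous_on UNIV f"
| "k_times_cont_differentiable (Suc k) f \<longleftrightarrow>
     (\<forall>x. f differentiable (at x)) \<and>
     (\<forall>v. k_times_cont_differentiable k (\<lambda>x. frechet_derivative f (at x) v))"

definition smooth :: "('a::euclidean_space \<Rightarrow> real) \<Rightarrow> bool" where
  "smooth f \<longleftrightarrow> (\<forall>k. k_times_cont_differentiable k f)"

definition test_function :: "'a::euclidean_space set \<Rightarrow> ('a \<Rightarrow> real) \<Rightarrow> bool" where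
  "test_function \<Omega> \<phi> \<longleftrightarrow>
     smooth \<phi> \<and> compact (closure {x. \<phi> x \<noteq> 0}) \<and> closure {x. \<phi> x \<noteq> 0} \<subseteq> \<Omega>"

definition grad :: "('a::euclidean_space \<Rightarrow> real) \<Rightarrow> 'a \<Rightarrow> 'a" where
  "grad f x = (\<Sum>b\<in>Basis. frechet_derivative f (at x) b *\<^sub>R b)"

lemma GDERIV_grad:
  assumes "f differentiable (at x)"
  shows "GDERIV f x :> grad f x"
proof -
  have D: "(f has_derivative frechet_derivative f (at x)) (at x)"
    using assms frechet_derivative_works by blast
  then interpret bounded_linear "frechet_derivative f (at x)"
    by (rule has_derivative_bounded_linear)
  have "h \<bullet> grad f x = frechet_derivative f (at x) h" for h
  proof -
    have "frechet_derivative f (at x) h = frechet_derivative f (at x) (\<Sum>b\<in>Basis. (h \<bullet> b) *\<^sub>R b)"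
      by (simp add: euclidean_representation)
    also have "\<dots> = (\<Sum>b\<in>Basis. (h \<bullet> b) * frechet_derivative f (at x) b)"
      by (simp add: sum scaleR)
    finally show ?thesis
      by (simp add: grad_def inner_sum_right mult.commute)
  qed
  with D show ?thesis
    by (simp add: gderiv_def)
qed


section \<open>Sobolev spaces\<close>

definition locally_integrable_on ::
    "('a::euclidean_space \<Rightarrow> 'b::euclidean_space) \<Rightarrow> 'a set \<Rightarrow> bool" where
  "locally_integrable_on f \<Omega> \<longleftrightarrow> (\<forall>K. compact K \<and> K \<subseteq> \<Omega> \<longrightarrow> set_integrable lebesgue K f)"

definition weak_gradient ::
    "'a::euclidean_space set \<Rightarrow> ('a \<Rightarrow> real) \<Rightarrow> ('a \<Rightarrow> 'a) \<Rightarrow> bool" where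
  "weak_gradient \<Omega> u g \<longleftrightarrow>
     locally_integrable_on u \<Omega> \<and> locally_integrable_on g \<Omega> \<and>
     (\<forall>\<phi>. test_function \<Omega> \<phi> \<longrightarrow> (\<forall>b\<in>Basis.
        (LINT x:\<Omega>|lebesgue. u x * (grad \<phi> x \<bullet> b)) = - (LINT x:\<Omega>|lebesgue. (g x \<bullet> b) * \<phi> x)))"

definition Lp :: "nat \<Rightarrow> 'a::euclidean_space set \<Rightarrow> ('a \<Rightarrow> 'b::euclidean_space) set" where
  "Lp p \<Omega> = {f. f \<in> borel_measurable (lebesgue_on \<Omega>) \<and>
                (\<integral>\<^sup>+x. ennreal (norm (f x) ^ p) \<partial>lebesgue_on \<Omega>) < \<infinity>}"

definition W1 :: "nat \<Rightarrow> 'a::euclidean_space set \<Rightarrow> ('a \<Rightarrow> real) set" where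
  "W1 p \<Omega> = {u \<in> Lp p \<Omega>. \<exists>g \<in> Lp p \<Omega>. weak_gradient \<Omega> u g}"

text \<open>
  The closure of the test functions in \<^const>\<open>W1\<close>, with respect to the Sobolev norm; the
  quantity below is the \<open>p\<close>-th power of the distance from \<open>u\<close> to \<open>\<phi>\<close>.
\<close>

definition W1_0 :: "nat \<Rightarrow> 'a::euclidean_space set \<Rightarrow> ('a \<Rightarrow> real) set" where
  "W1_0 p \<Omega> = {u \<in> W1 p \<Omega>. \<exists>g \<in> Lp p \<Omega>. weak_gradient \<Omega> u g \<and>
     (\<forall>e>0. \<exists>\<phi>. test_function \<Omega> \<phi> \<and>
        (\<integral>\<^sup>+x. ennreal (norm (u x - \<phi> x) ^ p) \<partial>lebesgue_on \<Omega>) +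
        (\<integral>\<^sup>+x. ennreal (norm (g x - grad \<phi> x) ^ p) \<partial>lebesgue_on \<Omega>) < ennreal e)}"


section \<open>The critical Hardy constant\<close>

definition outer_radius :: "'a::real_normed_vector set \<Rightarrow> real" where
  "outer_radius \<Omega> = (SUP x\<in>\<Omega>. norm x)"

text \<open>
  The weak gradient \<open>g\<close> of \<open>u\<close> is determined up to a null set, so the quotient depends on \<open>u\<close> only.
  Being an element of a space of equivalence classes, \<open>u \<noteq> 0\<close> means that \<open>u\<close> does not vanish
  almost everywhere.  The denominator is then positive, and the quotient is \<open>0\<close>
  should the denominator be infinite.  The weight is positive on \<open>\<Omega> - {0}\<close>, as \<open>norm x\<close>
  is smaller than the outer radius throughout an open set \<open>\<Omega>\<close>.
\<close>

definition hardy_constant :: "'a::euclidean_space set \<Rightarrow> ennreal" where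
  "hardy_constant \<Omega> = (let N = DIM('a); R = outer_radius \<Omega> in
     Inf {(\<integral>\<^sup>+x. ennreal (norm (g x) ^ N) \<partial>lebesgue_on \<Omega>) /
          (\<integral>\<^sup>+x. ennreal (\<bar>u x\<bar> ^ N / (norm x ^ N * ln (R / norm x) ^ N)) \<partial>lebesgue_on \<Omega>) | u g.
          u \<in> W1_0 N \<Omega> \<and> weak_gradient \<Omega> u g \<and> \<not> (AE x in lebesgue_on \<Omega>. u x = 0)})"

end

theory Submission
  imports Defs "HOL-Computational_Algebra.Polynomial"
begin

text \<open>
  Write \<open>n\<close> for the dimension, \<open>H = ((n - 1) / n) ^ n\<close> and \<open>t = ln (R / r)\<close> with \<open>r = norm x\<close>.  The gradient
  splits into a radial and a tangential part, and \<open>norm (grad u) ^ n\<close> is at least the sum of the \<open>n\<close>-th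
  powers of the two parts.  In the variable \<open>t\<close> the radial part alone satisfies, on every ray, the
  one-dimensional Hardy inequality with weight \<open>1 / t ^ n\<close> and sharp constant \<open>H\<close>.  That constant is
  approached only by functions that concentrate at \<open>t = 0\<close> (the outer sphere) or at \<open>t = \<infinity>\<close> (the origin),
  so two things suffice: a gain in the radial inequality for \<open>t\<close> in a compact part of \<open>(0, \<infinity>)\<close>, and a gain
  from the tangential part at both ends.

  The radial gain comes from perturbing the function that proves the Hardy inequality by the Picone
  argument: replacing \<open>((n - 1) / n) / t\<close> by \<open>((n - 1) / n) * q / t\<close> with \<open>q = 1 - \<kappa> * t / (1 + t)\<close> wins a
  term of order \<open>\<kappa>\<close> locally and loses only a term of order \<open>\<kappa> ^ 2\<close> globally
  (\<open>hardy_gain_bound\<close>, \<open>radial_hardy\<close>).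

  The tangential gain is a Poincare inequality on the spheres.  Near the origin \<open>u\<close> vanishes on a fixed
  proportion of every sphere, which gives a Poincare constant of order \<open>r\<close>.  Near the outer sphere \<open>u\<close> lives
  on a set of surface measure of order \<open>(R - r) ^ (n - 1)\<close>, so that it vanishes on most of every cap whose radius is a
  large multiple of \<open>R - r\<close>, which gives a Poincare constant of order \<open>R - r\<close>.
  Both are of order at most \<open>r * t\<close>, the scale of the Hardy weight (\<open>sphere_bounds_at_ends\<close>).  No charts are used: a function on the sphere is extended to be
  constant along rays, and the \<open>L1\<close> Poincare inequality follows by translating this extension in the whole
  space (\<open>sphere_translation_bound\<close>, \<open>sphere_poincare\<close>).

  Surface measure is represented by the volume of cones.  Its comparison with Hausdorff measure is only
  needed up to constant factors: a constant loses nothing at the outer sphere, and at the origin one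
  applies it to the complement of the section, which has positive Hausdorff measure by subadditivity.

  With \<open>\<kappa>\<close> small the gains beat the losses at every radius (\<open>hardy_gain_choice\<close>), so the inequality holds
  for test functions with a constant \<open>H + \<delta>\<close> (\<open>hardy_improved_C1\<close>).  It passes to the closure of the test
  functions with the same constant (\<open>hardy_extends_to_W1_0\<close>).
\<close>


section \<open>Polar coordinates\<close>

text \<open>
  Surface measure of the unit sphere divided by the dimension, as a Borel measure on the whole space: a
  set of directions is measured by the volume of the part of its cone in the unit ball.  The origin is
  sent to the direction \<open>0\<close>, which is a null set.
\<close>

definition cone_measure :: "'a::euclidean_space measure" where
  "cone_measure = distr (density lborel (indicator (cball 0 1))) borel sgn"

lemma sgn_borel_measurable [measurable]: "(sgn :: 'a::euclidean_space \<Rightarrow> 'a) \<in> borel_measurable borel"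
  unfolding sgn_div_norm by measurable

lemma cball_pred_measurable [measurable]: "Measurable.pred borel (\<lambda>x. x \<in> cball (a :: 'a::euclidean_space) r)"
  by (rule pred_sets2[OF borel_closed]) auto

lemma space_cone_measure [simp]: "space cone_measure = UNIV"
  and sets_cone_measure [simp, measurable_cong]: "sets cone_measure = sets borel"
  by (simp_all add: cone_measure_def)

lemma emeasure_cone_measure:
  assumes "A \<in> sets borel"
  shows "emeasure cone_measure A = emeasure lborel {x \<in> cball 0 1. sgn x \<in> A}"
proof -
  have [measurable]: "A \<in> sets borel" by fact
  have "emeasure cone_measure A = emeasure (density lborel (indicator (cball 0 1))) (sgn -` A)"
    unfolding cone_measure_def by (subst emeasure_distr) (auto intro: measurable_sets_borel)
  also have "\<dots> = (\<integral>\<^sup>+x. indicator (cball 0 1) x * indicator (sgn -` A) x \<partial>lborel)"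
    by (rule emeasure_density) (auto intro!: borel_measurable_indicator intro: measurable_sets_borel[OF sgn_borel_measurable])
  also have "\<dots> = (\<integral>\<^sup>+x. indicator {x \<in> cball 0 1. sgn x \<in> A} x \<partial>lborel)"
    by (intro nn_integral_cong) (auto simp: indicator_def)
  also have "\<dots> = emeasure lborel {x \<in> cball 0 1. sgn x \<in> A}"
    by (rule nn_integral_indicator) measurable
  finally show ?thesis .
qed

lemma emeasure_cone_measure_UNIV:
  "emeasure (cone_measure :: 'a::euclidean_space measure) UNIV = ennreal (unit_ball_vol DIM('a))"
proof -
  have "{x \<in> cball (0::'a) 1. sgn x \<in> UNIV} = cball 0 1" by auto
  then show ?thesis using emeasure_cball[of 1 "0::'a"] by (simp add: emeasure_cone_measure del: mem_cball)
qed

lemma finite_measure_cone_measure: "finite_measure cone_measure"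
  by (rule finite_measureI) (simp add: emeasure_cone_measure_UNIV)

interpretation cone_measure: finite_measure cone_measure
  by (rule finite_measure_cone_measure)

text \<open>
  The image of a cone under a dilation is the same cone.
\<close>

lemma emeasure_lborel_scale_ball:
  fixes S :: "'a::euclidean_space set"
  assumes [measurable]: "B \<in> sets borel" and s: "0 < s"
  shows "emeasure lborel {x \<in> cball 0 s. sgn x \<in> B} = ennreal (s ^ DIM('a)) * emeasure lborel {x \<in> cball (0::'a) 1. sgn x \<in> B}"
proof -
  let ?E = "\<lambda>s. {x \<in> cball (0::'a) s. sgn x \<in> B}"
  have meas: "?E s \<in> sets borel" for s by measurable
  have "?E s = (\<lambda>x. s *\<^sub>R x + 0) ` ?E 1"
  proof -
    have "x \<in> (\<lambda>x. s *\<^sub>R x + 0) ` ?E 1" if "x \<in> ?E s" for x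
      using that s by (intro image_eqI[of _ _ "x /\<^sub>R s"]) (auto simp: sgn_scaleR field_simps)
    then show ?thesis using s by (auto simp: sgn_scaleR mult_left_le)
  qed
  then have "emeasure lebesgue (?E s) = ennreal (\<bar>s\<bar> ^ DIM('a)) * emeasure lebesgue (?E 1)"
    using emeasure_lebesgue_affine[of s 0 "?E 1"] by simp
  then show ?thesis using s meas[of s] meas[of 1] by (simp add: emeasure_completion)
qed

lemma nn_integral_radius:
  assumes "0 \<le> s"
  shows "(\<integral>\<^sup>+r. ennreal (real n * r ^ (n - 1)) * indicator {0<..s} r \<partial>lborel) = ennreal (if n = 0 then 0 else s ^ n)"
proof (cases "n = 0")
  case False
  have "((\<lambda>r. real n * r ^ (n - 1)) has_integral (s ^ n - 0 ^ n)) {0..s}"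
    using assms by (intro fundamental_theorem_of_calculus)
       (auto intro!: derivative_eq_intros simp flip: has_real_derivative_iff_has_vector_derivative)
  then have "(\<integral>\<^sup>+r. ennreal (real n * r ^ (n - 1)) * indicator {0..s} r \<partial>lborel) = ennreal (s ^ n)"
    using False by (intro nn_integral_has_integral_lebesgue') (auto simp: zero_power)
  moreover have "(\<integral>\<^sup>+r. ennreal (real n * r ^ (n - 1)) * indicator {0..s} r \<partial>lborel) =
      (\<integral>\<^sup>+r. ennreal (real n * r ^ (n - 1)) * indicator {0<..s} r \<partial>lborel)"
    by (intro nn_integral_cong_AE eventually_mono[OF AE_lborel_singleton[of 0]]) (auto simp: indicator_def)
  ultimately show ?thesis using False by simp
qed simp

text \<open>
  The radial factor of Lebesgue measure that goes with the normalisation of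
  \<^const>\<open>cone_measure\<close>.
\<close>

definition radius_measure :: "nat \<Rightarrow> real measure" where
  "radius_measure n = density lborel (\<lambda>r. ennreal (real n * r ^ (n - 1)) * indicator {0<..} r)"

lemma sets_radius_measure [simp, measurable_cong]: "sets (radius_measure n) = sets borel"
  by (simp add: radius_measure_def)

lemma space_radius_measure [simp]: "space (radius_measure n) = UNIV"
  by (simp add: radius_measure_def)

lemma emeasure_radius_measure:
  assumes "n > 0"
  shows "emeasure (radius_measure n) {..s} = ennreal ((max 0 s) ^ n)"
proof -
  have "emeasure (radius_measure n) {..s} = (\<integral>\<^sup>+r. ennreal (real n * r ^ (n - 1)) * indicator {0<..} r * indicator {..s} r \<partial>lborel)"
    unfolding radius_measure_def by (rule emeasure_density) auto
  also have "\<dots> = (\<integral>\<^sup>+r. ennreal (real n * r ^ (n - 1)) * indicator {0<..max 0 s} r \<partial>lborel)"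
    by (intro nn_integral_cong) (auto simp: indicator_def max_def split: if_splits)
  also have "\<dots> = ennreal ((max 0 s) ^ n)" using assms by (subst nn_integral_radius) auto
  finally show ?thesis .
qed

text \<open>
  Both sides agree on rectangles; for a fixed set of directions both are measures of the radial set, and
  these agree on half-lines because cones scale.
\<close>

lemma distr_polar:
  "distr lborel (borel \<Otimes>\<^sub>M borel) (\<lambda>x::'a::euclidean_space. (norm x, sgn x)) =
   radius_measure DIM('a) \<Otimes>\<^sub>M cone_measure"
proof -
  let ?n = "DIM('a)"
  have "radius_measure ?n \<Otimes>\<^sub>M (cone_measure :: 'a measure) = distr lborel (borel \<Otimes>\<^sub>M borel) (\<lambda>x::'a. (norm x, sgn x))"
  proof (rule pair_measure_eqI)
    show "sigma_finite_measure (radius_measure ?n)"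
    proof
      show "\<exists>A. countable A \<and> A \<subseteq> sets (radius_measure ?n) \<and> \<Union>A = space (radius_measure ?n) \<and> (\<forall>a\<in>A. emeasure (radius_measure ?n) a \<noteq> \<infinity>)"
        by (intro exI[of _ "range (\<lambda>k::nat. {..real k})"])
           (auto simp: emeasure_radius_measure real_arch_simple)
    qed
    show "sigma_finite_measure (cone_measure :: 'a measure)"
      by unfold_locales
    show "sets (radius_measure ?n \<Otimes>\<^sub>M (cone_measure :: 'a measure)) =
      sets (distr lborel (borel \<Otimes>\<^sub>M borel) (\<lambda>x::'a. (norm x, sgn x)))"
      by (auto intro!: sets_pair_measure_cong)
    fix A and B :: "'a set" assume A: "A \<in> sets (radius_measure ?n)" and "B \<in> sets cone_measure"
    then have [measurable]: "B \<in> sets borel" and A': "A \<in> sets borel" by simp_all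
    \<comment> \<open>the set \<open>B\<close> of directions is fixed; the rectangles are compared through measures on the line\<close>
    define \<mu> where "\<mu> = distr (density lborel (indicator {x::'a. sgn x \<in> B})) borel norm"
    define \<nu> where "\<nu> = scale_measure (emeasure cone_measure B) (radius_measure ?n)"
    have \<mu>: "emeasure \<mu> X = emeasure lborel {x::'a. norm x \<in> X \<and> sgn x \<in> B}" if X [measurable]: "X \<in> sets borel" for X
    proof -
      have nX: "{x::'a. norm x \<in> X} \<in> sets borel" by measurable
      have "emeasure \<mu> X = emeasure (density lborel (indicator {x::'a. sgn x \<in> B})) {x. norm x \<in> X}"
        unfolding \<mu>_def by (subst emeasure_distr) (simp_all add: X vimage_def)
      also have "\<dots> = (\<integral>\<^sup>+x. indicator {x::'a. sgn x \<in> B} x * indicator {x. norm x \<in> X} x \<partial>lborel)"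
        using nX by (intro emeasure_density) (simp_all)
      also have "\<dots> = (\<integral>\<^sup>+x. indicator {x::'a. norm x \<in> X \<and> sgn x \<in> B} x \<partial>lborel)"
        by (intro nn_integral_cong) (auto simp: indicator_def)
      also have "\<dots> = emeasure lborel {x::'a. norm x \<in> X \<and> sgn x \<in> B}"
        by (rule nn_integral_indicator) measurable
      finally show ?thesis .
    qed
    have sb: "sets (borel :: real measure) = sigma_sets UNIV (range (\<lambda>s::real. {..s}))"
      by (subst borel_eq_atMost) simp
    have "\<mu> = \<nu>"
    proof (rule measure_eqI_generator_eq[where \<Omega>=UNIV and E="range (\<lambda>s::real. {..s})" and A="\<lambda>k::nat. {..real k}"])
      show "Int_stable (range (\<lambda>s::real. {..s}))"
        by (auto simp: Int_stable_def)
      show "sets \<mu> = sigma_sets UNIV (range (\<lambda>s::real. {..s}))"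
        unfolding \<mu>_def by (simp add: sb)
      show "sets \<nu> = sigma_sets UNIV (range (\<lambda>s::real. {..s}))"
        unfolding \<nu>_def by (simp add: sb)
      show "(\<Union>i. {..real i}) = UNIV" by (auto simp: real_arch_simple)
      have eq: "emeasure \<mu> {..s} = emeasure \<nu> {..s}" for s
      proof -
        have "emeasure \<mu> {..s} = emeasure lborel {x::'a. norm x \<in> {..s} \<and> sgn x \<in> B}"
          by (rule \<mu>) simp
        also have "\<dots> = emeasure \<nu> {..s}"
        proof (cases "s \<le> 0")
          case True
          have "x = 0" if "norm x \<le> s" for x :: 'a
            using that True norm_ge_zero[of x] by (metis dual_order.trans norm_le_zero_iff)
          then have "emeasure lborel {x::'a. norm x \<in> {..s} \<and> sgn x \<in> B} \<le> emeasure lborel {0::'a}"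
            by (intro emeasure_mono) auto
          then have "emeasure lborel {x::'a. norm x \<in> {..s} \<and> sgn x \<in> B} = 0" by simp
          moreover have "emeasure \<nu> {..s} = 0"
            using True by (simp add: \<nu>_def emeasure_radius_measure max_absorb1)
          ultimately show ?thesis by simp
        next
          case False
          have "{x::'a. norm x \<in> {..s} \<and> sgn x \<in> B} = {x \<in> cball 0 s. sgn x \<in> B}" by simp
          moreover have "emeasure \<nu> {..s} = emeasure (cone_measure :: 'a measure) B * ennreal (s ^ DIM('a))"
            using False by (simp add: \<nu>_def emeasure_radius_measure max_absorb2)
          ultimately show ?thesis using False emeasure_lborel_scale_ball[OF \<open>B \<in> sets borel\<close>, of s]
            by (simp only: emeasure_cone_measure[OF \<open>B \<in> sets borel\<close>] mult.commute not_le)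
        qed
        finally show ?thesis .
      qed
      show "emeasure \<mu> X = emeasure \<nu> X" if "X \<in> range (\<lambda>s::real. {..s})" for X
      proof -
        obtain s where "X = {..s}" using \<open>X \<in> _\<close> by (rule rangeE)
        then show ?thesis using eq by (simp only:)
      qed
      show "emeasure \<mu> {..real i} \<noteq> \<infinity>" for i
      proof -
        have "emeasure \<mu> {..real i} = emeasure cone_measure B * ennreal (real i ^ ?n)"
          unfolding eq \<nu>_def emeasure_scale_measure by (simp add: emeasure_radius_measure)
        then show ?thesis using cone_measure.emeasure_finite[of B]
          by (simp only: ennreal_mult_eq_top_iff infinity_ennreal_def ennreal_neq_top) simp
      qed
      show "range (\<lambda>s::real. {..s}) \<subseteq> Pow UNIV" by simp
      show "range (\<lambda>k. {..real k}) \<subseteq> range (\<lambda>s::real. {..s})" by blast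
    qed
    then have 1: "emeasure \<mu> A = emeasure \<nu> A" by (rule arg_cong)
    have AB: "A \<times> B \<in> sets (borel \<Otimes>\<^sub>M borel)" using A' by (intro pair_measureI) simp_all
    have "emeasure (distr lborel (borel \<Otimes>\<^sub>M borel) (\<lambda>x::'a. (norm x, sgn x))) (A \<times> B) =
        emeasure lborel ((\<lambda>x::'a. (norm x, sgn x)) -` (A \<times> B) \<inter> space lborel)"
      using AB by (intro emeasure_distr) simp_all
    also have "(\<lambda>x::'a. (norm x, sgn x)) -` (A \<times> B) \<inter> space lborel = {x::'a. norm x \<in> A \<and> sgn x \<in> B}"
      by fastforce
    also have "emeasure lborel \<dots> = emeasure \<nu> A"
      using \<mu>[OF A'] 1 by (simp only:)
    also have "\<dots> = emeasure (radius_measure ?n) A * emeasure cone_measure B"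
      unfolding \<nu>_def emeasure_scale_measure by (rule mult.commute)
    finally show "emeasure (radius_measure ?n) A * emeasure cone_measure B =
         emeasure (distr lborel (borel \<Otimes>\<^sub>M borel) (\<lambda>x::'a. (norm x, sgn x))) (A \<times> B)"
      by (rule sym)
  qed
  then show ?thesis by simp
qed

lemma norm_scaleR_sgn: "norm x *\<^sub>R sgn x = (x::'a::real_normed_vector)"
  by (cases "x = 0") (simp_all add: sgn_div_norm)

lemma nn_integral_polar:
  fixes f :: "'a::euclidean_space \<Rightarrow> ennreal"
  assumes [measurable]: "f \<in> borel_measurable borel"
  shows "(\<integral>\<^sup>+x. f x \<partial>lborel) = (\<integral>\<^sup>+r. (\<integral>\<^sup>+w. f (r *\<^sub>R w) \<partial>cone_measure) \<partial>radius_measure DIM('a))"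
proof -
  have "(\<integral>\<^sup>+x. f x \<partial>lborel) = (\<integral>\<^sup>+x. (case (norm x, sgn x) of (r, w) \<Rightarrow> f (r *\<^sub>R w)) \<partial>lborel)"
    by (intro nn_integral_cong) (simp add: norm_scaleR_sgn)
  also have "\<dots> = (\<integral>\<^sup>+p. (case p of (r, w) \<Rightarrow> f (r *\<^sub>R w)) \<partial>distr lborel (borel \<Otimes>\<^sub>M borel) (\<lambda>x::'a. (norm x, sgn x)))"
    by (subst nn_integral_distr) auto
  also have "\<dots> = (\<integral>\<^sup>+p. (case p of (r, w) \<Rightarrow> f (r *\<^sub>R w)) \<partial>(radius_measure DIM('a) \<Otimes>\<^sub>M cone_measure))"
    by (simp add: distr_polar)
  also have "\<dots> = (\<integral>\<^sup>+r. (\<integral>\<^sup>+w. f (r *\<^sub>R w) \<partial>cone_measure) \<partial>radius_measure DIM('a))"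
    by (subst cone_measure.nn_integral_fst[symmetric]) auto
  finally show ?thesis .
qed

section \<open>A Poincare inequality on spheres\<close>

text \<open>
  The component of \<open>v\<close> tangential to the sphere through \<open>x\<close> with centre
  \<open>0\<close>.
\<close>

definition tangential :: "'a::real_inner \<Rightarrow> 'a \<Rightarrow> 'a" where
  "tangential x v = v - (v \<bullet> sgn x) *\<^sub>R sgn x"

abbreviation sphere_variation :: "('a::euclidean_space \<Rightarrow> 'a) \<Rightarrow> ennreal" where
  "sphere_variation Df \<equiv> \<integral>\<^sup>+w. ennreal (norm (tangential w (Df w))) \<partial>cone_measure"

abbreviation sphere_mass :: "nat \<Rightarrow> ('a::euclidean_space \<Rightarrow> real) \<Rightarrow> real \<Rightarrow> ennreal" where
  "sphere_mass n \<phi> r \<equiv> \<integral>\<^sup>+w. ennreal (\<bar>\<phi> (r *\<^sub>R w)\<bar> ^ n) \<partial>cone_measure"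

abbreviation sphere_energy :: "nat \<Rightarrow> ('a::euclidean_space \<Rightarrow> 'a) \<Rightarrow> real \<Rightarrow> ennreal" where
  "sphere_energy n D\<phi> r \<equiv> \<integral>\<^sup>+w. ennreal (norm (tangential w (D\<phi> (r *\<^sub>R w))) ^ n) \<partial>cone_measure"

text \<open>
  The gradient of \<open>\<lambda>x. \<bar>\<phi> (r *\<^sub>R x)\<bar> ^ n\<close> when
  \<open>D\<phi>\<close> is the gradient of \<open>\<phi>\<close>; see
  \<open>GDERIV_abs_power_dilation\<close>.
\<close>

abbreviation power_gradient :: "nat \<Rightarrow> ('a::euclidean_space \<Rightarrow> real) \<Rightarrow> ('a \<Rightarrow> 'a) \<Rightarrow> real \<Rightarrow> 'a \<Rightarrow> 'a" where
  "power_gradient n \<phi> D\<phi> r x \<equiv> (real n * (\<bar>\<phi> (r *\<^sub>R x)\<bar> ^ (n - 2) * \<phi> (r *\<^sub>R x)) * r) *\<^sub>R D\<phi> (r *\<^sub>R x)"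

text \<open>
  The velocity of the central projection of a straight line to the unit sphere; the factor \<open>1 /
  norm\<close> is the reason why only the exponent \<open>1\<close> is used in the Poincare inequality:
  \<open>1 / norm z\<close> is integrable at the origin, but its \<open>n\<close>-th power is not.
\<close>

lemma has_vector_derivative_sgn_line:
  fixes y h :: "'a::euclidean_space"
  assumes nz: "y + s *\<^sub>R h \<noteq> 0"
  shows "((\<lambda>s. sgn (y + s *\<^sub>R h)) has_vector_derivative tangential (y + s *\<^sub>R h) h /\<^sub>R norm (y + s *\<^sub>R h)) (at s)"
proof -
  let ?z = "\<lambda>s. y + s *\<^sub>R h"
  have z: "(?z has_derivative (\<lambda>t. t *\<^sub>R h)) (at s)"
    by (auto intro!: derivative_eq_intros)
  have n: "((\<lambda>s. norm (?z s)) has_derivative (\<lambda>t. (t *\<^sub>R h) \<bullet> sgn (?z s))) (at s)"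
    using has_derivative_compose[OF z has_derivative_norm[OF nz]] .
  have "((\<lambda>s. inverse (norm (?z s)) *\<^sub>R ?z s) has_derivative
     (\<lambda>t. inverse (norm (?z s)) *\<^sub>R (t *\<^sub>R h) +
          (- (inverse (norm (?z s)) * ((t *\<^sub>R h) \<bullet> sgn (?z s)) * inverse (norm (?z s)))) *\<^sub>R ?z s)) (at s)"
    by (rule has_derivative_scaleR[OF Deriv.has_derivative_inverse[OF _ n] z]) (use nz in auto)
  also have "(\<lambda>t. inverse (norm (?z s)) *\<^sub>R (t *\<^sub>R h) +
          (- (inverse (norm (?z s)) * ((t *\<^sub>R h) \<bullet> sgn (?z s)) * inverse (norm (?z s)))) *\<^sub>R ?z s) =
     (\<lambda>t. t *\<^sub>R (tangential (?z s) h /\<^sub>R norm (?z s)))"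
    by (simp add: fun_eq_iff tangential_def sgn_div_norm algebra_simps)
  finally show ?thesis
    by (simp add: has_vector_derivative_def sgn_div_norm)
qed

lemma GDERIV_imp_continuous_on:
  fixes f :: "'a::euclidean_space \<Rightarrow> real"
  assumes "\<And>x. GDERIV f x :> Df x"
  shows "continuous_on UNIV f"
  using assms by (intro continuous_at_imp_continuous_on) (auto simp: gderiv_def intro: has_derivative_continuous)

lemma inner_tangential: "tangential x v \<bullet> w = v \<bullet> tangential x w"
  by (simp add: tangential_def inner_diff_left inner_diff_right inner_commute)

text \<open>
  Integrate the derivative of the radially constant extension \<open>f \<circ> sgn\<close> along the
  segment from \<open>y\<close> to \<open>y + h\<close>.
\<close>

lemma sphere_chord_bound:
  fixes f :: "'a::euclidean_space \<Rightarrow> real"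
  assumes f: "\<And>x. GDERIV f x :> Df x" and cont: "continuous_on UNIV Df"
    and nz: "\<And>s. 0 \<le> s \<Longrightarrow> s \<le> 1 \<Longrightarrow> y + s *\<^sub>R h \<noteq> 0"
  defines "g \<equiv> \<lambda>z. norm (tangential z (Df (sgn z))) / norm z"
  shows "ennreal \<bar>f (sgn (y + h)) - f (sgn y)\<bar> \<le> (\<integral>\<^sup>+s. ennreal (norm h * g (y + s *\<^sub>R h)) * indicator {0..1} s \<partial>lborel)"
proof -
  let ?z = "\<lambda>s. y + s *\<^sub>R h"
  let ?\<psi>' = "\<lambda>s. (tangential (?z s) h /\<^sub>R norm (?z s)) \<bullet> Df (sgn (?z s))"
  have deriv: "((\<lambda>s. f (sgn (?z s))) has_vector_derivative ?\<psi>' s) (at s within {0..1})" if "s \<in> {0..1}" for s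
  proof -
    have "?z s \<noteq> 0" using nz that by auto
    from has_derivative_compose[OF has_vector_derivative_sgn_line[OF this, unfolded has_vector_derivative_def] f[unfolded gderiv_def]]
    have "((\<lambda>s. f (sgn (?z s))) has_vector_derivative ?\<psi>' s) (at s)"
      by (simp add: has_vector_derivative_def inner_scaleR_left mult.assoc)
    then show ?thesis by (rule has_vector_derivative_at_within)
  qed
  have I: "(?\<psi>' has_integral f (sgn (?z 1)) - f (sgn (?z 0))) {0..1}"
    by (rule fundamental_theorem_of_calculus) (use deriv in auto)
  have contz: "continuous_on {0..1} (\<lambda>s. sgn (?z s))"
    unfolding sgn_div_norm using nz by (intro continuous_intros) auto
  have contD: "continuous_on {0..1} (\<lambda>s. Df (sgn (?z s)))"
    by (rule continuous_on_compose2[OF cont contz]) auto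
  have contg: "continuous_on {0..1} (\<lambda>s. norm h * g (?z s))"
    unfolding g_def tangential_def using nz by (intro continuous_intros contD contz) auto
  have J: "((\<lambda>s. norm h * g (?z s)) has_integral integral {0..1} (\<lambda>s. norm h * g (?z s))) {0..1}"
    using integrable_continuous_interval[OF contg] by (rule integrable_integral)
  have le: "norm (?\<psi>' s) \<le> norm h * g (?z s)" for s
  proof -
    have "?\<psi>' s = (h \<bullet> tangential (?z s) (Df (sgn (?z s)))) / norm (?z s)"
      by (simp add: inner_tangential inverse_eq_divide)
    then show ?thesis
      unfolding g_def using Cauchy_Schwarz_ineq2[of h "tangential (?z s) (Df (sgn (?z s)))"]
      by (simp add: divide_right_mono)
  qed
  have "\<bar>f (sgn (y + h)) - f (sgn y)\<bar> \<le> integral {0..1} (\<lambda>s. norm h * g (?z s))"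
    using integral_norm_bound_integral[OF has_integral_integrable[OF I] has_integral_integrable[OF J] le] integral_unique[OF I]
    by simp
  moreover have "(\<integral>\<^sup>+s. ennreal (norm h * g (y + s *\<^sub>R h)) * indicator {0..1} s \<partial>lborel) = ennreal (integral {0..1} (\<lambda>s. norm h * g (?z s)))"
    by (rule nn_integral_has_integral_lebesgue'[OF _ J]) (simp add: g_def)
  ultimately show ?thesis by (simp add: ennreal_leI)
qed

lemma AE_line_avoids_0:
  fixes h :: "'a::euclidean_space"
  assumes "2 \<le> DIM('a)"
  shows "AE y in lborel. \<forall>s. y + s *\<^sub>R h \<noteq> 0"
proof -
  have "dim (span {h}) \<le> card {h}" by (subst dim_span) (rule dim_le_card', simp)
  then have "negligible (span {h})" using assms by (intro negligible_lowdim) simp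
  then have "AE y in lebesgue. y \<notin> span {h}"
    by (simp add: negligible_iff_null_sets AE_not_in)
  then have "AE y in lborel. y \<notin> span {h}"
    by (rule AE_completion_iff[THEN iffD1])
  then show ?thesis
  proof eventually_elim
    case (elim y)
    then show ?case
      by (metis add_eq_0_iff2 span_base singletonI span_neg span_scale)
  qed
qed


lemma sgn_sgn_vector [simp]: "sgn (sgn x) = sgn (x :: 'a::real_normed_vector)"
  by (cases "x = 0") (simp_all add: sgn_div_norm)

lemma tangential_sgn [simp]: "tangential (sgn x) v = tangential x v"
  by (simp add: tangential_def)

lemma tangential_measurable [measurable]:
  assumes [measurable]: "f \<in> borel_measurable M" "g \<in> borel_measurable M"
  shows "(\<lambda>x. tangential (f x) (g x :: 'a::euclidean_space)) \<in> borel_measurable M"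
  unfolding tangential_def by measurable

lemma AE_cone_measure: "AE w in cone_measure. norm (w::'a::euclidean_space) = 1"
proof (rule AE_I)
  show "{w \<in> space cone_measure. norm w \<noteq> 1} \<subseteq> {w::'a. norm w \<noteq> 1}" by simp
  have m: "{w::'a. norm w \<noteq> 1} \<in> sets borel" by measurable
  then show "{w::'a. norm w \<noteq> 1} \<in> sets cone_measure" by simp
  have "emeasure cone_measure {w::'a. norm w \<noteq> 1} \<le> emeasure lborel {0::'a}"
    unfolding emeasure_cone_measure[OF m] by (rule emeasure_mono) (auto simp: norm_sgn)
  then show "emeasure cone_measure {w::'a. norm w \<noteq> 1} = 0" by simp
qed

lemma nn_integral_lborel_translate:
  assumes [measurable]: "f \<in> borel_measurable borel"
  shows "(\<integral>\<^sup>+y. f (y + c) \<partial>lborel) = (\<integral>\<^sup>+y. f (y::'a::euclidean_space) \<partial>lborel)"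
proof -
  have "(\<integral>\<^sup>+y. f y \<partial>lborel) = (\<integral>\<^sup>+y. f y \<partial>distr lborel borel ((+) c))"
    by (simp add: lborel_distr_plus)
  also have "\<dots> = (\<integral>\<^sup>+y. f (y + c) \<partial>lborel)"
    by (subst nn_integral_distr) (simp_all add: add.commute)
  finally show ?thesis by simp
qed

lemma nn_integral_polar_product:
  fixes f :: "'a::euclidean_space \<Rightarrow> ennreal"
  assumes [measurable]: "f \<in> borel_measurable borel" "g \<in> borel_measurable borel"
  shows "(\<integral>\<^sup>+x. g (norm x) * f (sgn x) \<partial>lborel) =
    (\<integral>\<^sup>+r. g r \<partial>radius_measure DIM('a)) * (\<integral>\<^sup>+w. f w \<partial>cone_measure)"
proof -
  have "(\<integral>\<^sup>+x. g (norm x) * f (sgn x) \<partial>lborel) =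
      (\<integral>\<^sup>+r. (\<integral>\<^sup>+w. g (norm (r *\<^sub>R w)) * f (sgn (r *\<^sub>R w)) \<partial>(cone_measure :: 'a measure)) \<partial>radius_measure DIM('a))"
    by (rule nn_integral_polar) measurable
  also have "\<dots> = (\<integral>\<^sup>+r. g r * (\<integral>\<^sup>+w. f w \<partial>cone_measure) \<partial>radius_measure DIM('a))"
  proof (intro nn_integral_cong_AE)
    have "AE r in radius_measure DIM('a). 0 < r"
      unfolding radius_measure_def by (subst AE_density) (auto simp: indicator_def)
    then show "AE r in radius_measure DIM('a).
      (\<integral>\<^sup>+w. g (norm (r *\<^sub>R w)) * f (sgn (r *\<^sub>R w)) \<partial>(cone_measure :: 'a measure)) = g r * (\<integral>\<^sup>+w. f w \<partial>cone_measure)"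
    proof eventually_elim
      case (elim r)
      have "(\<integral>\<^sup>+w. g (norm (r *\<^sub>R w)) * f (sgn (r *\<^sub>R w)) \<partial>cone_measure) = (\<integral>\<^sup>+w. g r * f w \<partial>(cone_measure :: 'a measure))"
        by (rule nn_integral_cong_AE) (use AE_cone_measure in eventually_elim, use elim in \<open>simp add: sgn_scaleR, simp add: sgn_div_norm\<close>)
      also have "\<dots> = g r * (\<integral>\<^sup>+w. f w \<partial>cone_measure)"
        by (rule nn_integral_cmult) simp
      finally show ?case .
    qed
  qed
  also have "\<dots> = (\<integral>\<^sup>+r. g r \<partial>radius_measure DIM('a)) * (\<integral>\<^sup>+w. f w \<partial>cone_measure)"
    by (rule nn_integral_multc) simp
  finally show ?thesis .
qed

lemma nn_integral_radius_measure:
  assumes [measurable]: "g \<in> borel_measurable borel"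
  shows "(\<integral>\<^sup>+r. g r \<partial>radius_measure n) = (\<integral>\<^sup>+r. ennreal (real n * r ^ (n - 1)) * indicator {0<..} r * g r \<partial>lborel)"
  unfolding radius_measure_def by (rule nn_integral_density) measurable

text \<open>
  Integrability of \<open>1 / norm z\<close> near the origin in dimension at least \<open>2\<close>.
\<close>

lemma nn_integral_radius_inverse:
  assumes "2 \<le> n" "0 \<le> \<rho>"
  shows "(\<integral>\<^sup>+r. ennreal (1 / r) * indicator {..\<rho>} r \<partial>radius_measure n) = ennreal (real n / real (n - 1) * \<rho> ^ (n - 1))"
proof -
  have "(\<integral>\<^sup>+r. ennreal (1 / r) * indicator {..\<rho>} r \<partial>radius_measure n) =
     (\<integral>\<^sup>+r. ennreal (real n / real (n - 1)) * (ennreal (real (n - 1) * r ^ (n - 1 - 1)) * indicator {0<..\<rho>} r) \<partial>lborel)"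
  proof (subst nn_integral_radius_measure, measurable, rule nn_integral_cong)
    fix r :: real
    have "real n * r ^ (n - 1) * (1 / r) = real n / real (n - 1) * (real (n - 1) * r ^ (n - 1 - 1))" if "0 < r"
    proof -
      have "r ^ (n - 1) = r * r ^ (n - 1 - 1)"
        using assms by (metis Suc_diff_1 diff_is_0_eq' less_numeral_extra(3) not_gr_zero numeral_2_eq_2 not_less_eq_eq power_Suc One_nat_def zero_less_diff Suc_le_lessD)
      then show ?thesis using that assms by simp
    qed
    then show "ennreal (real n * r ^ (n - 1)) * indicator {0<..} r * (ennreal (1 / r) * indicator {..\<rho>} r) =
         ennreal (real n / real (n - 1)) * (ennreal (real (n - 1) * r ^ (n - 1 - 1)) * indicator {0<..\<rho>} r)"
      by (auto simp: indicator_def simp flip: ennreal_mult)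
  qed
  also have "\<dots> = ennreal (real n / real (n - 1)) * ennreal (\<rho> ^ (n - 1))"
    using assms nn_integral_radius[of \<rho> "n - 1"] by (subst nn_integral_cmult) (auto simp del: of_nat_diff)
  finally show ?thesis using assms by (simp add: ennreal_mult[symmetric])
qed

text \<open>
  The integral of \<open>sphere_chord_bound\<close> over \<open>y\<close>; translation invariance of
  Lebesgue measure turns every point of the segment into a point of the ball of radius \<open>1 + norm
  h\<close>, and polar coordinates turn the integral over this ball into one over the sphere.
\<close>

lemma sphere_translation_bound:
  fixes f :: "'a::euclidean_space \<Rightarrow> real"
  assumes dim: "2 \<le> DIM('a)"
    and f: "\<And>x. GDERIV f x :> Df x" and cont: "continuous_on UNIV Df"
  shows "(\<integral>\<^sup>+y. ennreal \<bar>f (sgn (y + h)) - f (sgn y)\<bar> * indicator (cball 0 1) y \<partial>lborel) \<le>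
    ennreal (norm h * (real DIM('a) / real (DIM('a) - 1) * (1 + norm h) ^ (DIM('a) - 1))) *
    sphere_variation Df"
proof -
  have [measurable]: "Df \<in> borel_measurable borel"
    using cont by (rule borel_measurable_continuous_onI)
  define g where "g z = norm (tangential z (Df (sgn z))) / norm z" for z
  have [measurable]: "g \<in> borel_measurable borel" unfolding g_def by measurable
  have "(\<integral>\<^sup>+y. ennreal \<bar>f (sgn (y + h)) - f (sgn y)\<bar> * indicator (cball 0 1) y \<partial>lborel) \<le>
    (\<integral>\<^sup>+y. (\<integral>\<^sup>+s. ennreal (norm h * g (y + s *\<^sub>R h)) * indicator {0..1} s * indicator (cball 0 1) y \<partial>lborel) \<partial>lborel)"
  proof (rule nn_integral_mono_AE, use AE_line_avoids_0[OF dim, of h] in eventually_elim)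
    case (elim y)
    show ?case
      using sphere_chord_bound[OF f cont, of y h] elim
      by (cases "y \<in> cball 0 1") (simp_all add: g_def)
  qed
  also have "\<dots> = (\<integral>\<^sup>+s. (\<integral>\<^sup>+y. ennreal (norm h * g (y + s *\<^sub>R h)) * indicator {0..1} s * indicator (cball 0 1) y \<partial>lborel) \<partial>lborel)"
    by (rule lborel_pair.Fubini') measurable
  also have "\<dots> \<le> (\<integral>\<^sup>+s. indicator {0..1::real} s * (\<integral>\<^sup>+z. ennreal (norm h * g z) * indicator (cball 0 (1 + norm h)) z \<partial>lborel) \<partial>lborel)"
  proof (rule nn_integral_mono)
    fix s :: real
    show "(\<integral>\<^sup>+y. ennreal (norm h * g (y + s *\<^sub>R h)) * indicator {0..1} s * indicator (cball 0 1) y \<partial>lborel) \<le>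
      indicator {0..1} s * (\<integral>\<^sup>+z. ennreal (norm h * g z) * indicator (cball 0 (1 + norm h)) z \<partial>lborel)"
    proof (cases "s \<in> {0..1}")
      case True
      have "(\<integral>\<^sup>+y. ennreal (norm h * g (y + s *\<^sub>R h)) * indicator (cball 0 1) y \<partial>lborel) \<le>
        (\<integral>\<^sup>+y. ennreal (norm h * g (y + s *\<^sub>R h)) * indicator (cball 0 (1 + norm h)) (y + s *\<^sub>R h) \<partial>lborel)"
      proof (intro nn_integral_mono mult_left_mono)
        fix y :: 'a
        have "norm (y + s *\<^sub>R h) \<le> 1 + norm h" if "norm y \<le> 1"
        proof -
          have "norm (s *\<^sub>R h) \<le> 1 * norm h"
            unfolding norm_scaleR using True by (intro mult_right_mono) auto
          then show ?thesis using norm_triangle_ineq[of y "s *\<^sub>R h"] that by simp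
        qed
        then show "(indicator (cball 0 1) y :: ennreal) \<le> indicator (cball 0 (1 + norm h)) (y + s *\<^sub>R h)"
          by (auto simp: indicator_def)
      qed simp
      also have "\<dots> = (\<integral>\<^sup>+z. ennreal (norm h * g z) * indicator (cball 0 (1 + norm h)) z \<partial>lborel)"
        by (rule nn_integral_lborel_translate[of "\<lambda>z. ennreal (norm h * g z) * indicator (cball 0 (1 + norm h)) z"]) measurable
      finally show ?thesis using True by simp
    qed simp
  qed
  also have "\<dots> = (\<integral>\<^sup>+z. ennreal (norm h * g z) * indicator (cball 0 (1 + norm h)) z \<partial>lborel)"
    by (subst nn_integral_multc) simp_all
  also have "\<dots> = (\<integral>\<^sup>+z. (ennreal (norm h) * (ennreal (1 / norm z) * indicator {..1 + norm h} (norm z))) * ennreal (norm (tangential (sgn z) (Df (sgn z)))) \<partial>lborel)"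
    by (rule nn_integral_cong) (auto simp: g_def indicator_def simp flip: ennreal_mult)
  also have "\<dots> = (\<integral>\<^sup>+r. ennreal (norm h) * (ennreal (1 / r) * indicator {..1 + norm h} r) \<partial>radius_measure DIM('a)) *
    sphere_variation Df"
    by (rule nn_integral_polar_product) measurable
  also have "(\<integral>\<^sup>+r. ennreal (norm h) * (ennreal (1 / r) * indicator {..1 + norm h} r) \<partial>radius_measure DIM('a)) =
     ennreal (norm h * (real DIM('a) / real (DIM('a) - 1) * (1 + norm h) ^ (DIM('a) - 1)))"
    by (subst nn_integral_cmult) (use dim in \<open>simp_all add: nn_integral_radius_inverse flip: ennreal_mult\<close>)
  finally show ?thesis .
qed


definition poincare_const :: "'a::euclidean_space itself \<Rightarrow> real" where
  "poincare_const _ = 2 * unit_ball_vol DIM('a) * (real DIM('a) / real (DIM('a) - 1) * 3 ^ (DIM('a) - 1))"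

text \<open>
  At least half of the volume of a cone in the unit ball lies outside the ball of radius
  \<open>1/2\<close>, so \<open>sphere_poincare\<close> may stay away from the origin, where a small
  translation can change the direction arbitrarily.
\<close>

lemma radius_measure_half:
  assumes "1 \<le> n"
  shows "ennreal (1/2) \<le> (\<integral>\<^sup>+r. indicator {1/2..1} r \<partial>radius_measure n)"
proof -
  have n: "n > 0" using assms by simp
  have "(1/2 :: real) ^ n \<le> 1/2"
    using power_decreasing[of 1 n "1/2 :: real"] assms by simp
  have half: "ennreal (1/2) + ennreal (1/2) = ennreal 1"
    by (subst ennreal_plus[symmetric]) auto
  have "ennreal 1 \<le> emeasure (radius_measure n) {..1}"
    using emeasure_radius_measure[OF n, of 1] by simp
  also have "\<dots> \<le> emeasure (radius_measure n) ({..1/2} \<union> {1/2..1})"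
    by (rule emeasure_mono) auto
  also have "\<dots> \<le> emeasure (radius_measure n) {..1/2} + emeasure (radius_measure n) {1/2..1}"
    by (rule emeasure_subadditive) auto
  also have "\<dots> \<le> ennreal (1/2) + emeasure (radius_measure n) {1/2..1}"
    using ennreal_leI[OF \<open>(1/2) ^ n \<le> 1/2\<close>] emeasure_radius_measure[OF n, of "1/2"]
    by (intro add_right_mono) simp
  finally have "ennreal (1/2) + ennreal (1/2) \<le> ennreal (1/2) + emeasure (radius_measure n) {1/2..1}"
    unfolding half .
  then have "ennreal (1/2) = \<infinity> \<or> ennreal (1/2) \<le> emeasure (radius_measure n) {1/2..1}"
    by (simp only: ennreal_add_left_cancel_le)
  then have "ennreal (1/2) \<le> emeasure (radius_measure n) {1/2..1}"
    by (metis ennreal_neq_top infinity_ennreal_def)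
  then show ?thesis by simp
qed

text \<open>
  If every point sees, within distance \<open>\<rho>\<close>, a set of volume \<open>\<delta>\<close> on
  which \<open>f\<close> vanishes, then the integral of \<open>\<bar>f (sgn (y + h)) - f (sgn
  y)\<bar>\<close> over translations \<open>h\<close> in the ball of radius \<open>\<rho>\<close>
  controls \<open>f\<close>, while \<open>sphere_translation_bound\<close> bounds that integral by the
  variation.
\<close>

lemma sphere_poincare:
  fixes f :: "'a::euclidean_space \<Rightarrow> real"
  assumes dim: "2 \<le> DIM('a)"
    and f: "\<And>x. GDERIV f x :> Df x" and cont: "continuous_on UNIV Df"
    and nonneg: "\<And>x. 0 \<le> f x"
    and \<rho>: "0 \<le> \<rho>" "\<rho> \<le> 2"
    and dense: "\<And>y. 1/2 \<le> norm y \<Longrightarrow> norm y \<le> 1 \<Longrightarrow> \<delta> \<le> emeasure lborel {h \<in> cball 0 \<rho>. f (sgn (y + h)) = 0}"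
  shows "\<delta> * (\<integral>\<^sup>+w. ennreal (f w) \<partial>cone_measure) \<le>
    ennreal (poincare_const TYPE('a) * \<rho> ^ Suc DIM('a)) * sphere_variation Df"
    (is "\<delta> * ?F \<le> _ * ?T")
proof -
  let ?n = "DIM('a)"
  define c where "c = real ?n / real (?n - 1)"
  have c: "0 \<le> c" by (simp add: c_def)
  have "continuous_on UNIV f" by (rule GDERIV_imp_continuous_on[OF f])
  then have [measurable]: "f \<in> borel_measurable borel"
    by (rule borel_measurable_continuous_onI)
  define D where "D y h = ennreal \<bar>f (sgn (y + h)) - f (sgn y)\<bar>" for y h
  have [measurable]: "(\<lambda>(y, h). D y h) \<in> borel_measurable (borel \<Otimes>\<^sub>M borel)"
    unfolding D_def by measurable
  have "\<delta> * (ennreal (1/2) * ?F) \<le> \<delta> * ((\<integral>\<^sup>+r. indicator {1/2..1} r \<partial>radius_measure ?n) * ?F)"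
    using radius_measure_half[of ?n] dim by (intro mult_left_mono mult_right_mono) auto
  also have "\<dots> = \<delta> * (\<integral>\<^sup>+y. indicator {1/2..1} (norm y) * ennreal (f (sgn y)) \<partial>(lborel :: 'a measure))"
    by (subst nn_integral_polar_product) auto
  also have "\<dots> = (\<integral>\<^sup>+y. indicator {1/2..1} (norm (y::'a)) * (\<delta> * ennreal (f (sgn y))) \<partial>lborel)"
    by (subst nn_integral_cmult[symmetric]) (auto intro!: nn_integral_cong simp: mult_ac)
  also have "\<dots> \<le> (\<integral>\<^sup>+y. (\<integral>\<^sup>+h. D y h * indicator (cball 0 \<rho>) h * indicator (cball 0 1) y \<partial>lborel) \<partial>lborel)"
  proof (rule nn_integral_mono)
    fix y :: 'a
    show "indicator {1/2..1} (norm y) * (\<delta> * ennreal (f (sgn y))) \<le> (\<integral>\<^sup>+h. D y h * indicator (cball 0 \<rho>) h * indicator (cball 0 1) y \<partial>lborel)"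
    proof (cases "norm y \<in> {1/2..1}")
      case True
      let ?E = "{h \<in> cball 0 \<rho>. f (sgn (y + h)) = 0}"
      have E: "?E \<in> sets lborel" by measurable
      have "\<delta> * ennreal (f (sgn y)) \<le> emeasure lborel ?E * ennreal (f (sgn y))"
        using dense[of y] True by (intro mult_right_mono) auto
      also have "\<dots> = (\<integral>\<^sup>+h. ennreal (f (sgn y)) * indicator ?E h \<partial>lborel)"
        using E by (subst nn_integral_cmult_indicator) (simp_all add: mult.commute)
      also have "\<dots> \<le> (\<integral>\<^sup>+h. D y h * indicator (cball 0 \<rho>) h * indicator (cball 0 1) y \<partial>lborel)"
        using True nonneg by (intro nn_integral_mono) (auto simp: indicator_def D_def)
      finally show ?thesis using True by simp
    qed simp
  qed
  also have "\<dots> = (\<integral>\<^sup>+h. (\<integral>\<^sup>+y. D y h * indicator (cball 0 \<rho>) h * indicator (cball 0 1) y \<partial>lborel) \<partial>lborel)"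
    by (rule lborel_pair.Fubini') measurable
  also have "\<dots> \<le> (\<integral>\<^sup>+h. (ennreal (\<rho> * (c * 3 ^ (?n - 1))) * ?T) * indicator (cball (0::'a) \<rho>) h \<partial>lborel)"
  proof (rule nn_integral_mono)
    fix h :: 'a
    show "(\<integral>\<^sup>+y. D y h * indicator (cball 0 \<rho>) h * indicator (cball 0 1) y \<partial>lborel) \<le> (ennreal (\<rho> * (c * 3 ^ (?n - 1))) * ?T) * indicator (cball 0 \<rho>) h"
    proof (cases "h \<in> cball 0 \<rho>")
      case True
      then have "(\<integral>\<^sup>+y. D y h * indicator (cball 0 \<rho>) h * indicator (cball 0 1) y \<partial>lborel) \<le>
         ennreal (norm h * (c * (1 + norm h) ^ (?n - 1))) * ?T"
        using sphere_translation_bound[OF dim f cont, of h] by (simp add: D_def c_def)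
      also have "\<dots> \<le> ennreal (\<rho> * (c * 3 ^ (?n - 1))) * ?T"
        using True \<rho> c by (intro mult_right_mono ennreal_leI mult_mono power_mono mult_nonneg_nonneg) auto
      finally show ?thesis using True by simp
    qed simp
  qed
  also have "\<dots> = (ennreal (\<rho> * (c * 3 ^ (?n - 1))) * ?T) * ennreal (unit_ball_vol ?n * \<rho> ^ ?n)"
    using \<rho> emeasure_cball[of \<rho> "0::'a"] by (subst nn_integral_cmult_indicator) simp_all
  finally have "ennreal 2 * (\<delta> * (ennreal (1/2) * ?F)) \<le> ennreal 2 * ((ennreal (\<rho> * (c * 3 ^ (?n - 1))) * ?T) * ennreal (unit_ball_vol ?n * \<rho> ^ ?n))"
    by (rule mult_left_mono) simp
  also have "ennreal 2 * (\<delta> * (ennreal (1/2) * ?F)) = (ennreal 2 * ennreal (1/2)) * (\<delta> * ?F)"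
    by (simp only: mult_ac)
  also have "ennreal 2 * ennreal (1/2) = 1"
    by (subst ennreal_mult[symmetric]) auto
  also have "ennreal 2 * ((ennreal (\<rho> * (c * 3 ^ (?n - 1))) * ?T) * ennreal (unit_ball_vol ?n * \<rho> ^ ?n)) =
     (ennreal 2 * ennreal (\<rho> * (c * 3 ^ (?n - 1))) * ennreal (unit_ball_vol ?n * \<rho> ^ ?n)) * ?T"
    by (simp only: mult_ac)
  also have "ennreal 2 * ennreal (\<rho> * (c * 3 ^ (?n - 1))) * ennreal (unit_ball_vol ?n * \<rho> ^ ?n) = ennreal (poincare_const TYPE('a) * \<rho> ^ Suc ?n)"
  proof -
    have "poincare_const TYPE('a) = 2 * unit_ball_vol ?n * (c * 3 ^ (?n - 1))"
      by (simp only: poincare_const_def c_def)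
    then show ?thesis using \<rho> c by (simp add: ennreal_mult[symmetric] mult_ac del: ennreal_numeral)
  qed
  finally show ?thesis by simp
qed

text \<open>
  The case used near the origin: any two points of the unit ball differ by a translation of length at
  most \<open>2\<close>.
\<close>

lemma sphere_poincare_large_zero_set:
  fixes f :: "'a::euclidean_space \<Rightarrow> real"
  assumes dim: "2 \<le> DIM('a)"
    and f: "\<And>x. GDERIV f x :> Df x" and cont: "continuous_on UNIV Df"
    and nonneg: "\<And>x. 0 \<le> f x"
  shows "emeasure cone_measure {w. f w = 0} * (\<integral>\<^sup>+w. ennreal (f w) \<partial>cone_measure) \<le>
    ennreal (poincare_const TYPE('a) * 2 ^ Suc DIM('a)) * sphere_variation Df"
proof (rule sphere_poincare[OF dim f cont nonneg])
  have "continuous_on UNIV f" by (rule GDERIV_imp_continuous_on[OF f])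
  then have [measurable]: "f \<in> borel_measurable borel"
    by (rule borel_measurable_continuous_onI)
  fix y :: 'a assume y: "1/2 \<le> norm y" "norm y \<le> 1"
  have "emeasure cone_measure {w. f w = 0} = emeasure lborel {z \<in> cball 0 1. f (sgn z) = 0}"
    by (subst emeasure_cone_measure) simp_all
  also have "\<dots> = (\<integral>\<^sup>+z. indicator {z \<in> cball 0 1. f (sgn z) = 0} z \<partial>lborel)"
    by (rule nn_integral_indicator[symmetric]) measurable
  also have "\<dots> = (\<integral>\<^sup>+h. indicator {z \<in> cball 0 1. f (sgn z) = 0} (h + y) \<partial>lborel)"
    by (rule nn_integral_lborel_translate[symmetric]) measurable
  also have "\<dots> \<le> (\<integral>\<^sup>+h. indicator {h \<in> cball 0 2. f (sgn (y + h)) = 0} h \<partial>lborel)"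
  proof (rule nn_integral_mono)
    fix h
    have "norm h \<le> 2" if "norm (h + y) \<le> 1"
      using that y norm_triangle_ineq4[of "h + y" y] by simp
    then show "(indicator {z \<in> cball 0 1. f (sgn z) = 0} (h + y) :: ennreal) \<le> indicator {h \<in> cball 0 2. f (sgn (y + h)) = 0} h"
      by (auto simp: indicator_def add.commute)
  qed
  also have "\<dots> = emeasure lborel {h \<in> cball 0 2. f (sgn (y + h)) = 0}"
    by (rule nn_integral_indicator) measurable
  finally show "emeasure cone_measure {w. f w = 0} \<le> emeasure lborel {h \<in> cball 0 2. f (sgn (y + h)) = 0}" .
qed simp_all

text \<open>
  The density of the radius measure is bounded by its value at \<open>2\<close>.
\<close>

lemma radius_measure_interval:
  assumes "0 \<le> a" "a \<le> b" "b \<le> 2"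
  shows "(\<integral>\<^sup>+r. indicator {a..b} r \<partial>radius_measure n) \<le> ennreal (real n * 2 ^ (n - 1) * (b - a))"
proof -
  have "(\<integral>\<^sup>+r. indicator {a..b} r \<partial>radius_measure n) \<le> (\<integral>\<^sup>+r. ennreal (real n * 2 ^ (n - 1)) * indicator {a..b} r \<partial>lborel)"
  proof (subst nn_integral_radius_measure, measurable, rule nn_integral_mono)
    fix r :: real
    show "ennreal (real n * r ^ (n - 1)) * indicator {0<..} r * indicator {a..b} r \<le> ennreal (real n * 2 ^ (n - 1)) * indicator {a..b} r"
      using assms by (auto simp: indicator_def intro!: ennreal_leI mult_left_mono power_mono)
  qed
  also have "\<dots> = ennreal (real n * 2 ^ (n - 1) * (b - a))"
    using assms by (subst nn_integral_cmult_indicator) (auto simp: ennreal_mult)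
  finally show ?thesis .
qed

text \<open>
  The case used near the outer sphere: a ball of radius \<open>\<rho>\<close> meets the cone over the
  support in volume of order \<open>\<rho> * \<tau>\<close>, which is at most half of the ball once \<open>\<rho>\<close> is a large multiple of the radius of a cap of
  measure \<open>\<tau>\<close>.
\<close>

lemma sphere_poincare_small_support:
  fixes f :: "'a::euclidean_space \<Rightarrow> real"
  assumes dim: "2 \<le> DIM('a)"
    and f: "\<And>x. GDERIV f x :> Df x" and cont: "continuous_on UNIV Df"
    and nonneg: "\<And>x. 0 \<le> f x"
    and \<rho>: "0 \<le> \<rho>" "\<rho> \<le> 1/2" and \<tau>: "0 \<le> \<tau>"
    and supp: "emeasure cone_measure {w. f w \<noteq> 0} \<le> ennreal \<tau>"
    and small: "real DIM('a) * 2 ^ DIM('a) * (\<rho> * \<tau>) \<le> unit_ball_vol DIM('a) * \<rho> ^ DIM('a) / 2"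
  shows "ennreal (unit_ball_vol DIM('a) * \<rho> ^ DIM('a) / 2) * (\<integral>\<^sup>+w. ennreal (f w) \<partial>cone_measure) \<le>
    ennreal (poincare_const TYPE('a) * \<rho> ^ Suc DIM('a)) * sphere_variation Df"
proof (rule sphere_poincare[OF dim f cont nonneg])
  let ?n = "DIM('a)"
  let ?V = "unit_ball_vol DIM('a) * \<rho> ^ DIM('a)"
  have "continuous_on UNIV f" by (rule GDERIV_imp_continuous_on[OF f])
  then have [measurable]: "f \<in> borel_measurable borel"
    by (rule borel_measurable_continuous_onI)
  fix y :: 'a assume y: "1/2 \<le> norm y" "norm y \<le> 1"
  let ?E = "{h \<in> cball 0 \<rho>. f (sgn (y + h)) = 0}" and ?S = "{h \<in> cball 0 \<rho>. f (sgn (y + h)) \<noteq> 0}"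
  have sets: "?E \<in> sets lborel" "?S \<in> sets lborel" by measurable
  have "emeasure lborel ?S = (\<integral>\<^sup>+h. indicator ?S h \<partial>lborel)"
    using sets by simp
  also have "\<dots> \<le> (\<integral>\<^sup>+h. indicator {norm y - \<rho>..norm y + \<rho>} (norm (h + y)) * indicator {w. f w \<noteq> 0} (sgn (h + y)) \<partial>lborel)"
  proof (rule nn_integral_mono)
    fix h
    have "norm (h + y) \<in> {norm y - \<rho>..norm y + \<rho>}" if "norm h \<le> \<rho>"
      using that norm_triangle_ineq[of h y] norm_diff_ineq[of y h] by (simp add: add.commute)
    then show "(indicator ?S h :: ennreal) \<le> indicator {norm y - \<rho>..norm y + \<rho>} (norm (h + y)) * indicator {w. f w \<noteq> 0} (sgn (h + y))"
      by (auto simp: indicator_def add.commute)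
  qed
  also have "\<dots> = (\<integral>\<^sup>+z. indicator {norm y - \<rho>..norm y + \<rho>} (norm z) * indicator {w. f w \<noteq> 0} (sgn z) \<partial>lborel)"
    by (rule nn_integral_lborel_translate[of "\<lambda>z. indicator {norm y - \<rho>..norm y + \<rho>} (norm z) * indicator {w. f w \<noteq> 0} (sgn z)"]) measurable
  also have "\<dots> = (\<integral>\<^sup>+r. indicator {norm y - \<rho>..norm y + \<rho>} r \<partial>radius_measure ?n) * emeasure cone_measure {w. f w \<noteq> 0}"
    by (subst nn_integral_polar_product) auto
  also have "\<dots> \<le> ennreal (real ?n * 2 ^ (?n - 1) * ((norm y + \<rho>) - (norm y - \<rho>))) * ennreal \<tau>"
    using supp \<rho> y by (intro mult_mono radius_measure_interval) auto
  also have "\<dots> = ennreal (real ?n * 2 ^ ?n * (\<rho> * \<tau>))"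
  proof -
    have "(2::real) ^ ?n = 2 * 2 ^ (?n - 1)"
      using dim by (metis DIM_positive Suc_diff_1 power_Suc)
    then show ?thesis using \<rho> \<tau> by (simp add: ennreal_mult[symmetric] mult_ac)
  qed
  also have "\<dots> \<le> ennreal (?V / 2)" using small by (rule ennreal_leI)
  finally have S: "emeasure lborel ?S \<le> ennreal (?V / 2)" .
  have "ennreal (?V / 2) + ennreal (?V / 2) = ennreal ?V"
    using \<rho> by (subst ennreal_plus[symmetric]) auto
  also have "\<dots> = emeasure lborel (cball (0::'a) \<rho>)"
    using emeasure_cball[of \<rho> "0::'a"] \<rho> by simp
  also have "cball (0::'a) \<rho> = ?S \<union> ?E" by auto
  also have "emeasure lborel (?S \<union> ?E) \<le> emeasure lborel ?S + emeasure lborel ?E"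
    using sets by (intro emeasure_subadditive)
  also have "\<dots> \<le> ennreal (?V / 2) + emeasure lborel ?E"
    using S by (rule add_right_mono)
  finally show "ennreal (?V / 2) \<le> emeasure lborel ?E"
    unfolding ennreal_add_left_cancel_le by simp
qed (use \<rho> in simp_all)


lemma DERIV_abs_power:
  assumes "2 \<le> n"
  shows "((\<lambda>x::real. \<bar>x\<bar> ^ n) has_real_derivative real n * (\<bar>x\<bar> ^ (n - 2) * x)) (at x)"
proof -
  have n: "n = Suc (Suc (n - 2))" "n - 1 = Suc (n - 2)" using assms by auto
  consider "0 < x" | "x < 0" | "x = 0" by linarith
  then show ?thesis
  proof cases
    case 1
    have "((\<lambda>x::real. x ^ n) has_real_derivative real n * (\<bar>x\<bar> ^ (n - 2) * x)) (at x)"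
      by (rule DERIV_cong[OF DERIV_power[OF DERIV_ident]]) (use 1 n(2) in simp)
    then show ?thesis
      by (rule has_field_derivative_transform_within_open[of _ _ _ "{0<..}"]) (use 1 in auto)
  next
    case 2
    have "((\<lambda>x::real. (- x) ^ n) has_real_derivative real n * (\<bar>x\<bar> ^ (n - 2) * x)) (at x)"
      by (rule DERIV_cong[OF DERIV_power[OF DERIV_minus[OF DERIV_ident]]]) (use 2 n(2) in simp)
    then show ?thesis
      by (rule has_field_derivative_transform_within_open[of _ _ _ "{..<0}"]) (use 2 in auto)
  next
    case 3
    have "((\<lambda>h::real. \<bar>h\<bar> ^ (n - 2) * h) \<longlongrightarrow> \<bar>0\<bar> ^ (n - 2) * 0) (at 0)"
      by (intro tendsto_intros)
    moreover have "\<bar>h\<bar> ^ (n - 2) * h = \<bar>h\<bar> ^ n / h" for h :: real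
    proof -
      have "\<bar>h\<bar> ^ n = \<bar>h\<bar> ^ (n - 2) * (h * h)"
        by (subst n(1)) (simp add: mult_ac flip: abs_mult)
      then show ?thesis by simp
    qed
    ultimately have "((\<lambda>h::real. \<bar>h\<bar> ^ n / h) \<longlongrightarrow> 0) (at 0)"
      by simp
    then show ?thesis using 3 assms by (simp add: DERIV_def zero_power)
  qed
qed

text \<open>
  A crude form of Young's inequality: compare \<open>b\<close> with \<open>s * a\<close>.
\<close>

lemma mult_power_le_young:
  fixes a b s :: real
  assumes "0 \<le> a" "0 \<le> b" "0 < s" and "1 \<le> n"
  shows "a ^ (n - 1) * b \<le> s * a ^ n + b ^ n / s ^ (n - 1)"
proof (cases "b \<le> s * a")
  case True
  then have "a ^ (n - 1) * b \<le> a ^ (n - 1) * (s * a)" using assms by (intro mult_left_mono) auto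
  also have "\<dots> = s * a ^ n" using power_Suc2[of a "n - 1"] \<open>1 \<le> n\<close> by simp
  finally show ?thesis using assms by (simp add: add_increasing2)
next
  case False
  then have "a \<le> b / s" using assms by (simp add: field_simps)
  then have "a ^ (n - 1) * b \<le> (b / s) ^ (n - 1) * b" using assms by (intro mult_right_mono power_mono) auto
  also have "\<dots> = b ^ n / s ^ (n - 1)"
    using power_Suc2[of b "n - 1"] \<open>1 \<le> n\<close> by (simp add: power_divide)
  finally show ?thesis using assms by (simp add: add_increasing)
qed

lemma GDERIV_abs_power_dilation:
  assumes \<phi>: "\<And>x. GDERIV \<phi> x :> D\<phi> x" and n: "2 \<le> n"
  shows "GDERIV (\<lambda>x. \<bar>\<phi> (r *\<^sub>R x)\<bar> ^ n) x :> power_gradient n \<phi> D\<phi> r x"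
proof -
  have "((\<lambda>x. r *\<^sub>R x) has_derivative (\<lambda>h. r *\<^sub>R h)) (at x)" by (auto intro!: derivative_eq_intros)
  from has_derivative_compose[OF this \<phi>[unfolded gderiv_def]]
  have "((\<lambda>x. \<phi> (r *\<^sub>R x)) has_derivative (\<lambda>h. (r *\<^sub>R h) \<bullet> D\<phi> (r *\<^sub>R x))) (at x)" .
  from has_derivative_compose[OF this DERIV_abs_power[OF n, of "\<phi> (r *\<^sub>R x)", unfolded has_field_derivative_def]]
  show ?thesis by (simp add: gderiv_def mult_ac)
qed

text \<open>
  Apply an \<open>L1\<close> Poincare inequality to \<open>\<bar>\<phi>\<bar> ^ n\<close>, whose
  gradient is \<open>n * \<bar>\<phi>\<bar> ^ (n - 1)\<close> times that of \<open>\<phi>\<close>, and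
  absorb half of the mass by Young's inequality.  The absorption needs the mass to be finite, which
  holds because \<open>\<phi>\<close> is continuous.
\<close>

lemma sphere_energy_bound:
  fixes \<phi> :: "'a::euclidean_space \<Rightarrow> real"
  assumes n: "2 \<le> n"
    and \<phi>: "\<And>x. GDERIV \<phi> x :> D\<phi> x" and cont: "continuous_on UNIV D\<phi>"
    and r: "0 < r" and Q: "0 < Q"
    and poincare: "sphere_mass n \<phi> r \<le>
      ennreal Q * sphere_variation (power_gradient n \<phi> D\<phi> r)"
  shows "sphere_mass n \<phi> r \<le>
    ennreal ((2 * (Q * real n * r)) ^ n) * sphere_energy n D\<phi> r"
    (is "?F \<le> _ * ?T")
proof -
  define L where "L = Q * real n * r"
  have L: "0 < L" using Q r n by (simp add: L_def)
  have cont\<phi>: "continuous_on UNIV \<phi>" by (rule GDERIV_imp_continuous_on[OF \<phi>])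
  have [measurable]: "D\<phi> \<in> borel_measurable borel" "\<phi> \<in> borel_measurable borel"
    using cont cont\<phi> by (auto intro: borel_measurable_continuous_onI)
  have tang_scale: "tangential w (c *\<^sub>R v) = c *\<^sub>R tangential w v" for w v :: 'a and c
    by (simp add: tangential_def scaleR_right_diff_distrib)
  have "compact ((\<lambda>w. \<bar>\<phi> (r *\<^sub>R w)\<bar> ^ n) ` cball 0 1)"
    by (intro compact_continuous_image continuous_intros continuous_on_compose2[OF cont\<phi>]) auto
  then obtain M where M: "\<bar>\<phi> (r *\<^sub>R w)\<bar> ^ n \<le> M" if "norm w \<le> 1" for w
    using compact_imp_bounded by (fastforce simp: bounded_iff)
  have fin: "?F < \<infinity>"
  proof -
    have "?F \<le> (\<integral>\<^sup>+w. ennreal M \<partial>(cone_measure :: 'a measure))"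
      by (rule nn_integral_mono_AE, use AE_cone_measure in eventually_elim) (auto intro!: ennreal_leI M)
    also have "\<dots> < \<infinity>" by (simp add: emeasure_cone_measure_UNIV ennreal_mult_less_top)
    finally show ?thesis .
  qed
  have "?F \<le> ennreal Q * (\<integral>\<^sup>+w. ennreal (real n * r * (\<bar>\<phi> (r *\<^sub>R w)\<bar> ^ (n - 1) * norm (tangential w (D\<phi> (r *\<^sub>R w))))) \<partial>cone_measure)"
  proof (rule order_trans[OF poincare], rule mult_left_mono[OF nn_integral_mono])
    fix w
    have "\<bar>\<phi> (r *\<^sub>R w)\<bar> ^ (n - 1) = \<bar>\<phi> (r *\<^sub>R w)\<bar> ^ (n - 2) * \<bar>\<phi> (r *\<^sub>R w)\<bar>"
      using n by (metis Suc_diff_Suc Suc_1 Suc_le_lessD diff_Suc_1 power_Suc2 One_nat_def)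
    then show "ennreal (norm (tangential w (power_gradient n \<phi> D\<phi> r w)))
      \<le> ennreal (real n * r * (\<bar>\<phi> (r *\<^sub>R w)\<bar> ^ (n - 1) * norm (tangential w (D\<phi> (r *\<^sub>R w)))))"
      using r by (simp add: tang_scale abs_mult mult_ac)
  qed simp
  also have "\<dots> = (\<integral>\<^sup>+w. ennreal (L * (\<bar>\<phi> (r *\<^sub>R w)\<bar> ^ (n - 1) * norm (tangential w (D\<phi> (r *\<^sub>R w))))) \<partial>cone_measure)"
    using Q r by (subst nn_integral_cmult[symmetric]) (auto simp: L_def ennreal_mult[symmetric] mult_ac)
  also have "\<dots> \<le> (\<integral>\<^sup>+w. ennreal (1/2) * ennreal (\<bar>\<phi> (r *\<^sub>R w)\<bar> ^ n) + ennreal ((2 * L) ^ n / 2) * ennreal (norm (tangential w (D\<phi> (r *\<^sub>R w))) ^ n) \<partial>cone_measure)"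
  proof (rule nn_integral_mono)
    fix w
    let ?a = "\<bar>\<phi> (r *\<^sub>R w)\<bar>" and ?b = "norm (tangential w (D\<phi> (r *\<^sub>R w)))"
    have "L * (?a ^ (n - 1) * ?b) \<le> L * (1 / (2 * L) * ?a ^ n + ?b ^ n / (1 / (2 * L)) ^ (n - 1))"
      using L n by (intro mult_left_mono mult_power_le_young) auto
    also have "\<dots> = 1/2 * ?a ^ n + (2 * L) ^ n / 2 * ?b ^ n"
    proof -
      have "?b ^ n / (1 / (2 * L)) ^ (n - 1) = (2 * L) ^ (n - 1) * ?b ^ n"
        by (simp add: power_one_over)
      moreover have "(2 * L) ^ n = (2 * L) * (2 * L) ^ (n - 1)"
        using power_Suc[of "2 * L" "n - 1"] n by simp
      ultimately show ?thesis using L by (simp add: algebra_simps)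
    qed
    finally show "ennreal (L * (?a ^ (n - 1) * ?b)) \<le> ennreal (1/2) * ennreal (?a ^ n) + ennreal ((2 * L) ^ n / 2) * ennreal (?b ^ n)"
      using L by (simp add: ennreal_mult[symmetric] ennreal_plus[symmetric] ennreal_leI del: ennreal_plus ennreal_half)
  qed
  also have "\<dots> = ennreal (1/2) * ?F + ennreal ((2 * L) ^ n / 2) * ?T"
    by (subst nn_integral_add) (auto simp: nn_integral_cmult)
  finally have *: "?F \<le> ennreal (1/2) * ?F + ennreal ((2 * L) ^ n / 2) * ?T" .
  obtain x where x: "?F = ennreal x" "0 \<le> x" using fin by (cases ?F) auto
  show ?thesis
  proof (cases ?T)
    case (real t)
    then have "ennreal x \<le> ennreal (1/2 * x + (2 * L) ^ n / 2 * t)"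
      using * x(2) L real unfolding x(1) real
      by (subst ennreal_plus) (simp_all only: ennreal_mult[symmetric] zero_le_power mult_nonneg_nonneg
          divide_nonneg_nonneg zero_le_numeral zero_le_one less_imp_le)
    then have "x \<le> 1/2 * x + (2 * L) ^ n / 2 * t" using x L real by (subst (asm) ennreal_le_iff) auto
    then have "x \<le> (2 * L) ^ n * t" by simp
    then show ?thesis using x real L by (simp add: ennreal_mult[symmetric] ennreal_leI L_def)
  next
    case top
    then show ?thesis using Q r n by (simp add: ennreal_mult_top)
  qed
qed

section \<open>Hausdorff measure and surface measure on the unit sphere\<close>

abbreviation cover_weight :: "nat \<Rightarrow> 'a::metric_space set \<Rightarrow> ennreal" where
  "cover_weight k S \<equiv> if S = {} then 0 else ennreal (unit_ball_vol (real k) * (diameter S / 2) ^ k)"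

lemma hausdorff_premeasure_le_measure: "0 < d \<Longrightarrow> hausdorff_premeasure k d A \<le> hausdorff_measure k A"
  unfolding hausdorff_measure_def by (rule SUP_upper) simp

lemma hausdorff_premeasure_le_cover:
  assumes "A \<subseteq> (\<Union>i. C i)" "\<And>i. bounded (C i)" "\<And>i. diameter (C i) \<le> d"
  shows "hausdorff_premeasure k d A \<le> (\<Sum>i. cover_weight k (C i))"
  unfolding hausdorff_premeasure_def by (rule INF_lower) (use assms in auto)

lemma hausdorff_premeasure_antimono: "d \<le> d' \<Longrightarrow> hausdorff_premeasure k d' A \<le> hausdorff_premeasure k d A"
  unfolding hausdorff_premeasure_def by (rule INF_superset_mono) (auto intro: order_trans)

text \<open>
  Interleave two almost optimal covers.
\<close>

lemma hausdorff_premeasure_Un: "hausdorff_premeasure k d (A \<union> B) \<le> hausdorff_premeasure k d A + hausdorff_premeasure k d B"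
proof (cases "hausdorff_premeasure k d A < \<infinity> \<and> hausdorff_premeasure k d B < \<infinity>")
  case True
  define w where "w S = cover_weight k S" for S :: "'a set"
  show ?thesis
  proof (rule ennreal_le_epsilon)
    fix e :: real assume "0 < e"
    have "\<exists>C. A' \<subseteq> (\<Union>i. C i) \<and> (\<forall>i. bounded (C i) \<and> diameter (C i) \<le> d) \<and> (\<Sum>i. w (C i)) < hausdorff_premeasure k d A' + ennreal (e / 2)"
      if "hausdorff_premeasure k d A' < \<infinity>" for A'
    proof -
      have "hausdorff_premeasure k d A' < hausdorff_premeasure k d A' + ennreal (e / 2)"
        using that \<open>0 < e\<close> by (simp add: ennreal_add_left_cancel_less[of _ 0, simplified] del: ennreal_half)
      then show ?thesis
        unfolding hausdorff_premeasure_def[of k d A'] INF_less_iff w_def by auto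
    qed
    from this[of A] this[of B] True obtain C1 C2 where
      C1: "A \<subseteq> (\<Union>i. C1 i)" "\<And>i. bounded (C1 i) \<and> diameter (C1 i) \<le> d" "(\<Sum>i. w (C1 i)) < hausdorff_premeasure k d A + ennreal (e / 2)" and
      C2: "B \<subseteq> (\<Union>i. C2 i)" "\<And>i. bounded (C2 i) \<and> diameter (C2 i) \<le> d" "(\<Sum>i. w (C2 i)) < hausdorff_premeasure k d B + ennreal (e / 2)"
      by metis
    define C where "C i = (if even i then C1 (i div 2) else C2 (i div 2))" for i
    have "A \<union> B \<subseteq> (\<Union>i. C i)"
    proof
      fix x assume "x \<in> A \<union> B"
      then obtain i where "x \<in> C1 i \<or> x \<in> C2 i" using C1(1) C2(1) by auto
      then have "x \<in> C (2 * i) \<or> x \<in> C (2 * i + 1)" by (auto simp: C_def)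
      then show "x \<in> (\<Union>i. C i)" by blast
    qed
    then have "hausdorff_premeasure k d (A \<union> B) \<le> (\<Sum>i. w (C i))"
      unfolding w_def by (rule hausdorff_premeasure_le_cover) (auto simp: C_def C1(2) C2(2))
    also have "\<dots> \<le> (\<Sum>i. w (C1 i)) + (\<Sum>i. w (C2 i))"
    proof (rule suminf_le_const[OF summableI])
      fix n
      have "(\<Sum>i<n. w (C i)) \<le> (\<Sum>i<2 * n. w (C i))" by (rule sum_mono2) auto
      also have "\<dots> = (\<Sum>i<n. w (C1 i)) + (\<Sum>i<n. w (C2 i))"
        by (induction n) (simp_all add: C_def add_ac)
      also have "\<dots> \<le> (\<Sum>i. w (C1 i)) + (\<Sum>i. w (C2 i))"
        by (intro add_mono sum_le_suminf) auto
      finally show "(\<Sum>i<n. w (C i)) \<le> (\<Sum>i. w (C1 i)) + (\<Sum>i. w (C2 i))" .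
    qed
    also have "\<dots> \<le> (hausdorff_premeasure k d A + ennreal (e / 2)) + (hausdorff_premeasure k d B + ennreal (e / 2))"
      using C1(3) C2(3) by (intro add_mono) auto
    also have "\<dots> = hausdorff_premeasure k d A + hausdorff_premeasure k d B + (ennreal (e / 2) + ennreal (e / 2))"
      by (simp only: add_ac)
    also have "ennreal (e / 2) + ennreal (e / 2) = ennreal e"
      using \<open>0 < e\<close> by (subst ennreal_plus[symmetric]) auto
    finally show "hausdorff_premeasure k d (A \<union> B) \<le> hausdorff_premeasure k d A + hausdorff_premeasure k d B + ennreal e" .
  qed
next
  case False
  then show ?thesis by (auto simp: not_less top_unique)
qed

lemma hausdorff_measure_Un: "hausdorff_measure k (A \<union> B) \<le> hausdorff_measure k A + hausdorff_measure k B"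
proof -
  have "hausdorff_premeasure k d (A \<union> B) \<le> hausdorff_measure k A + hausdorff_measure k B" if "0 < d" for d
    using hausdorff_premeasure_Un[of k d A B] hausdorff_premeasure_le_measure[OF that, of k A]
      hausdorff_premeasure_le_measure[OF that, of k B] by (meson add_mono order_trans)
  then show ?thesis unfolding hausdorff_measure_def[of k "A \<union> B"] by (intro SUP_least) auto
qed

lemma diameter_scaleR_le:
  fixes S :: "'a::real_normed_vector set"
  assumes "bounded S" "S \<noteq> {}"
  shows "diameter ((\<lambda>x. c *\<^sub>R x) ` S) \<le> \<bar>c\<bar> * diameter S"
proof (rule diameter_le)
  fix x y assume "x \<in> (\<lambda>x. c *\<^sub>R x) ` S" "y \<in> (\<lambda>x. c *\<^sub>R x) ` S"
  then obtain a b where "a \<in> S" "b \<in> S" "x = c *\<^sub>R a" "y = c *\<^sub>R b" by auto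
  then show "norm (x - y) \<le> \<bar>c\<bar> * diameter S"
    using diameter_bounded_bound[OF assms(1), of a b]
    by (simp add: dist_norm mult_left_mono flip: scaleR_diff_right)
qed (use assms in auto)


lemma hausdorff_measure_scaleR_le:
  fixes A :: "'a::real_normed_vector set"
  assumes c: "0 < c"
  shows "hausdorff_measure k ((\<lambda>x. c *\<^sub>R x) ` A) \<le> ennreal (c ^ k) * hausdorff_measure k A"
proof -
  have "hausdorff_premeasure k d ((\<lambda>x. c *\<^sub>R x) ` A) \<le> ennreal (c ^ k) * hausdorff_measure k A" if "0 < d" for d
  proof -
    have "ennreal (inverse c ^ k) * hausdorff_premeasure k d ((\<lambda>x. c *\<^sub>R x) ` A) \<le> hausdorff_premeasure k (d / c) A"
      unfolding hausdorff_premeasure_def[of k "d / c" A]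
    proof (rule INF_greatest)
      fix C :: "nat \<Rightarrow> 'a set" assume "C \<in> {C. A \<subseteq> (\<Union>i. C i) \<and> (\<forall>i. bounded (C i) \<and> diameter (C i) \<le> d / c)}"
      then have C: "A \<subseteq> (\<Union>i. C i)" "\<And>i. bounded (C i)" "\<And>i. diameter (C i) \<le> d / c" by auto
      define C' where "C' i = (\<lambda>x. c *\<^sub>R x) ` C i" for i
      have dia: "diameter (C' i) \<le> c * diameter (C i)" if "C i \<noteq> {}" for i
        using diameter_scaleR_le[OF C(2) that, of c] c by (simp add: C'_def)
      have "diameter (C' i) \<le> d" for i
      proof (cases "C i = {}")
        case False
        then show ?thesis using dia[of i] C(3)[of i] c by (simp add: field_simps)
      qed (use \<open>0 < d\<close> in \<open>simp add: C'_def\<close>)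
      moreover have "(\<lambda>x. c *\<^sub>R x) ` A \<subseteq> (\<Union>i. C' i)"
        using C(1) unfolding C'_def by blast
      ultimately have "hausdorff_premeasure k d ((\<lambda>x. c *\<^sub>R x) ` A) \<le>
         (\<Sum>i. cover_weight k (C' i))"
        using C by (intro hausdorff_premeasure_le_cover) (simp_all add: C'_def bounded_scaling)
      then have "ennreal (inverse c ^ k) * hausdorff_premeasure k d ((\<lambda>x. c *\<^sub>R x) ` A) \<le>
         ennreal (inverse c ^ k) * (\<Sum>i. cover_weight k (C' i))"
        by (rule mult_left_mono) simp
      also have "\<dots> = (\<Sum>i. ennreal (inverse c ^ k) * cover_weight k (C' i))"
        by simp
      also have "\<dots> \<le> (\<Sum>i. cover_weight k (C i))"
      proof (rule suminf_le)
        fix i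
        show "ennreal (inverse c ^ k) * cover_weight k (C' i) \<le>
           cover_weight k (C i)"
        proof (cases "C i = {}")
          case False
          have bC': "bounded (C' i)" unfolding C'_def by (intro bounded_scaling C)
          have "inverse c ^ k * (unit_ball_vol (real k) * (diameter (C' i) / 2) ^ k) = unit_ball_vol (real k) * (inverse c * diameter (C' i) / 2) ^ k"
            by (simp add: power_mult_distrib power_divide)
          also have "\<dots> \<le> unit_ball_vol (real k) * (diameter (C i) / 2) ^ k"
          proof (intro mult_left_mono power_mono divide_right_mono)
            show "inverse c * diameter (C' i) \<le> diameter (C i)"
              using dia[OF False] c by (simp add: field_simps)
          qed (use c diameter_ge_0[OF bC'] in auto)
          finally show ?thesis using False c
            by (simp add: C'_def ennreal_mult'[symmetric] ennreal_leI)
        qed (simp add: C'_def)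
      qed auto
      finally show "ennreal (inverse c ^ k) * hausdorff_premeasure k d ((\<lambda>x. c *\<^sub>R x) ` A) \<le> (\<Sum>i. cover_weight k (C i))" .
    qed
    also have "\<dots> \<le> hausdorff_measure k A"
      using \<open>0 < d\<close> c by (intro hausdorff_premeasure_le_measure) simp
    finally have "ennreal (c ^ k) * (ennreal (inverse c ^ k) * hausdorff_premeasure k d ((\<lambda>x. c *\<^sub>R x) ` A)) \<le> ennreal (c ^ k) * hausdorff_measure k A"
      by (rule mult_left_mono) simp
    also have "ennreal (c ^ k) * (ennreal (inverse c ^ k) * hausdorff_premeasure k d ((\<lambda>x. c *\<^sub>R x) ` A)) = hausdorff_premeasure k d ((\<lambda>x. c *\<^sub>R x) ` A)"
      using c by (simp add: mult.assoc[symmetric] ennreal_mult[symmetric] power_inverse)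
    finally show ?thesis .
  qed
  then show ?thesis unfolding hausdorff_measure_def[of k "(\<lambda>x. c *\<^sub>R x) ` A"] by (intro SUP_least) auto
qed


text \<open>
  The cone over a cap of radius \<open>d\<close> lies in the \<open>d\<close>-neighbourhood of a segment
  of length \<open>1\<close>, which is covered by about \<open>1 / d\<close> balls of radius \<open>2 *
  d\<close>.
\<close>

lemma emeasure_cone_cball_le:
  fixes p :: "'a::euclidean_space"
  assumes p: "norm p = 1" and d: "0 < d" "d \<le> 1"
  shows "emeasure cone_measure (cball p d) \<le> ennreal (2 ^ Suc DIM('a) * unit_ball_vol DIM('a) * d ^ (DIM('a) - 1))"
proof -
  let ?n = "DIM('a)"
  define m where "m = nat \<lfloor>1 / d\<rfloor>"
  define P where "P = (\<lambda>k::nat. (real k * d) *\<^sub>R p) ` {..m}"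
  have "{x \<in> cball 0 1. sgn x \<in> cball p d} \<subseteq> (\<Union>k\<in>{..m}. cball ((real k * d) *\<^sub>R p) (2 * d))"
  proof (rule subsetI)
    fix x :: 'a assume "x \<in> {x \<in> cball 0 1. sgn x \<in> cball p d}"
    then have x: "norm x \<le> 1" "norm (p - sgn x) \<le> d" by (auto simp: dist_norm)
    define k where "k = nat \<lfloor>norm x / d\<rfloor>"
    have "k \<le> m" unfolding k_def m_def using x d by (intro nat_mono floor_mono divide_right_mono) auto
    have k: "real k \<le> norm x / d" "norm x / d \<le> real k + 1"
      unfolding k_def using d floor_correct[of "norm x / d"] by (simp_all add: of_nat_nat less_imp_le)
    have "(real k * d) *\<^sub>R p - x = norm x *\<^sub>R (p - sgn x) - (norm x - real k * d) *\<^sub>R p"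
      using norm_scaleR_sgn[of x] by (simp add: algebra_simps)
    then have "norm ((real k * d) *\<^sub>R p - x) \<le> norm (norm x *\<^sub>R (p - sgn x)) + norm ((norm x - real k * d) *\<^sub>R p)"
      by (metis norm_triangle_ineq4)
    also have "\<dots> = norm x * norm (p - sgn x) + \<bar>norm x - real k * d\<bar>"
      using p by simp
    also have "norm x * norm (p - sgn x) \<le> 1 * d"
      using x by (intro mult_mono) auto
    also have "\<bar>norm x - real k * d\<bar> \<le> d"
      using k d by (simp add: field_simps abs_le_iff)
    finally have "x \<in> cball ((real k * d) *\<^sub>R p) (2 * d)" by (simp add: dist_norm)
    then show "x \<in> (\<Union>k\<in>{..m}. cball ((real k * d) *\<^sub>R p) (2 * d))" using \<open>k \<le> m\<close> by blast
  qed
  then have "emeasure cone_measure (cball p d) \<le> emeasure lborel (\<Union>k\<in>{..m}. cball ((real k * d) *\<^sub>R p) (2 * d))"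
    by (subst emeasure_cone_measure) (auto intro!: emeasure_mono)
  also have "\<dots> \<le> (\<Sum>k\<in>{..m}. emeasure lborel (cball ((real k * d) *\<^sub>R p) (2 * d)))"
    by (rule emeasure_subadditive_finite) auto
  also have "\<dots> = (\<Sum>k\<in>{..m}. ennreal (unit_ball_vol ?n * (2 * d) ^ ?n))"
    using d by (intro sum.cong refl emeasure_cball) auto
  also have "\<dots> = ennreal ((real m + 1) * (unit_ball_vol ?n * (2 * d) ^ ?n))"
    using d by (simp add: ennreal_mult[symmetric] ennreal_of_nat_eq_real_of_nat ennreal_plus[symmetric] add.commute del: ennreal_plus flip: ennreal_1)
  also have "\<dots> \<le> ennreal (2 / d * (unit_ball_vol ?n * (2 * d) ^ ?n))"
  proof (intro ennreal_leI mult_right_mono)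
    have "real m \<le> 1 / d" unfolding m_def using d by (simp add: of_nat_floor)
    moreover have "1 \<le> 1 / d" using d by simp
    ultimately show "real m + 1 \<le> 2 / d" by simp
  qed (use d in auto)
  also have "2 / d * (unit_ball_vol ?n * (2 * d) ^ ?n) = 2 ^ Suc ?n * unit_ball_vol ?n * d ^ (?n - 1)"
    using d power_Suc[of d "?n - 1"] by (simp add: power_mult_distrib)
  finally show ?thesis .
qed

definition cone_le_hausdorff_const :: "'a::euclidean_space itself \<Rightarrow> real" where
  "cone_le_hausdorff_const _ = 2 ^ Suc DIM('a) * unit_ball_vol DIM('a) * 2 ^ (DIM('a) - 1) / unit_ball_vol (real (DIM('a) - 1))"


text \<open>
  Replace each covering set that meets \<open>A\<close> by a cap with centre in \<open>A\<close> and
  compare term by term.  Sets of diameter \<open>0\<close> have weight \<open>0\<close> in the cover;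
  they correspond to rays, which are null sets.
\<close>

lemma emeasure_cone_le_hausdorff:
  fixes A :: "'a::euclidean_space set"
  assumes dim: "2 \<le> DIM('a)" and A: "A \<in> sets borel" "A \<subseteq> sphere 0 1"
  shows "emeasure cone_measure A \<le> ennreal (cone_le_hausdorff_const TYPE('a)) * hausdorff_measure (DIM('a) - 1) A"
proof -
  let ?n = "DIM('a)" and ?v = "unit_ball_vol (real (DIM('a) - 1))" and ?K = "cone_le_hausdorff_const TYPE('a)"
  have v: "0 < ?v" by simp
  have K: "0 < ?K" using v by (simp add: cone_le_hausdorff_const_def)
  have piece: "emeasure cone_measure (cball p d) \<le> ennreal ?K * ennreal (?v * (d / 2) ^ (?n - 1))"
    if p: "norm p = 1" and d: "0 \<le> d" "d \<le> 1" for p :: 'a and d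
  proof (cases "d = 0")
    case False
    have "?K * (?v * (d / 2) ^ (?n - 1)) = 2 ^ Suc ?n * unit_ball_vol ?n * d ^ (?n - 1)"
      using v by (simp add: cone_le_hausdorff_const_def power_divide del: unit_ball_vol_pos of_nat_diff)
    then show ?thesis
      using emeasure_cone_cball_le[OF p, of d] d False K v by (simp add: ennreal_mult[symmetric])
  next
    case True
    define X where "X = {x \<in> cball (0::'a) 1. sgn x \<in> {p}}"
    have "X \<subseteq> span {p}"
    proof
      fix x assume "x \<in> X"
      then have "x = norm x *\<^sub>R p" using norm_scaleR_sgn[of x] by (simp add: X_def)
      then show "x \<in> span {p}" by (metis span_base singletonI span_scale)
    qed
    moreover have "negligible (span {p})"
    proof (rule negligible_lowdim)
      have "dim (span {p}) \<le> card {p}" by (subst dim_span) (rule dim_le_card', simp)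
      then show "dim (span {p}) < ?n" using dim by simp
    qed
    ultimately have "negligible X" by (rule negligible_subset[rotated])
    then have "emeasure lebesgue X = 0" by (simp add: negligible_iff_null_sets null_setsD1)
    moreover have "X \<in> sets lborel" unfolding X_def by measurable
    ultimately have "emeasure lborel X = 0" by (simp add: emeasure_completion)
    then have "emeasure cone_measure {p} = 0" by (subst emeasure_cone_measure) (simp_all add: X_def)
    then show ?thesis using True by simp
  qed
  have "emeasure cone_measure A \<le> ennreal ?K * hausdorff_premeasure (?n - 1) 1 A"
  proof -
    have "ennreal (inverse ?K) * emeasure cone_measure A \<le> hausdorff_premeasure (?n - 1) 1 A"
      unfolding hausdorff_premeasure_def
    proof (rule INF_greatest)
      fix C :: "nat \<Rightarrow> 'a set" assume "C \<in> {C. A \<subseteq> (\<Union>i. C i) \<and> (\<forall>i. bounded (C i) \<and> diameter (C i) \<le> 1)}"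
      then have C: "A \<subseteq> (\<Union>i. C i)" "\<And>i. bounded (C i)" "\<And>i. diameter (C i) \<le> 1" by auto
      define p where "p i = (SOME p. p \<in> C i \<inter> A)" for i
      define T where "T i = (if C i \<inter> A = {} then {} else cball (p i) (diameter (C i)))" for i
      have p: "p i \<in> C i \<inter> A" if "C i \<inter> A \<noteq> {}" for i
        using that unfolding p_def by (metis ex_in_conv someI_ex)
      have "A \<subseteq> (\<Union>i. T i)"
      proof
        fix x assume "x \<in> A"
        then obtain i where i: "x \<in> C i" using C(1) by auto
        then have ne: "C i \<inter> A \<noteq> {}" using \<open>x \<in> A\<close> by auto
        then have "x \<in> T i" using p[OF ne] i diameter_bounded_bound[OF C(2), of "p i" i x] by (simp add: T_def)
        then show "x \<in> (\<Union>i. T i)" by blast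
      qed
      moreover have T: "T i \<in> sets cone_measure" for i by (simp add: T_def)
      ultimately have "emeasure cone_measure A \<le> emeasure cone_measure (\<Union>i. T i)"
        by (intro emeasure_mono) auto
      also have "\<dots> \<le> (\<Sum>i. emeasure cone_measure (T i))"
        by (rule emeasure_subadditive_countably) (use T in auto)
      also have "\<dots> \<le> (\<Sum>i. ennreal ?K * cover_weight (?n - 1) (C i))"
      proof (rule suminf_le)
        fix i
        show "emeasure cone_measure (T i) \<le> ennreal ?K * cover_weight (?n - 1) (C i)"
        proof (cases "C i \<inter> A = {}")
          case False
          then have "norm (p i) = 1" using p[OF False] A(2) by auto
          then show ?thesis using False piece[of "p i" "diameter (C i)"] C(3) diameter_ge_0[OF C(2)]
            by (auto simp: T_def)
        qed (simp add: T_def)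
      qed auto
      also have "\<dots> = ennreal ?K * (\<Sum>i. cover_weight (?n - 1) (C i))"
        by (rule ennreal_suminf_cmult)
      finally have "ennreal (inverse ?K) * emeasure cone_measure A \<le> ennreal (inverse ?K) * (ennreal ?K * (\<Sum>i. cover_weight (?n - 1) (C i)))"
        by (rule mult_left_mono) simp
      also have "\<dots> = (\<Sum>i. cover_weight (?n - 1) (C i))"
        using K by (simp add: mult.assoc[symmetric] ennreal_mult[symmetric] del: ennreal_suminf_cmult)
      finally show "ennreal (inverse ?K) * emeasure cone_measure A \<le> (\<Sum>i. cover_weight (?n - 1) (C i))" .
    qed
    then have "ennreal ?K * (ennreal (inverse ?K) * emeasure cone_measure A) \<le> ennreal ?K * hausdorff_premeasure (?n - 1) 1 A"
      by (rule mult_left_mono) simp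
    then show ?thesis using K by (simp add: mult.assoc[symmetric] ennreal_mult[symmetric])
  qed
  also have "\<dots> \<le> ennreal ?K * hausdorff_measure (?n - 1) A"
    by (intro mult_left_mono hausdorff_premeasure_le_measure) auto
  finally show ?thesis .
qed

text \<open>
  Balls of radius \<open>s / 2\<close> around an \<open>s\<close>-separated set are disjoint and lie
  over \<open>S\<close> in a spherical shell of thickness \<open>s\<close>; compare volumes.
\<close>

lemma card_separated_le:
  fixes P :: "'a::euclidean_space set"
  assumes dim: "2 \<le> DIM('a)" and P: "finite P" "P \<subseteq> sphere 0 1" and s: "0 < s" "s \<le> 1"
    and sep: "\<And>p q. p \<in> P \<Longrightarrow> q \<in> P \<Longrightarrow> p \<noteq> q \<Longrightarrow> s \<le> dist p q"
    and S: "S \<in> sets borel" "\<And>p x. p \<in> P \<Longrightarrow> dist p x \<le> s \<Longrightarrow> x \<in> S"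
  shows "ennreal (real (card P) * (unit_ball_vol DIM('a) * (s / 2) ^ DIM('a))) \<le>
    ennreal (real DIM('a) * 2 ^ (DIM('a) - 1) * s) * emeasure cone_measure S"
proof -
  let ?n = "DIM('a)"
  have "ennreal (real (card P) * (unit_ball_vol ?n * (s / 2) ^ ?n)) = (\<Sum>p\<in>P. emeasure lborel (ball p (s / 2)))"
    using s by (simp add: emeasure_ball ennreal_mult ennreal_of_nat_eq_real_of_nat)
  also have "\<dots> = emeasure lborel (\<Union>p\<in>P. ball p (s / 2))"
  proof (rule sum_emeasure)
    show "disjoint_family_on (\<lambda>p. ball p (s / 2)) P"
    proof (clarsimp simp: disjoint_family_on_def)
      fix p q assume pq: "p \<in> P" "q \<in> P" "p \<noteq> q"
      have False if "dist p x < s / 2" "dist q x < s / 2" for x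
        using dist_triangle2[of p q x] sep[OF pq] that by simp
      then show "ball p (s / 2) \<inter> ball q (s / 2) = {}" by auto
    qed
  qed (use P in auto)
  also have "\<dots> = (\<integral>\<^sup>+x. indicator (\<Union>p\<in>P. ball p (s / 2)) x \<partial>lborel)"
    by (rule nn_integral_indicator[symmetric]) (use P in auto)
  also have "\<dots> \<le> (\<integral>\<^sup>+x. indicator {1 - s / 2..1 + s / 2} (norm x) * indicator S (sgn x) \<partial>lborel)"
  proof (rule nn_integral_mono)
    fix x :: 'a
    have "norm x \<in> {1 - s / 2..1 + s / 2} \<and> sgn x \<in> S" if p: "p \<in> P" and d: "dist p x < s / 2" for p
    proof -
      have np: "norm p = 1" using P p by auto
      have 1: "\<bar>norm x - 1\<bar> < s / 2" using norm_triangle_ineq3[of x p] d np by (simp add: dist_norm norm_minus_commute)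
      have "x \<noteq> 0" using 1 s by auto
      have "norm (x - sgn x) = norm ((norm x - 1) *\<^sub>R sgn x)"
        using norm_scaleR_sgn[of x] by (simp add: algebra_simps)
      also have "\<dots> = \<bar>norm x - 1\<bar>" using \<open>x \<noteq> 0\<close> by (simp add: norm_sgn)
      finally have "dist x (sgn x) < s / 2" using 1 by (simp add: dist_norm)
      then have "dist p (sgn x) \<le> s" using dist_triangle[of p "sgn x" x] d by simp
      then show ?thesis using S(2)[OF p] abs_ge_self[of "norm x - 1"] abs_ge_minus_self[of "norm x - 1"] 1
        by (simp del: abs_ge_self abs_ge_minus_self)
    qed
    then show "(indicator (\<Union>p\<in>P. ball p (s / 2)) x :: ennreal) \<le> indicator {1 - s / 2..1 + s / 2} (norm x) * indicator S (sgn x)"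
      by (auto simp: indicator_def)
  qed
  also have "\<dots> = (\<integral>\<^sup>+r. indicator {1 - s / 2..1 + s / 2} r \<partial>radius_measure ?n) * emeasure cone_measure S"
    using S(1) by (subst nn_integral_polar_product) auto
  also have "\<dots> \<le> ennreal (real ?n * 2 ^ (?n - 1) * ((1 + s / 2) - (1 - s / 2))) * emeasure cone_measure S"
    using s by (intro mult_right_mono radius_measure_interval) auto
  finally show ?thesis by simp
qed

definition hausdorff_le_cone_const :: "'a::euclidean_space itself \<Rightarrow> real" where
  "hausdorff_le_cone_const _ = unit_ball_vol (real (DIM('a) - 1)) * (real DIM('a) * 2 ^ (DIM('a) - 1) * 2 ^ DIM('a) / unit_ball_vol DIM('a))"

text \<open>
  Balls of radius \<open>s\<close> around an \<open>s\<close>-separated subset of maximal cardinality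
  cover \<open>B\<close>, and \<open>card_separated_le\<close> bounds their number.
\<close>

lemma hausdorff_premeasure_le_cone:
  fixes B :: "'a::euclidean_space set"
  assumes dim: "2 \<le> DIM('a)" and B: "B \<subseteq> sphere 0 1" and s: "0 < s" "s \<le> 1"
    and S: "S \<in> sets borel" "\<And>p x. p \<in> B \<Longrightarrow> dist p x \<le> s \<Longrightarrow> x \<in> S"
  shows "hausdorff_premeasure (DIM('a) - 1) (2 * s) B \<le> ennreal (hausdorff_le_cone_const TYPE('a)) * emeasure cone_measure S"
proof -
  let ?n = "DIM('a)" and ?v = "unit_ball_vol (real (DIM('a) - 1))" and ?\<beta> = "unit_ball_vol (real DIM('a))"
  define \<sigma> where "\<sigma> = measure cone_measure S"
  have \<sigma>: "emeasure cone_measure S = ennreal \<sigma>" "0 \<le> \<sigma>"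
    by (simp_all add: \<sigma>_def cone_measure.emeasure_eq_measure)
  define sep where "sep P \<longleftrightarrow> finite P \<and> P \<subseteq> B \<and> (\<forall>p\<in>P. \<forall>q\<in>P. p \<noteq> q \<longrightarrow> s \<le> dist p q)" for P
  have card_le: "real (card P) * (?\<beta> * (s / 2) ^ ?n) \<le> real ?n * 2 ^ (?n - 1) * s * \<sigma>" if "sep P" for P
  proof -
    have "ennreal (real (card P) * (?\<beta> * (s / 2) ^ ?n)) \<le> ennreal (real ?n * 2 ^ (?n - 1) * s) * emeasure cone_measure S"
      using that B S s dim unfolding sep_def by (intro card_separated_le) (auto intro: S(2))
    then show ?thesis using \<sigma> s by (simp add: ennreal_mult[symmetric])
  qed
  \<comment> \<open>the volume bound on separated sets makes a maximal cardinality available\<close>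
  define b where "b = nat \<lceil>real ?n * 2 ^ (?n - 1) * s * \<sigma> / (?\<beta> * (s / 2) ^ ?n)\<rceil>"
  have "\<exists>P. sep P \<and> (\<forall>Q. sep Q \<longrightarrow> card Q \<le> card P)"
  proof (rule ex_has_greatest_nat)
    show "sep {}" by (simp add: sep_def)
    show "\<forall>Q. sep Q \<longrightarrow> card Q < Suc b"
    proof (intro allI impI)
      fix Q assume "sep Q"
      from card_le[OF this] have "real (card Q) \<le> real ?n * 2 ^ (?n - 1) * s * \<sigma> / (?\<beta> * (s / 2) ^ ?n)"
        using s by (subst pos_le_divide_eq) auto
      then show "card Q < Suc b" unfolding b_def by linarith
    qed
  qed
  then obtain P where P: "sep P" and max: "\<And>Q. sep Q \<Longrightarrow> card Q \<le> card P" by blast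
  have finP: "finite P" and PB: "P \<subseteq> B" using P by (auto simp: sep_def)
  have cover: "\<exists>p\<in>P. dist p x \<le> s" if "x \<in> B" for x
  proof (rule ccontr)
    assume far: "\<not> (\<exists>p\<in>P. dist p x \<le> s)"
    then have "x \<notin> P" using s by force
    have "sep (insert x P)"
      using P far \<open>x \<in> B\<close> unfolding sep_def by (auto simp: dist_commute not_le less_imp_le)
    from max[OF this] show False using \<open>x \<notin> P\<close> finP by simp
  qed
  obtain h where h: "bij_betw h {0..<card P} P"
    using ex_bij_betw_nat_finite[OF finP] by blast
  define C where "C i = (if i < card P then cball (h i) s else {})" for i
  have "B \<subseteq> (\<Union>i. C i)"
  proof
    fix x assume "x \<in> B"
    then obtain p where p: "p \<in> P" "dist p x \<le> s" using cover by blast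
    then obtain i where "i < card P" "p = h i" using h unfolding bij_betw_def by (metis atLeastLessThan_iff imageE)
    then have "x \<in> C i" using p by (simp add: C_def)
    then show "x \<in> (\<Union>i. C i)" by blast
  qed
  then have "hausdorff_premeasure (?n - 1) (2 * s) B \<le> (\<Sum>i. cover_weight (?n - 1) (C i))"
    using s by (intro hausdorff_premeasure_le_cover) (auto simp: C_def)
  also have "\<dots> = (\<Sum>i\<in>{..<card P}. cover_weight (?n - 1) (C i))"
    by (rule suminf_finite) (auto simp: C_def)
  also have "\<dots> = (\<Sum>i\<in>{..<card P}. ennreal (?v * s ^ (?n - 1)))"
    using s by (intro sum.cong) (auto simp: C_def)
  also have "\<dots> = ennreal (?v * (real (card P) * s ^ (?n - 1)))"
    using s by (simp add: ennreal_mult[symmetric] ennreal_of_nat_eq_real_of_nat mult_ac)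
  also have "\<dots> \<le> ennreal (?v * (real ?n * 2 ^ (?n - 1) * 2 ^ ?n / ?\<beta> * \<sigma>))"
  proof (intro ennreal_leI mult_left_mono)
    have "s ^ ?n = s * s ^ (?n - 1)" using power_Suc[of s "?n - 1"] by simp
    then have "s * (real (card P) * s ^ (?n - 1) * ?\<beta>) \<le> s * (real ?n * 2 ^ (?n - 1) * 2 ^ ?n * \<sigma>)"
      using card_le[OF P] by (simp add: power_divide field_simps)
    then have "real (card P) * s ^ (?n - 1) * ?\<beta> \<le> real ?n * 2 ^ (?n - 1) * 2 ^ ?n * \<sigma>"
      using s by (rule_tac mult_left_le_imp_le)
    then show "real (card P) * s ^ (?n - 1) \<le> real ?n * 2 ^ (?n - 1) * 2 ^ ?n / ?\<beta> * \<sigma>"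
      by (simp add: field_simps)
  qed simp
  also have "\<dots> = ennreal (hausdorff_le_cone_const TYPE('a)) * emeasure cone_measure S"
    unfolding \<sigma> hausdorff_le_cone_const_def using \<sigma>(2) by (subst ennreal_mult[symmetric]) (auto simp: mult.assoc)
  finally show ?thesis .
qed

text \<open>
  Let the scale in \<open>hausdorff_premeasure_le_cone\<close> tend to \<open>0\<close>: closed
  neighbourhoods of a compact set decrease to it, so their surface measures converge.
\<close>

lemma hausdorff_le_emeasure_cone:
  fixes B :: "'a::euclidean_space set"
  assumes dim: "2 \<le> DIM('a)" and B: "compact B" "B \<subseteq> sphere 0 1"
  shows "hausdorff_measure (DIM('a) - 1) B \<le> ennreal (hausdorff_le_cone_const TYPE('a)) * emeasure cone_measure B"
proof (cases "B = {}")
  case True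
  have "hausdorff_premeasure (DIM('a) - 1) d ({} :: 'a set) = 0" if "0 < d" for d
    using hausdorff_premeasure_le_cover[of "{}" "\<lambda>_. {}" d "DIM('a) - 1"] that by simp
  then show ?thesis using True by (simp add: hausdorff_measure_def)
next
  case False
  let ?n = "DIM('a)" and ?K = "ennreal (hausdorff_le_cone_const TYPE('a))"
  define S where "S i = {x. infdist x B \<le> 1 / real (Suc i)}" for i
  have S: "S i \<in> sets borel" for i
    unfolding S_def by (intro borel_closed closed_Collect_le continuous_intros)
  have "(\<Inter>i. S i) = B"
  proof (intro antisym subsetI)
    fix x assume "x \<in> (\<Inter>i. S i)"
    then have "infdist x B \<le> 1 / real (Suc i)" for i by (auto simp: S_def)
    then have "infdist x B \<le> 0"
      using LIMSEQ_inverse_real_of_nat by (intro LIMSEQ_le_const) (auto simp: inverse_eq_divide)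
    then have "infdist x B = 0" using infdist_nonneg[of x B] by linarith
    then show "x \<in> B" using in_closed_iff_infdist_zero[OF compact_imp_closed[OF B(1)] False] by simp
  qed (auto simp: S_def)
  moreover have "(\<lambda>i. emeasure cone_measure (S i)) \<longlonglongrightarrow> emeasure cone_measure (\<Inter>i. S i)"
  proof (rule Lim_emeasure_decseq)
    show "decseq S" unfolding decseq_def S_def
    proof (intro allI impI subsetI, clarsimp)
      fix m n :: nat and x assume "m \<le> n" "infdist x B \<le> 1 / (1 + real n)"
      moreover have "1 / (1 + real n) \<le> 1 / (1 + real m)" using \<open>m \<le> n\<close> by (simp add: field_simps)
      ultimately show "infdist x B \<le> 1 / (1 + real m)" by linarith
    qed
  qed (use S in auto)
  ultimately have lim: "(\<lambda>i. ?K * emeasure cone_measure (S i)) \<longlonglongrightarrow> ?K * emeasure cone_measure B"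
    by (intro ennreal_tendsto_cmult) auto
  have "hausdorff_premeasure (?n - 1) d B \<le> ?K * emeasure cone_measure B" if d: "0 < d" for d
  proof (rule LIMSEQ_le_const[OF lim])
    obtain N where N: "2 / d < real N" using reals_Archimedean2 by blast
    show "\<exists>N. \<forall>i\<ge>N. hausdorff_premeasure (?n - 1) d B \<le> ?K * emeasure cone_measure (S i)"
    proof (intro exI allI impI)
      fix i assume "N \<le> i"
      then have "2 * (1 / real (Suc i)) \<le> d" using N d by (simp add: field_simps) (smt (verit) of_nat_mono mult_left_mono)
      then have "hausdorff_premeasure (?n - 1) d B \<le> hausdorff_premeasure (?n - 1) (2 * (1 / real (Suc i))) B"
        by (rule hausdorff_premeasure_antimono)
      also have "\<dots> \<le> ?K * emeasure cone_measure (S i)"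
      proof (rule hausdorff_premeasure_le_cone[OF dim B(2)])
        fix p x assume "p \<in> B" "dist p x \<le> 1 / real (Suc i)"
        then show "x \<in> S i" unfolding S_def using infdist_le2[of p B x] by (simp add: dist_commute)
      qed (use S in auto)
      finally show "hausdorff_premeasure (?n - 1) d B \<le> ?K * emeasure cone_measure (S i)" .
    qed
  qed
  then show ?thesis unfolding hausdorff_measure_def by (intro SUP_least) auto
qed

section \<open>The radial Hardy inequality with a gain\<close>

text \<open>
  The graph of a power lies above its tangents; this is Bernoulli's inequality after division by
  \<open>b ^ n\<close>.
\<close>

lemma power_tangent_le:
  fixes a b :: real
  assumes "0 \<le> a" "0 \<le> b" "1 \<le> n"
  shows "real n * (b ^ (n - 1) * a) \<le> a ^ n + (real n - 1) * b ^ n"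
proof (cases "b = 0")
  case True
  then show ?thesis using assms by (cases "n = 1") (auto simp: zero_power)
next
  case False
  then have b: "0 < b" using assms by simp
  have "1 + real n * (a / b - 1) \<le> (1 + (a / b - 1)) ^ n"
    by (rule Bernoulli_inequality) (use assms b in simp)
  then have "(1 + real n * (a / b - 1)) * b ^ n \<le> (a / b) ^ n * b ^ n"
    using b by (intro mult_right_mono) auto
  also have "(a / b) ^ n * b ^ n = a ^ n"
    using b by (simp add: power_divide)
  also have "(1 + real n * (a / b - 1)) * b ^ n = real n * (b ^ (n - 1) * a) - (real n - 1) * b ^ n"
    using power_Suc[of b "n - 1"] b \<open>1 \<le> n\<close> by (simp add: field_simps)
  finally show ?thesis by simp
qed

text \<open>
  By \<open>power_tangent_le\<close> with \<open>a = r * \<bar>\<psi>'\<bar>\<close> and \<open>b *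
  \<bar>\<psi>\<bar>\<close>, the difference of the integrands is at least the derivative of \<open>- (b
  ^ (n - 1) * \<bar>\<psi>\<bar> ^ n)\<close>.  The boundary term at \<open>e\<close> vanishes and the
  one at \<open>s\<close> has the right sign.
\<close>

lemma picone_interval:
  fixes \<psi> \<psi>' b W :: "real \<Rightarrow> real"
  assumes n: "2 \<le> n" and se: "0 < s" "s \<le> e"
    and \<psi>: "\<And>r. r \<in> {s..e} \<Longrightarrow> (\<psi> has_real_derivative \<psi>' r) (at r)" and \<psi>': "continuous_on {s..e} \<psi>'"
    and b: "\<And>r. r \<in> {s..e} \<Longrightarrow> 0 \<le> b r"
    and B: "\<And>r. r \<in> {s..e} \<Longrightarrow> ((\<lambda>r. b r ^ (n - 1)) has_real_derivative B r) (at r)"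
    and W: "continuous_on {s..e} W" "\<And>r. r \<in> {s..e} \<Longrightarrow> W r \<le> B r - (real n - 1) * b r ^ n / r"
    and end0: "\<psi> e = 0"
  shows "integral {s..e} (\<lambda>r. W r * \<bar>\<psi> r\<bar> ^ n) \<le> integral {s..e} (\<lambda>r. r ^ (n - 1) * \<bar>\<psi>' r\<bar> ^ n)"
proof -
  have cont\<psi>: "continuous_on {s..e} \<psi>"
    by (intro continuous_at_imp_continuous_on ballI DERIV_isCont[OF \<psi>])
  have i1: "(\<lambda>r. W r * \<bar>\<psi> r\<bar> ^ n) integrable_on {s..e}" and i2: "(\<lambda>r. r ^ (n - 1) * \<bar>\<psi>' r\<bar> ^ n) integrable_on {s..e}"
    by (intro integrable_continuous_interval continuous_intros W cont\<psi> \<psi>')+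
  \<comment> \<open>the derivative of \<open>- (b ^ (n - 1) * \<bar>\<psi>\<bar> ^ n)\<close>\<close>
  define F' where "F' r = - (b r ^ (n - 1) * (real n * (\<bar>\<psi> r\<bar> ^ (n - 2) * \<psi> r) * \<psi>' r) + B r * \<bar>\<psi> r\<bar> ^ n)" for r
  have "((\<lambda>r. - (b r ^ (n - 1) * \<bar>\<psi> r\<bar> ^ n)) has_real_derivative F' r) (at r)" if r: "r \<in> {s..e}" for r
  proof -
    have "((\<lambda>r. \<bar>\<psi> r\<bar> ^ n) has_real_derivative real n * (\<bar>\<psi> r\<bar> ^ (n - 2) * \<psi> r) * \<psi>' r) (at r)"
      using DERIV_chain2[OF DERIV_abs_power[OF n] \<psi>[OF r]] .
    from DERIV_minus[OF DERIV_mult[OF B[OF r] this]] show ?thesis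
      by (simp add: F'_def add.commute mult.commute)
  qed
  then have "(F' has_integral (- (b e ^ (n - 1) * \<bar>\<psi> e\<bar> ^ n) - (- (b s ^ (n - 1) * \<bar>\<psi> s\<bar> ^ n)))) {s..e}"
    using se by (intro fundamental_theorem_of_calculus)
      (auto simp flip: has_real_derivative_iff_has_vector_derivative intro: DERIV_subset)
  then have F: "(F' has_integral (b s ^ (n - 1) * \<bar>\<psi> s\<bar> ^ n)) {s..e}"
    using end0 n by (simp add: zero_power)
  have "b s ^ (n - 1) * \<bar>\<psi> s\<bar> ^ n \<le> integral {s..e} (\<lambda>r. r ^ (n - 1) * \<bar>\<psi>' r\<bar> ^ n - W r * \<bar>\<psi> r\<bar> ^ n)"
  proof (rule has_integral_le[OF F integrable_integral[OF integrable_diff[OF i2 i1]]])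
    fix r assume r: "r \<in> {s..e}"
    then have r0: "0 < r" using se by auto
    have "real n * ((b r * \<bar>\<psi> r\<bar>) ^ (n - 1) * (r * \<bar>\<psi>' r\<bar>)) \<le> (r * \<bar>\<psi>' r\<bar>) ^ n + (real n - 1) * (b r * \<bar>\<psi> r\<bar>) ^ n"
      using n r0 b[OF r] by (intro power_tangent_le) auto
    also have "\<dots> = (r ^ (n - 1) * \<bar>\<psi>' r\<bar> ^ n + (real n - 1) * b r ^ n / r * \<bar>\<psi> r\<bar> ^ n) * r"
      using power_Suc2[of r "n - 1"] n r0 by (simp add: power_mult_distrib field_simps)
    also have "real n * ((b r * \<bar>\<psi> r\<bar>) ^ (n - 1) * (r * \<bar>\<psi>' r\<bar>)) = real n * (b r ^ (n - 1) * \<bar>\<psi> r\<bar> ^ (n - 1) * \<bar>\<psi>' r\<bar>) * r"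
      by (simp add: power_mult_distrib)
    finally have "real n * (b r ^ (n - 1) * \<bar>\<psi> r\<bar> ^ (n - 1) * \<bar>\<psi>' r\<bar>) * r \<le> (r ^ (n - 1) * \<bar>\<psi>' r\<bar> ^ n + (real n - 1) * b r ^ n / r * \<bar>\<psi> r\<bar> ^ n) * r" .
    then have 1: "real n * (b r ^ (n - 1) * \<bar>\<psi> r\<bar> ^ (n - 1) * \<bar>\<psi>' r\<bar>) \<le> r ^ (n - 1) * \<bar>\<psi>' r\<bar> ^ n + (real n - 1) * b r ^ n / r * \<bar>\<psi> r\<bar> ^ n"
      using r0 by (simp only: mult_le_cancel_right_pos)
    have "\<bar>\<psi> r\<bar> ^ (n - 1) = \<bar>\<psi> r\<bar> ^ (n - 2) * \<bar>\<psi> r\<bar>"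
      using n power_Suc2[of "\<bar>\<psi> r\<bar>" "n - 2"] by (simp add: numeral_2_eq_2 Suc_diff_Suc)
    then have "\<bar>b r ^ (n - 1) * (real n * (\<bar>\<psi> r\<bar> ^ (n - 2) * \<psi> r) * \<psi>' r)\<bar> = real n * (b r ^ (n - 1) * \<bar>\<psi> r\<bar> ^ (n - 1) * \<bar>\<psi>' r\<bar>)"
      using b[OF r] by (simp add: abs_mult)
    then have "- (b r ^ (n - 1) * (real n * (\<bar>\<psi> r\<bar> ^ (n - 2) * \<psi> r) * \<psi>' r)) \<le> real n * (b r ^ (n - 1) * \<bar>\<psi> r\<bar> ^ (n - 1) * \<bar>\<psi>' r\<bar>)"
      by linarith
    moreover have "W r * \<bar>\<psi> r\<bar> ^ n \<le> (B r - (real n - 1) * b r ^ n / r) * \<bar>\<psi> r\<bar> ^ n"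
      using W(2)[OF r] by (intro mult_right_mono) auto
    ultimately show "F' r \<le> r ^ (n - 1) * \<bar>\<psi>' r\<bar> ^ n - W r * \<bar>\<psi> r\<bar> ^ n"
      using 1 unfolding F'_def by (simp add: left_diff_distrib)
  qed
  moreover have "0 \<le> b s ^ (n - 1) * \<bar>\<psi> s\<bar> ^ n" using b[of s] se by auto
  ultimately show ?thesis using integral_diff[OF i2 i1] by simp
qed

text \<open>
  The factor of the weight \<open>1 / t ^ n\<close> (with respect to \<open>dt\<close>) that the
  perturbed Picone argument yields: the sharp constant, a loss of second order in
  \<open>\<kappa>\<close>, and a gain of first order that is bounded below on compact subsets of
  \<open>(0, \<infinity>)\<close>.
\<close>

definition hardy_gain :: "nat \<Rightarrow> real \<Rightarrow> real \<Rightarrow> real" where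
  "hardy_gain n \<kappa> t = ((real n - 1) / real n) ^ n * (1 - (real n - 1)\<^sup>2 * \<kappa>\<^sup>2 + real n * \<kappa> / 2 ^ n * (t / (1 + t)\<^sup>2))"

text \<open>
  The right-hand side is \<open>t ^ n\<close> times the potential that belongs to \<open>\<alpha> * q /
  t\<close>.  For \<open>q = 1 - x\<close> the terms without derivative are a multiple of \<open>q ^ (n
  - 1) * (n - (n - 1) * q)\<close>, which has its maximum \<open>1\<close> at \<open>q = 1\<close>;
  Bernoulli's inequality makes the second-order loss explicit.
\<close>

lemma hardy_gain_bound:
  fixes \<kappa> t :: real
  assumes n: "2 \<le> n" and \<kappa>: "0 \<le> \<kappa>" "\<kappa> \<le> 1/2" and t: "0 < t"
  defines "\<alpha> \<equiv> (real n - 1) / real n" and "q \<equiv> 1 - \<kappa> * t / (1 + t)"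
  shows "hardy_gain n \<kappa> t \<le> (real n - 1) * (\<alpha> ^ (n - 1) * q ^ (n - 2) * (q + \<kappa> * t / (1 + t)\<^sup>2) - \<alpha> ^ n * q ^ n)"
proof -
  define x where "x = \<kappa> * t / (1 + t)"
  have x: "0 \<le> x" "x \<le> \<kappa>" using \<kappa> t by (auto simp: x_def field_simps)
  have q: "q = 1 - x" by (simp add: q_def x_def)
  have \<alpha>: "0 < \<alpha>" using n by (simp add: \<alpha>_def)
  have powers: "q ^ (n - 1) = q ^ (n - 2) * q" "\<alpha> ^ n = \<alpha> ^ (n - 1) * \<alpha>" "q ^ n = q ^ (n - 1) * q"
    using n power_Suc2[of q "n - 2"] power_Suc2[of \<alpha> "n - 1"] power_Suc2[of q "n - 1"] by (simp_all add: numeral_2_eq_2 Suc_diff_Suc)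
  have an: "(real n - 1) * \<alpha> ^ (n - 1) = real n * \<alpha> ^ n"
    unfolding powers using n by (simp add: \<alpha>_def)
  have "1 - (real n - 1)\<^sup>2 * \<kappa>\<^sup>2 \<le> 1 - (real n - 1)\<^sup>2 * x\<^sup>2"
    using x by (intro diff_left_mono mult_left_mono power_mono) auto
  also have "\<dots> = (1 + real (n - 1) * (- x)) * (1 + (real n - 1) * x)"
    using n by (simp add: algebra_simps power2_eq_square of_nat_diff)
  also have "\<dots> \<le> (1 + (- x)) ^ (n - 1) * (1 + (real n - 1) * x)"
    using x \<kappa> n by (intro mult_right_mono Bernoulli_inequality) auto
  also have "\<dots> = q ^ (n - 1) * (real n - (real n - 1) * q)" by (simp add: q algebra_simps)
  finally have 1: "1 - (real n - 1)\<^sup>2 * \<kappa>\<^sup>2 \<le> q ^ (n - 1) * (real n - (real n - 1) * q)" .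
  have "1 / 2 ^ n \<le> (1/2::real) ^ (n - 2)"
    using power_decreasing[of "n - 2" n "1/2::real"] by (simp add: power_one_over)
  also have "\<dots> \<le> q ^ (n - 2)" using x \<kappa> by (intro power_mono) (auto simp: q)
  finally have 2: "1 / 2 ^ n \<le> q ^ (n - 2)" .
  have "real n * \<kappa> / 2 ^ n * (t / (1 + t)\<^sup>2) = (1 / 2 ^ n) * (real n * \<kappa> * t / (1 + t)\<^sup>2)" by simp
  also have "\<dots> \<le> q ^ (n - 2) * (real n * \<kappa> * t / (1 + t)\<^sup>2)"
    using 2 \<kappa> t by (intro mult_right_mono) auto
  finally have 3: "real n * \<kappa> / 2 ^ n * (t / (1 + t)\<^sup>2) \<le> real n * (q ^ (n - 2) * (\<kappa> * t / (1 + t)\<^sup>2))" by (simp add: mult_ac)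
  have "hardy_gain n \<kappa> t \<le> \<alpha> ^ n * (q ^ (n - 1) * (real n - (real n - 1) * q) + real n * (q ^ (n - 2) * (\<kappa> * t / (1 + t)\<^sup>2)))"
    unfolding hardy_gain_def \<alpha>_def[symmetric] using 1 3 \<alpha> by (intro mult_left_mono) auto
  also have "\<dots> = (real n * \<alpha> ^ n) * q ^ (n - 2) * (q + \<kappa> * t / (1 + t)\<^sup>2) - (real n - 1) * \<alpha> ^ n * q ^ n"
    by (simp only: powers(1,3)) (simp add: algebra_simps)
  also have "\<dots> = (real n - 1) * (\<alpha> ^ (n - 1) * q ^ (n - 2) * (q + \<kappa> * t / (1 + t)\<^sup>2) - \<alpha> ^ n * q ^ n)"
    unfolding an[symmetric] by (simp add: algebra_simps diff_divide_distrib)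
  finally show ?thesis .
qed

text \<open>
  The Picone argument for the perturbed function \<open>b = \<alpha> * q / t\<close>, written in the
  variable \<open>r\<close>.
\<close>

lemma radial_hardy_interval:
  fixes \<psi> \<psi>' :: "real \<Rightarrow> real"
  assumes n: "2 \<le> n" and se: "0 < s" "s \<le> e" "e < R" and \<kappa>: "0 \<le> \<kappa>" "\<kappa> \<le> 1/2"
    and \<psi>: "\<And>r. r \<in> {s..e} \<Longrightarrow> (\<psi> has_real_derivative \<psi>' r) (at r)" and \<psi>': "continuous_on {s..e} \<psi>'"
    and end0: "\<psi> e = 0"
  shows "integral {s..e} (\<lambda>r. hardy_gain n \<kappa> (ln (R / r)) / (r * ln (R / r) ^ n) * \<bar>\<psi> r\<bar> ^ n) \<le> integral {s..e} (\<lambda>r. r ^ (n - 1) * \<bar>\<psi>' r\<bar> ^ n)"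
proof -
  let ?\<alpha> = "(real n - 1) / real n"
  let ?T = "\<lambda>r. ln (R / r)"
  let ?q = "\<lambda>r. 1 - \<kappa> * ?T r / (1 + ?T r)"
  let ?b = "\<lambda>r. ?\<alpha> * ?q r / ?T r"
  let ?B = "\<lambda>r. real (n - 1) * ?b r ^ (n - 2) * (?\<alpha> / r * (?q r / (?T r)\<^sup>2 + \<kappa> / (?T r * (1 + ?T r)\<^sup>2)))"
  have T: "0 < ?T r" if "r \<in> {s..e}" for r using that se by (intro ln_gt_zero) auto
  have q: "0 \<le> ?q r" if "r \<in> {s..e}" for r
  proof -
    have "\<kappa> * (?T r / (1 + ?T r)) \<le> 1 * 1" using T[OF that] \<kappa> by (intro mult_mono) auto
    then show ?thesis by simp
  qed
  have contT: "continuous_on {s..e} ?T" using se by (intro continuous_intros) auto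
  show ?thesis
  proof (rule picone_interval[OF n se(1,2) \<psi> \<psi>', where b = ?b and B = ?B])
    fix r assume r: "r \<in> {s..e}"
    then have r0: "0 < r" "0 < R" using se by auto
    have t: "0 < ?T r" by (rule T[OF r])
    show "0 \<le> ?b r" using t q[OF r] n by simp
    have dT: "(?T has_real_derivative - (1 / r)) (at r)"
      using r0 by (auto intro!: derivative_eq_intros simp: field_simps power2_eq_square)
    have dq: "(?q has_real_derivative \<kappa> / (r * (1 + ?T r)\<^sup>2)) (at r)"
    proof -
      have "((\<lambda>r. 1 + ?T r) has_real_derivative - (1 / r)) (at r)"
        using DERIV_add[OF DERIV_const dT, of 1] by simp
      from DERIV_diff[OF DERIV_const DERIV_divide[OF DERIV_cmult[OF dT, of \<kappa>] this], of 1] t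
      have "(?q has_real_derivative 0 - (\<kappa> * - (1 / r) * (1 + ?T r) - \<kappa> * ?T r * - (1 / r)) / ((1 + ?T r) * (1 + ?T r))) (at r)"
        by simp
      moreover have "0 - (\<kappa> * - (1 / r) * (1 + T) - \<kappa> * T * - (1 / r)) / ((1 + T) * (1 + T)) = \<kappa> / (r * (1 + T)\<^sup>2)" if "0 < T" for T
        using that r0 by (simp add: field_simps power2_eq_square)
      ultimately show ?thesis using t by simp
    qed
    have db: "(?b has_real_derivative ?\<alpha> / r * (?q r / (?T r)\<^sup>2 + \<kappa> / (?T r * (1 + ?T r)\<^sup>2))) (at r)"
    proof -
      have eq: "(a * (\<kappa> / (r * w)) * T - a * Q * (- (1 / r))) / (T * T) = a / r * (Q / T\<^sup>2 + \<kappa> / (T * w))"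
        if "T \<noteq> 0" "w \<noteq> 0" for a T w Q using that r0 by (simp add: field_simps power2_eq_square)
      show ?thesis
        by (rule DERIV_cong[OF DERIV_divide[OF DERIV_cmult[OF dq] dT] eq]) (use t in simp_all)
    qed
    show "((\<lambda>r. ?b r ^ (n - 1)) has_real_derivative ?B r) (at r)"
      using DERIV_power[OF db, of "n - 1"] by (simp add: mult_ac numeral_2_eq_2)
    have key: "real (n - 1) * (a * q0 / t) ^ (n - 2) * (a / r * (q0 / t\<^sup>2 + \<kappa> / (t * (1 + t)\<^sup>2))) - (real n - 1) * (a * q0 / t) ^ n / r =
        (real n - 1) * (a ^ (n - 1) * q0 ^ (n - 2) * (q0 + \<kappa> * t / (1 + t)\<^sup>2) - a ^ n * q0 ^ n) / (r * t ^ n)"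
      if t0: "0 < t" for t q0 a :: real
    proof -
      have p: "t ^ n = t ^ (n - 2) * t\<^sup>2" "a ^ (n - 1) = a ^ (n - 2) * a"
        using n power_add[of t "n - 2" 2] power_Suc2[of a "n - 2"] by (simp_all add: numeral_2_eq_2 Suc_diff_Suc)
      have e1: "real (n - 1) = real n - 1" using n by (simp add: of_nat_diff)
      have e2: "(a * q0 / t) ^ (n - 2) * (a / r * (q0 / t\<^sup>2 + \<kappa> / (t * w))) = a ^ (n - 1) * q0 ^ (n - 2) * (q0 + \<kappa> * t / w) / (r * t ^ n)"
        if "w \<noteq> 0" for w
        using that t0 r0 unfolding p by (simp add: power_divide power_mult_distrib field_simps power2_eq_square)
      have e3: "(a * q0 / t) ^ n / r = a ^ n * q0 ^ n / (r * t ^ n)"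
        by (simp add: power_divide power_mult_distrib)
      have "(1 + t)\<^sup>2 \<noteq> 0" using t0 by simp
      note e2 = e2[OF this]
      have "real (n - 1) * (a * q0 / t) ^ (n - 2) * (a / r * (q0 / t\<^sup>2 + \<kappa> / (t * (1 + t)\<^sup>2))) - (real n - 1) * (a * q0 / t) ^ n / r =
        (real n - 1) * ((a * q0 / t) ^ (n - 2) * (a / r * (q0 / t\<^sup>2 + \<kappa> / (t * (1 + t)\<^sup>2)))) - (real n - 1) * ((a * q0 / t) ^ n / r)"
        unfolding e1 by (simp only: mult.assoc times_divide_eq_right)
      also have "\<dots> = (real n - 1) * (a ^ (n - 1) * q0 ^ (n - 2) * (q0 + \<kappa> * t / (1 + t)\<^sup>2) / (r * t ^ n)) - (real n - 1) * (a ^ n * q0 ^ n / (r * t ^ n))"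
        by (simp only: e2 e3)
      also have "\<dots> = (real n - 1) * (a ^ (n - 1) * q0 ^ (n - 2) * (q0 + \<kappa> * t / (1 + t)\<^sup>2) - a ^ n * q0 ^ n) / (r * t ^ n)"
        by (simp only: right_diff_distrib diff_divide_distrib times_divide_eq_right)
      finally show ?thesis .
    qed
    have "hardy_gain n \<kappa> (?T r) / (r * ?T r ^ n) \<le> (real n - 1) * (?\<alpha> ^ (n - 1) * ?q r ^ (n - 2) * (?q r + \<kappa> * ?T r / (1 + ?T r)\<^sup>2) - ?\<alpha> ^ n * ?q r ^ n) / (r * ?T r ^ n)"
      using t r0 by (intro divide_right_mono hardy_gain_bound n \<kappa>) auto
    then show "hardy_gain n \<kappa> (?T r) / (r * ?T r ^ n) \<le> ?B r - (real n - 1) * ?b r ^ n / r"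
      unfolding key[OF t] .
  next
    have nz: "r * ln (R / r) ^ n \<noteq> 0" "1 + ln (R / r) \<noteq> 0" "(1 + ln (R / r))\<^sup>2 \<noteq> 0" "r \<noteq> 0" if "r \<in> {s..e}" for r
    proof -
      have "ln (R / r) \<noteq> 0" "1 + ln (R / r) \<noteq> 0" "r \<noteq> 0" using T[OF that] that se by (linarith, linarith, auto)
      then show "r * ln (R / r) ^ n \<noteq> 0" "1 + ln (R / r) \<noteq> 0" "(1 + ln (R / r))\<^sup>2 \<noteq> 0" "r \<noteq> 0"
        by (simp_all only: mult_eq_0_iff power_eq_0_iff not_False_eq_True HOL.simp_thms)
    qed
    show "continuous_on {s..e} (\<lambda>r. hardy_gain n \<kappa> (?T r) / (r * ?T r ^ n))"
      unfolding hardy_gain_def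
    proof (intro continuous_on_divide[OF continuous_on_mult[OF continuous_on_const continuous_on_add[OF continuous_on_const
        continuous_on_mult[OF continuous_on_const]]]])
      show "continuous_on {s..e} (\<lambda>r. ?T r / (1 + ?T r)\<^sup>2)"
        by (rule continuous_on_divide[OF contT continuous_on_power[OF continuous_on_add[OF continuous_on_const contT]]]) (use nz in blast)
      show "continuous_on {s..e} (\<lambda>r. r * ?T r ^ n)"
        by (rule continuous_on_mult[OF continuous_on_id continuous_on_power[OF contT]])
    qed (use nz in blast)
  qed (use end0 in auto)
qed

lemma hardy_gain_nonneg:
  assumes "2 \<le> n" "0 \<le> \<kappa>" "(real n - 1) * \<kappa> \<le> 1" "0 \<le> t"
  shows "0 \<le> hardy_gain n \<kappa> t"
proof -
  have "((real n - 1) * \<kappa>)\<^sup>2 \<le> 1" using assms by (intro power_le_one) auto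
  then have "0 \<le> 1 - (real n - 1)\<^sup>2 * \<kappa>\<^sup>2" by (simp add: power_mult_distrib)
  then show ?thesis unfolding hardy_gain_def using assms by (intro mult_nonneg_nonneg add_nonneg_nonneg) auto
qed

text \<open>
  Let the left end of the interval tend to \<open>0\<close>.
\<close>

lemma radial_hardy:
  fixes \<psi> \<psi>' :: "real \<Rightarrow> real"
  assumes n: "2 \<le> n" and e: "0 < e" "e < R" and \<kappa>: "0 \<le> \<kappa>" "\<kappa> \<le> 1/2" "(real n - 1) * \<kappa> \<le> 1"
    and \<psi>: "\<And>r. (\<psi> has_real_derivative \<psi>' r) (at r)" and \<psi>': "continuous_on UNIV \<psi>'"
    and end0: "\<And>r. e \<le> r \<Longrightarrow> \<psi> r = 0"
  shows "(\<integral>\<^sup>+r. ennreal (hardy_gain n \<kappa> (ln (R / r)) / (r * ln (R / r) ^ n) * \<bar>\<psi> r\<bar> ^ n) * indicator {0<..<R} r \<partial>lborel) \<le>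
    (\<integral>\<^sup>+r. ennreal (r ^ (n - 1) * \<bar>\<psi>' r\<bar> ^ n) * indicator {0<..} r \<partial>lborel)"
proof -
  let ?W = "\<lambda>r. hardy_gain n \<kappa> (ln (R / r)) / (r * ln (R / r) ^ n) * \<bar>\<psi> r\<bar> ^ n"
  have cont\<psi>: "continuous_on UNIV \<psi>"
    using \<psi> by (intro continuous_at_imp_continuous_on) (auto intro: DERIV_isCont)
  have [measurable]: "\<psi> \<in> borel_measurable borel" "\<psi>' \<in> borel_measurable borel"
    using cont\<psi> \<psi>' by (auto intro: borel_measurable_continuous_onI)
  have W: "0 \<le> ?W r" if "0 < r" "r < R" for r
    using that n \<kappa> by (intro mult_nonneg_nonneg divide_nonneg_nonneg hardy_gain_nonneg zero_le_power) auto
  \<comment> \<open>the integrand on \<open>[e / (k + 1), e]\<close>; it vanishes to the right of \<open>e\<close>\<close>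
  define f where "f k r = ennreal (?W r) * indicator {e / real (Suc k)..e} r" for k r
  have [measurable]: "f k \<in> borel_measurable borel" for k
    unfolding f_def hardy_gain_def by measurable
  have "incseq f"
  proof (rule incseq_SucI, rule le_funI)
    fix k r
    have "e / real (Suc (Suc k)) \<le> e / real (Suc k)" using e by (simp add: field_simps)
    then show "f k r \<le> f (Suc k) r" unfolding f_def by (auto simp: indicator_def)
  qed
  have "(\<integral>\<^sup>+r. ennreal (?W r) * indicator {0<..<R} r \<partial>lborel) \<le> (\<integral>\<^sup>+r. (SUP k. f k r) \<partial>lborel)"
  proof (rule nn_integral_mono)
    fix r :: real
    show "ennreal (?W r) * indicator {0<..<R} r \<le> (SUP k. f k r)"
    proof (cases "0 < r \<and> r \<le> e")
      case True
      obtain k :: nat where "e / r < real k" using reals_Archimedean2 by blast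
      then have "e / real (Suc k) \<le> r" using True e by (simp add: field_simps)
      then have "ennreal (?W r) * indicator {0<..<R} r \<le> f k r"
        using True by (auto simp: f_def indicator_def)
      also have "\<dots> \<le> (SUP k. f k r)" by (rule SUP_upper) simp
      finally show ?thesis .
    next
      case False
      then show ?thesis using end0[of r] n by (auto simp: indicator_def zero_power)
    qed
  qed
  also have "\<dots> = (SUP k. \<integral>\<^sup>+r. f k r \<partial>lborel)"
    using \<open>incseq f\<close> by (rule nn_integral_monotone_convergence_SUP) measurable
  also have "\<dots> \<le> (\<integral>\<^sup>+r. ennreal (r ^ (n - 1) * \<bar>\<psi>' r\<bar> ^ n) * indicator {0<..} r \<partial>lborel)"
  proof (rule SUP_least)
    fix k
    let ?s = "e / real (Suc k)"
    have s: "0 < ?s" "?s \<le> e" using e by (simp_all add: field_simps)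
    have T: "0 < ln (R / r)" if "r \<in> {?s..e}" for r
    proof -
      have "0 < r" "r < R" using that less_le_trans[OF s(1), of r] e by auto
      then show ?thesis by (intro ln_gt_zero) simp
    qed
    have nz: "r * ln (R / r) ^ n \<noteq> 0" "(1 + ln (R / r))\<^sup>2 \<noteq> 0" "r \<noteq> 0" if "r \<in> {?s..e}" for r
      using T[OF that] that s by auto
    have iW: "?W integrable_on {?s..e}"
      unfolding hardy_gain_def using s e
      by (intro integrable_continuous_interval continuous_intros continuous_on_subset[OF cont\<psi>]) (use nz in auto)
    have i2: "(\<lambda>r. r ^ (n - 1) * \<bar>\<psi>' r\<bar> ^ n) integrable_on {?s..e}"
      by (intro integrable_continuous_interval continuous_intros continuous_on_subset[OF \<psi>']) auto
    have "(\<integral>\<^sup>+r. f k r \<partial>lborel) = ennreal (integral {?s..e} ?W)"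
      unfolding f_def
    proof (rule nn_integral_has_integral_lebesgue'[OF _ integrable_integral[OF iW]])
      fix r assume "r \<in> {?s..e}"
      then have "0 < r" "r < R" using less_le_trans[OF s(1), of r] e by auto
      then show "0 \<le> ?W r" by (rule W)
    qed
    also have "\<dots> \<le> ennreal (integral {?s..e} (\<lambda>r. r ^ (n - 1) * \<bar>\<psi>' r\<bar> ^ n))"
      using n s e \<kappa> \<psi> end0 by (intro ennreal_leI radial_hardy_interval continuous_on_subset[OF \<psi>']) auto
    also have "\<dots> = (\<integral>\<^sup>+r. ennreal (r ^ (n - 1) * \<bar>\<psi>' r\<bar> ^ n) * indicator {?s..e} r \<partial>lborel)"
      using s by (intro nn_integral_has_integral_lebesgue'[symmetric] integrable_integral[OF i2]) auto
    also have "\<dots> \<le> (\<integral>\<^sup>+r. ennreal (r ^ (n - 1) * \<bar>\<psi>' r\<bar> ^ n) * indicator {0<..} r \<partial>lborel)"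
      using s by (intro nn_integral_mono mult_left_mono) (auto simp: indicator_def)
    finally show "(\<integral>\<^sup>+r. f k r \<partial>lborel) \<le> (\<integral>\<^sup>+r. ennreal (r ^ (n - 1) * \<bar>\<psi>' r\<bar> ^ n) * indicator {0<..} r \<partial>lborel)" .
  qed
  finally show ?thesis .
qed

section \<open>Combining the radial and the tangential estimate\<close>

text \<open>
  From \<open>p ^ 2 + q ^ 2 = norm v ^ 2\<close> and \<open>n \<ge> 2\<close>, as \<open>p\<close> and
  \<open>q\<close> are at most \<open>norm v\<close>.
\<close>

lemma norm_power_split_le:
  fixes w v :: "'a::euclidean_space"
  assumes "2 \<le> n" "norm w = 1"
  shows "\<bar>v \<bullet> w\<bar> ^ n + norm (tangential w v) ^ n \<le> norm v ^ n"
proof -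
  have [simp]: "sgn w = w" using assms by (simp add: sgn_div_norm)
  have ww: "w \<bullet> w = 1" using assms by (simp add: norm_eq_1)
  define p q where "p = \<bar>v \<bullet> w\<bar>" and "q = norm (tangential w v)"
  have pq: "p\<^sup>2 + q\<^sup>2 = (norm v)\<^sup>2"
    unfolding p_def q_def tangential_def power2_norm_eq_inner
    by (simp add: inner_diff_left inner_diff_right ww inner_commute power2_eq_square algebra_simps)
  have le: "0 \<le> p" "p \<le> norm v" "0 \<le> q" "q \<le> norm v"
  proof -
    show "0 \<le> p" "0 \<le> q" by (simp_all add: p_def q_def)
    show "p \<le> norm v" by (rule power2_le_imp_le) (use pq zero_le_power2[of q] in linarith, simp)
    show "q \<le> norm v" by (rule power2_le_imp_le) (use pq zero_le_power2[of p] in linarith, simp)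
  qed
  have split: "x ^ n = x ^ (n - 2) * x\<^sup>2" for x :: real
    using power_add[of x "n - 2" 2] le_add_diff_inverse2[OF assms(1)] by (simp only:)
  have "p ^ n + q ^ n \<le> norm v ^ (n - 2) * p\<^sup>2 + norm v ^ (n - 2) * q\<^sup>2"
    unfolding split[of p] split[of q] using le by (intro add_mono mult_right_mono power_mono) auto
  also have "\<dots> = norm v ^ n" unfolding split[of "norm v"] pq[symmetric] by (simp add: algebra_simps)
  finally show ?thesis by (simp add: p_def q_def)
qed

lemma poincare_const_pos: "2 \<le> DIM('a) \<Longrightarrow> 0 < poincare_const TYPE('a::euclidean_space)"
  by (simp add: poincare_const_def)

lemma ennreal_le_mult_if_scaled_le:
  assumes "0 < c" "ennreal c * F \<le> ennreal d * T" "0 \<le> d"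
  shows "F \<le> ennreal (d / c) * T"
proof -
  have "F = ennreal (1 / c) * (ennreal c * F)" using assms by (simp add: mult.assoc[symmetric] ennreal_mult[symmetric])
  also have "\<dots> \<le> ennreal (1 / c) * (ennreal d * T)" by (intro mult_left_mono assms) simp
  also have "\<dots> = ennreal (d / c) * T" using assms by (simp add: mult.assoc[symmetric] ennreal_mult[symmetric])
  finally show ?thesis .
qed

lemma dilated_power_C1:
  fixes \<phi> :: "'a::euclidean_space \<Rightarrow> real"
  assumes n: "2 \<le> n" and \<phi>: "\<And>x. GDERIV \<phi> x :> D\<phi> x" and cont: "continuous_on UNIV D\<phi>"
  shows "continuous_on UNIV (\<lambda>x. power_gradient n \<phi> D\<phi> r x)"
proof -
  have "continuous_on UNIV \<phi>" by (rule GDERIV_imp_continuous_on[OF \<phi>])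
  have scale: "continuous_on UNIV (\<lambda>x::'a. r *\<^sub>R x)" by (intro continuous_intros)
  have "continuous_on UNIV (\<lambda>x. \<phi> (r *\<^sub>R x))" "continuous_on UNIV (\<lambda>x. D\<phi> (r *\<^sub>R x))"
    using continuous_on_compose2[OF \<open>continuous_on UNIV \<phi>\<close> scale] continuous_on_compose2[OF cont scale] by simp_all
  then show ?thesis by (intro continuous_intros)
qed

lemma sphere_bound_near_0:
  fixes \<phi> :: "'a::euclidean_space \<Rightarrow> real"
  assumes dim: "2 \<le> DIM('a)" and \<phi>: "\<And>x. GDERIV \<phi> x :> D\<phi> x" and cont: "continuous_on UNIV D\<phi>"
    and r: "0 < r" and \<epsilon>: "0 < \<epsilon>" "ennreal \<epsilon> \<le> emeasure cone_measure {w. \<phi> (r *\<^sub>R w) = 0}"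
  shows "sphere_mass DIM('a) \<phi> r \<le>
    ennreal ((2 * (poincare_const TYPE('a) * 2 ^ Suc DIM('a) / \<epsilon> * real DIM('a) * r)) ^ DIM('a)) *
    sphere_energy DIM('a) D\<phi> r"
proof (rule sphere_energy_bound[OF dim \<phi> cont r])
  let ?n = "DIM('a)"
  show "0 < poincare_const TYPE('a) * 2 ^ Suc DIM('a) / \<epsilon>" using poincare_const_pos[where 'a='a] dim \<epsilon> by simp
  have "ennreal \<epsilon> * sphere_mass ?n \<phi> r \<le>
     emeasure cone_measure {w. \<bar>\<phi> (r *\<^sub>R w)\<bar> ^ ?n = 0} * sphere_mass ?n \<phi> r"
    using \<epsilon> dim by (intro mult_right_mono) auto
  also have "\<dots> \<le> ennreal (poincare_const TYPE('a) * 2 ^ Suc ?n) *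
     sphere_variation (power_gradient ?n \<phi> D\<phi> r)"
    by (rule sphere_poincare_large_zero_set[OF dim GDERIV_abs_power_dilation[OF \<phi> dim] dilated_power_C1[OF dim \<phi> cont]]) simp
  finally show "sphere_mass ?n \<phi> r \<le> ennreal (poincare_const TYPE('a) * 2 ^ Suc ?n / \<epsilon>) *
     sphere_variation (power_gradient ?n \<phi> D\<phi> r)"
    using \<epsilon> poincare_const_pos[where 'a='a] dim by (intro ennreal_le_mult_if_scaled_le) auto
qed

text \<open>
  Here \<open>s\<close> stands for the distance to the outer sphere.  The choice of \<open>A\<close>
  makes \<open>\<rho> = A * s\<close> large enough for \<open>sphere_poincare_small_support\<close> with
  \<open>\<tau> = C * s ^ (n - 1)\<close>.
\<close>

lemma sphere_bound_near_boundary: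
  fixes \<phi> :: "'a::euclidean_space \<Rightarrow> real"
  assumes dim: "2 \<le> DIM('a)" and \<phi>: "\<And>x. GDERIV \<phi> x :> D\<phi> x" and cont: "continuous_on UNIV D\<phi>"
    and r: "0 < r" and C: "0 \<le> C" and s: "0 < s" and A: "A = 1 + real DIM('a) * 2 ^ Suc DIM('a) * C / unit_ball_vol DIM('a)" "A * s \<le> 1/2"
    and supp: "emeasure cone_measure {w. \<phi> (r *\<^sub>R w) \<noteq> 0} \<le> ennreal (C * s ^ (DIM('a) - 1))"
  shows "sphere_mass DIM('a) \<phi> r \<le>
    ennreal ((2 * (2 * poincare_const TYPE('a) / unit_ball_vol DIM('a) * (A * s) * real DIM('a) * r)) ^ DIM('a)) *
    sphere_energy DIM('a) D\<phi> r"
proof (rule sphere_energy_bound[OF dim \<phi> cont r])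
  let ?n = "DIM('a)" and ?\<beta> = "unit_ball_vol (real DIM('a))"
  define \<rho> where "\<rho> = A * s"
  have A1: "1 \<le> A" using C A(1) by simp
  have \<rho>: "0 < \<rho>" "\<rho> \<le> 1/2" using A1 s A by (auto simp: \<rho>_def)
  show "0 < 2 * poincare_const TYPE('a) / unit_ball_vol DIM('a) * (A * s)" using poincare_const_pos[where 'a='a] dim A1 s by simp
  have small: "real ?n * 2 ^ ?n * (\<rho> * (C * s ^ (?n - 1))) \<le> ?\<beta> * \<rho> ^ ?n / 2"
  proof -
    have "real ?n * 2 ^ Suc ?n * C / ?\<beta> \<le> A" using A by simp
    also have "\<dots> \<le> A ^ (?n - 1)" using A1 dim power_increasing[of 1 "?n - 1" A] by simp
    finally have "real ?n * 2 ^ Suc ?n * C \<le> A ^ (?n - 1) * ?\<beta>" by (simp add: pos_divide_le_eq)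
    then have "real ?n * 2 ^ Suc ?n * C * (\<rho> * s ^ (?n - 1) / 2) \<le> A ^ (?n - 1) * ?\<beta> * (\<rho> * s ^ (?n - 1) / 2)"
      using \<rho> s by (intro mult_right_mono) auto
    also have "\<dots> = ?\<beta> * \<rho> ^ ?n / 2"
      using power_Suc2[of \<rho> "?n - 1"] by (simp add: \<rho>_def power_mult_distrib)
    finally show ?thesis by (simp add: mult_ac)
  qed
  have "ennreal (?\<beta> * \<rho> ^ ?n / 2) * sphere_mass ?n \<phi> r
     \<le> ennreal (poincare_const TYPE('a) * \<rho> ^ Suc ?n) *
     sphere_variation (power_gradient ?n \<phi> D\<phi> r)"
    using \<rho> supp C s small dim
    by (intro sphere_poincare_small_support[OF dim GDERIV_abs_power_dilation[OF \<phi> dim] dilated_power_C1[OF dim \<phi> cont], where \<tau> = "C * s ^ (?n - 1)"]) auto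
  then have "sphere_mass ?n \<phi> r \<le> ennreal (poincare_const TYPE('a) * \<rho> ^ Suc ?n / (?\<beta> * \<rho> ^ ?n / 2)) *
     sphere_variation (power_gradient ?n \<phi> D\<phi> r)"
    using \<rho> poincare_const_pos[where 'a='a] dim by (intro ennreal_le_mult_if_scaled_le) auto
  also have "poincare_const TYPE('a) * \<rho> ^ Suc ?n / (?\<beta> * \<rho> ^ ?n / 2) = 2 * poincare_const TYPE('a) / ?\<beta> * (A * s)"
    using \<rho>(1) by (simp add: \<rho>_def[symmetric])
  finally show "sphere_mass ?n \<phi> r \<le> ennreal (2 * poincare_const TYPE('a) / ?\<beta> * (A * s)) *
     sphere_variation (power_gradient ?n \<phi> D\<phi> r)" .
qed

text \<open>
  The gain is of first and the loss of second order in \<open>\<kappa>\<close>.  For small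
  \<open>\<kappa>\<close> the gain is at least twice the loss where \<open>t / (1 + t)\<^sup>2 \<ge>
  g\<close>, and elsewhere the loss is at most half of the surplus \<open>K\<close> that the
  tangential part provides.
\<close>

lemma hardy_gain_choice:
  fixes g K :: real
  assumes n: "2 \<le> n" and g: "0 < g" and K: "0 < K"
  obtains \<kappa> \<delta> where "0 \<le> \<kappa>" "\<kappa> \<le> 1/2" "(real n - 1) * \<kappa> \<le> 1" "0 < \<delta>"
    "\<And>t. 0 \<le> t \<Longrightarrow> g \<le> t / (1 + t)\<^sup>2 \<Longrightarrow> ((real n - 1) / real n) ^ n + \<delta> \<le> hardy_gain n \<kappa> t"
    "\<And>t. 0 \<le> t \<Longrightarrow> ((real n - 1) / real n) ^ n + \<delta> \<le> hardy_gain n \<kappa> t + K"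
proof -
  let ?H = "((real n - 1) / real n) ^ n"
  have H: "0 < ?H" "?H \<le> 1" using n by (auto intro!: power_le_one)
  \<comment> \<open>\<open>a * \<kappa>\<close> is the guaranteed relative gain\<close>
  define a where "a = real n / 2 ^ n * g"
  have a: "0 < a" using n g by (simp add: a_def)
  define N where "N = 2 * (real n)\<^sup>2"
  have N: "0 < N" "real n \<le> N" "2 * (real n - 1)\<^sup>2 \<le> N" using n
    by (auto simp: N_def power2_eq_square algebra_simps)
  \<comment> \<open>the first bound ensures the side conditions on \<open>\<kappa>\<close>, the other two compare the loss with \<open>a * \<kappa>\<close> and with \<open>K\<close>\<close>
  define \<kappa> where "\<kappa> = Min {1 / N, a / N, K / N}"
  have \<kappa>: "0 < \<kappa>" "\<kappa> \<le> 1 / N" "\<kappa> \<le> a / N" "\<kappa> \<le> K / N" using a N K by (auto simp: \<kappa>_def)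
  have N2: "2 \<le> N" using N n by linarith
  have \<kappa>1: "\<kappa> \<le> 1/2" using \<kappa>(2) N2 
  proof -
    have "1 / N \<le> 1 / 2" using N2 by (intro frac_le) auto
    then show ?thesis using \<kappa>(2) by linarith
  qed
  have sq: "(real n - 1)\<^sup>2 * \<kappa>\<^sup>2 \<le> a * \<kappa> / 2" "(real n - 1)\<^sup>2 * \<kappa>\<^sup>2 \<le> K / 2"
  proof -
    have "(real n - 1)\<^sup>2 * \<kappa>\<^sup>2 \<le> (N / 2 * \<kappa>) * \<kappa>"
      using N \<kappa> by (simp add: power2_eq_square[of \<kappa>] mult.assoc[symmetric] mult_right_mono)
    also have "\<dots> \<le> (a / 2) * \<kappa>" using \<kappa> N by (intro mult_right_mono) (auto simp: field_simps)
    finally show "(real n - 1)\<^sup>2 * \<kappa>\<^sup>2 \<le> a * \<kappa> / 2" by simp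
    have "(real n - 1)\<^sup>2 * \<kappa>\<^sup>2 \<le> (N / 2 * \<kappa>) * \<kappa>"
      using N \<kappa> by (simp add: power2_eq_square[of \<kappa>] mult.assoc[symmetric] mult_right_mono)
    also have "\<dots> \<le> (K / 2) * 1" using \<kappa> N \<kappa>1 K by (intro mult_mono) (auto simp: field_simps)
    finally show "(real n - 1)\<^sup>2 * \<kappa>\<^sup>2 \<le> K / 2" by simp
  qed
  define \<delta> where "\<delta> = min (?H * (a * \<kappa> / 2)) (K / 2)"
  show thesis
  proof (rule that[of \<kappa> \<delta>])
    show "0 \<le> \<kappa>" "\<kappa> \<le> 1/2" using \<kappa> \<kappa>1 by auto
    have "(real n - 1) * \<kappa> \<le> N * \<kappa>" using N \<kappa> by (intro mult_right_mono) auto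
    also have "\<dots> \<le> 1" using \<kappa> N by (simp add: field_simps)
    finally show "(real n - 1) * \<kappa> \<le> 1" .
    show "0 < \<delta>" using H a \<kappa> K by (simp add: \<delta>_def)
    fix t :: real assume t: "0 \<le> t"
    { assume gt: "g \<le> t / (1 + t)\<^sup>2"
      have "a * \<kappa> = real n * \<kappa> / 2 ^ n * g" by (simp add: a_def)
      also have "\<dots> \<le> real n * \<kappa> / 2 ^ n * (t / (1 + t)\<^sup>2)" using gt \<kappa> by (intro mult_left_mono) auto
      finally have "1 + a * \<kappa> / 2 \<le> 1 - (real n - 1)\<^sup>2 * \<kappa>\<^sup>2 + real n * \<kappa> / 2 ^ n * (t / (1 + t)\<^sup>2)"
        using sq(1) by linarith
      then have "?H * (1 + a * \<kappa> / 2) \<le> hardy_gain n \<kappa> t"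
        unfolding hardy_gain_def using H by (intro mult_left_mono) auto
      moreover have "\<delta> \<le> ?H * (a * \<kappa> / 2)" by (simp add: \<delta>_def)
      ultimately show "?H + \<delta> \<le> hardy_gain n \<kappa> t" by (simp add: distrib_left) }
    have "0 \<le> real n * \<kappa> / 2 ^ n * (t / (1 + t)\<^sup>2)" using \<kappa> t by simp
    then have "1 - K / 2 \<le> 1 - (real n - 1)\<^sup>2 * \<kappa>\<^sup>2 + real n * \<kappa> / 2 ^ n * (t / (1 + t)\<^sup>2)" using sq(2) by linarith
    then have "?H * (1 - K / 2) \<le> hardy_gain n \<kappa> t"
      unfolding hardy_gain_def using H by (intro mult_left_mono) auto
    moreover have "?H * (K / 2) \<le> 1 * (K / 2)" using H K by (intro mult_right_mono) auto
    moreover have "\<delta> \<le> K / 2" by (simp add: \<delta>_def)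
    ultimately show "?H + \<delta> \<le> hardy_gain n \<kappa> t + K" by (simp add: right_diff_distrib)
  qed
qed

definition C1_supported :: "'a::euclidean_space set \<Rightarrow> ('a \<Rightarrow> real) \<Rightarrow> ('a \<Rightarrow> 'a) \<Rightarrow> bool" where
  "C1_supported \<Omega> \<phi> D\<phi> \<longleftrightarrow> (\<forall>x. GDERIV \<phi> x :> D\<phi> x) \<and> continuous_on UNIV D\<phi> \<and> (\<forall>x. x \<notin> \<Omega> \<longrightarrow> \<phi> x = 0)"

text \<open>
  The Poincare inequality on the sphere of radius \<open>r\<close> at the scale \<open>r * ln (R /
  r)\<close> of the Hardy weight, uniformly for all functions that vanish outside
  \<open>\<Omega>\<close>.
\<close>

definition tangential_bound :: "'a::euclidean_space set \<Rightarrow> real \<Rightarrow> real \<Rightarrow> real \<Rightarrow> bool" where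
  "tangential_bound \<Omega> R M r \<longleftrightarrow> (\<forall>\<phi> D\<phi>. C1_supported \<Omega> \<phi> D\<phi> \<longrightarrow>
    sphere_mass DIM('a) \<phi> r \<le>
    ennreal ((M * (r * ln (R / r))) ^ DIM('a)) *
    sphere_energy DIM('a) D\<phi> r)"

text \<open>
  On each sphere either the radial gain or the tangential energy beats the loss; integrating over the
  radii uses \<open>radial_hardy\<close> on the rays.
\<close>

lemma hardy_improved_C1:
  fixes \<Omega> :: "'a::euclidean_space set"
  assumes dim: "2 \<le> DIM('a)" and R: "0 < R" and M: "0 < M" and r12: "0 < r1" "r1 < R" "0 < r2" "r2 < R"
    and ends: "\<And>r. 0 < r \<Longrightarrow> r < R \<Longrightarrow> r < r1 \<or> r2 < r \<Longrightarrow> tangential_bound \<Omega> R M r"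
  obtains \<delta> where "0 < \<delta>"
    "\<And>\<phi> D\<phi> e. C1_supported \<Omega> \<phi> D\<phi> \<Longrightarrow> 0 < e \<Longrightarrow> e < R \<Longrightarrow> (\<forall>x. e \<le> norm x \<longrightarrow> \<phi> x = 0) \<Longrightarrow>
      ennreal (((real DIM('a) - 1) / real DIM('a)) ^ DIM('a) + \<delta>) *
        (\<integral>\<^sup>+x. ennreal (\<bar>\<phi> x\<bar> ^ DIM('a) / (norm x ^ DIM('a) * ln (R / norm x) ^ DIM('a))) \<partial>lborel) \<le>
      (\<integral>\<^sup>+x. ennreal (norm (D\<phi> x) ^ DIM('a)) \<partial>lborel)"
proof -
  let ?n = "DIM('a)" and ?H = "((real DIM('a) - 1) / real DIM('a)) ^ DIM('a)"
  define t1 t2 where "t1 = ln (R / r1)" and "t2 = ln (R / r2)"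
  have t12: "0 < t1" "0 < t2" using r12 by (auto simp: t1_def t2_def)
  \<comment> \<open>a lower bound of \<open>t / (1 + t)\<^sup>2\<close> for \<open>t2 \<le> t \<le> t1\<close>, that is for \<open>r1 \<le> r \<le> r2\<close>\<close>
  define g where "g = t2 / (1 + t1)\<^sup>2"
  define K where "K = 1 / M ^ ?n"
  have gK: "0 < g" "0 < K" using t12 M by (auto simp: g_def K_def)
  obtain \<kappa> \<delta> where \<kappa>: "0 \<le> \<kappa>" "\<kappa> \<le> 1/2" "(real ?n - 1) * \<kappa> \<le> 1" and \<delta>: "0 < \<delta>"
    and mid: "\<And>t. 0 \<le> t \<Longrightarrow> g \<le> t / (1 + t)\<^sup>2 \<Longrightarrow> ?H + \<delta> \<le> hardy_gain ?n \<kappa> t"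
    and outer: "\<And>t. 0 \<le> t \<Longrightarrow> ?H + \<delta> \<le> hardy_gain ?n \<kappa> t + K"
    using hardy_gain_choice[OF dim gK] by blast
  have H: "0 \<le> ?H" using dim by simp
  show thesis
  proof (rule that[OF \<delta>])
    fix \<phi> :: "'a \<Rightarrow> real" and D\<phi> e
    assume C1: "C1_supported \<Omega> \<phi> D\<phi>" and e01: "0 < e" "e < R" and vanish: "\<forall>x. e \<le> norm x \<longrightarrow> \<phi> x = 0"
    have \<phi>: "GDERIV \<phi> x :> D\<phi> x" and cont: "continuous_on UNIV D\<phi>" for x
      using C1 by (auto simp: C1_supported_def)
    have e: "0 < e" "e < R" "\<And>x. e \<le> norm x \<Longrightarrow> \<phi> x = 0" using e01 vanish by auto
    have cont\<phi>: "continuous_on UNIV \<phi>" by (rule GDERIV_imp_continuous_on[OF \<phi>])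
    have [measurable]: "D\<phi> \<in> borel_measurable borel" "\<phi> \<in> borel_measurable borel"
      using cont cont\<phi> by (auto intro: borel_measurable_continuous_onI)
    define F where "F r = sphere_mass ?n \<phi> r" for r
    define T where "T r = sphere_energy ?n D\<phi> r" for r
    define P where "P r = (\<integral>\<^sup>+w. ennreal (\<bar>w \<bullet> D\<phi> (r *\<^sub>R w)\<bar> ^ ?n) \<partial>cone_measure)" for r
    define w where "w r = 1 / (r ^ ?n * ln (R / r) ^ ?n)" for r
    define G where "G r = hardy_gain ?n \<kappa> (ln (R / r))" for r
    have [measurable]: "F \<in> borel_measurable borel" "T \<in> borel_measurable borel" "P \<in> borel_measurable borel"
      unfolding F_def T_def P_def by measurable
    have [measurable]: "w \<in> borel_measurable borel" "G \<in> borel_measurable borel"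
      unfolding w_def G_def hardy_gain_def by measurable
    have w_nonneg: "0 \<le> w r" if "0 < r" "r < R" for r using that by (simp add: w_def)
    have G_nonneg: "0 \<le> G r" if "0 < r" "r < R" for r
      unfolding G_def using that dim \<kappa> by (intro hardy_gain_nonneg) auto
    have pos: "AE r in radius_measure ?n. 0 < r"
      unfolding radius_measure_def by (subst AE_density) (auto simp: indicator_def)
    \<comment> \<open>the tangential energy enters only for the radii outside \<open>[r1, r2]\<close>\<close>
    have sphere: "ennreal (?H + \<delta>) * (ennreal (w r) * F r) \<le> ennreal (G r * w r) * F r + T r" if r: "0 < r" "r < R" for r
    proof -
      have t: "0 < ln (R / r)" using r by simp
      show ?thesis
      proof (cases "r < r1 \<or> r2 < r")
        case True
        have "F r \<le> ennreal ((M * (r * ln (R / r))) ^ ?n) * T r"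
          using ends[OF r True] C1 unfolding F_def T_def tangential_bound_def by blast
        then have "ennreal (K * w r) * F r \<le> ennreal (K * w r) * (ennreal ((M * (r * ln (R / r))) ^ ?n) * T r)"
          by (rule mult_left_mono) simp
        also have "\<dots> = ennreal (K * w r * (M * (r * ln (R / r))) ^ ?n) * T r"
          using gK w_nonneg[OF r] r t M by (subst ennreal_mult) (auto simp: mult.assoc)
        also have "K * w r * (M * (r * ln (R / r))) ^ ?n = 1"
          unfolding K_def w_def power_mult_distrib using M r t by simp
        finally have KT: "ennreal (K * w r) * F r \<le> T r" by simp
        have "ennreal (?H + \<delta>) * (ennreal (w r) * F r) = ennreal ((?H + \<delta>) * w r) * F r"
          using H \<delta> w_nonneg[OF r] by (simp add: ennreal_mult mult.assoc)
        also have "\<dots> \<le> ennreal ((G r + K) * w r) * F r"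
          using outer[of "ln (R / r)"] t w_nonneg[OF r] unfolding G_def
          by (intro mult_right_mono ennreal_leI) auto
        also have "\<dots> = ennreal (G r * w r) * F r + ennreal (K * w r) * F r"
          using gK w_nonneg[OF r] G_nonneg[OF r] by (simp add: distrib_right ennreal_plus)
        also have "\<dots> \<le> ennreal (G r * w r) * F r + T r" using KT by (rule add_left_mono)
        finally show ?thesis .
      next
        case False
        then have rr: "r1 \<le> r" "r \<le> r2" by auto
        have "t2 \<le> ln (R / r)" unfolding t2_def using rr r r12 by (simp add: field_simps)
        moreover have "ln (R / r) \<le> t1" unfolding t1_def using rr r r12 by (simp add: field_simps)
        ultimately have "g \<le> ln (R / r) / (1 + ln (R / r))\<^sup>2"
          unfolding g_def using t t12 by (intro frac_le power_mono) auto
        from mid[OF less_imp_le[OF t] this] have "(?H + \<delta>) * w r \<le> G r * w r"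
          unfolding G_def using w_nonneg[OF r] by (rule mult_right_mono)
        then have "ennreal ((?H + \<delta>) * w r) * F r \<le> ennreal (G r * w r) * F r"
          by (rule mult_right_mono[OF ennreal_leI]) simp
        then show ?thesis using H \<delta> w_nonneg[OF r] by (simp add: ennreal_mult mult.assoc add_increasing2)
      qed
    qed
    have radial: "(\<integral>\<^sup>+r. ennreal (G r * w r) * indicator {0<..<R} r * F r \<partial>radius_measure ?n) \<le> (\<integral>\<^sup>+r. P r \<partial>radius_measure ?n)"
    proof -
      let ?\<mu> = "\<lambda>r. ennreal (real ?n * r ^ (?n - 1)) * indicator {0<..} r"
      let ?c = "\<lambda>r. ennreal (G r * w r) * indicator {0<..<R} r"
      let ?f = "\<lambda>r v. ennreal (\<bar>\<phi> (r *\<^sub>R v)\<bar> ^ ?n)"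
      let ?d = "\<lambda>r v. ennreal (\<bar>v \<bullet> D\<phi> (r *\<^sub>R v)\<bar> ^ ?n)"
      let ?h = "\<lambda>r v. ennreal (hardy_gain ?n \<kappa> (ln (R / r)) / (r * ln (R / r) ^ ?n) * \<bar>\<phi> (r *\<^sub>R v)\<bar> ^ ?n) * indicator {0<..<R} r"
      have "(\<integral>\<^sup>+r. ?c r * F r \<partial>radius_measure ?n) =
        (\<integral>\<^sup>+r. (\<integral>\<^sup>+v. ?\<mu> r * (?c r * ?f r v) \<partial>cone_measure) \<partial>lborel)"
        unfolding F_def by (subst nn_integral_radius_measure) (auto simp: nn_integral_cmult)
      also have "\<dots> = (\<integral>\<^sup>+v. (\<integral>\<^sup>+r. ?\<mu> r * (?c r * ?f r v) \<partial>lborel) \<partial>cone_measure)"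
      proof (rule pair_sigma_finite.Fubini')
        show "pair_sigma_finite (cone_measure :: 'a measure) (lborel :: real measure)" by unfold_locales
      qed measurable
      also have "\<dots> \<le> (\<integral>\<^sup>+v. (\<integral>\<^sup>+r. ?\<mu> r * ?d r v \<partial>lborel) \<partial>cone_measure)"
      proof (rule nn_integral_mono_AE, use AE_cone_measure in eventually_elim)
        case (elim v)
        have \<psi>: "((\<lambda>r. \<phi> (r *\<^sub>R v)) has_real_derivative v \<bullet> D\<phi> (r *\<^sub>R v)) (at r)" for r
        proof -
          have "((\<lambda>r. r *\<^sub>R v) has_derivative (\<lambda>h. h *\<^sub>R v)) (at r)" by (auto intro!: derivative_eq_intros)
          from has_derivative_compose[OF this \<phi>[unfolded gderiv_def]] show ?thesis
            by (simp add: has_field_derivative_def mult_commute_abs)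
        qed
        have "(\<integral>\<^sup>+r. ?\<mu> r * (?c r * ?f r v) \<partial>lborel) =
          (\<integral>\<^sup>+r. ennreal (real ?n) * (?h r v) \<partial>lborel)"
        proof (rule nn_integral_cong)
          fix r :: real
          show "?\<mu> r * (?c r * ?f r v) =
            ennreal (real ?n) * (?h r v)"
          proof (cases "0 < r \<and> r < R")
            case True
            have "r ^ ?n = r * r ^ (?n - 1)" using power_Suc[of r "?n - 1"] by simp
            then have "real ?n * r ^ (?n - 1) * (G r * w r * \<bar>\<phi> (r *\<^sub>R v)\<bar> ^ ?n) =
               real ?n * (hardy_gain ?n \<kappa> (ln (R / r)) / (r * ln (R / r) ^ ?n) * \<bar>\<phi> (r *\<^sub>R v)\<bar> ^ ?n)"
              using True by (simp add: G_def w_def)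
            moreover have "0 \<le> hardy_gain ?n \<kappa> (ln (R / r)) / (r * ln (R / r) ^ ?n) * \<bar>\<phi> (r *\<^sub>R v)\<bar> ^ ?n"
              using True G_nonneg[of r] by (auto simp: G_def)
            ultimately show ?thesis
              using True G_nonneg[of r] w_nonneg[of r] by (simp add: ennreal_mult[symmetric])
          qed (auto simp: indicator_def)
        qed
        also have "\<dots> = ennreal (real ?n) * (\<integral>\<^sup>+r. ?h r v \<partial>lborel)"
          by (rule nn_integral_cmult) (unfold hardy_gain_def, measurable)
        also have "\<dots> \<le> ennreal (real ?n) * (\<integral>\<^sup>+r. ennreal (r ^ (?n - 1) * \<bar>v \<bullet> D\<phi> (r *\<^sub>R v)\<bar> ^ ?n) * indicator {0<..} r \<partial>lborel)"
        proof (rule mult_left_mono[OF radial_hardy[OF dim e(1,2) \<kappa> \<psi>]])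
          show "continuous_on UNIV (\<lambda>r. v \<bullet> D\<phi> (r *\<^sub>R v))"
            by (intro continuous_intros continuous_on_compose2[OF cont]) auto
          show "\<phi> (r *\<^sub>R v) = 0" if "e \<le> r" for r using e that elim by (intro e(3)) auto
        qed simp
        also have "\<dots> = (\<integral>\<^sup>+r. ennreal (real ?n) * (ennreal (r ^ (?n - 1) * \<bar>v \<bullet> D\<phi> (r *\<^sub>R v)\<bar> ^ ?n) * indicator {0<..} r) \<partial>lborel)"
          by (rule nn_integral_cmult[symmetric]) measurable
        also have "\<dots> = (\<integral>\<^sup>+r. ?\<mu> r * ?d r v \<partial>lborel)"
          by (rule nn_integral_cong) (auto simp: indicator_def ennreal_mult[symmetric] mult.assoc)
        finally show ?case .
      qed
      also have "\<dots> = (\<integral>\<^sup>+r. (\<integral>\<^sup>+v. ?\<mu> r * ?d r v \<partial>cone_measure) \<partial>lborel)"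
      proof (rule pair_sigma_finite.Fubini')
        show "pair_sigma_finite (lborel :: real measure) (cone_measure :: 'a measure)" by unfold_locales
      qed measurable
      also have "\<dots> = (\<integral>\<^sup>+r. P r \<partial>radius_measure ?n)"
        unfolding P_def by (subst nn_integral_radius_measure) (auto simp: nn_integral_cmult)
      finally show ?thesis .
    qed
    have "ennreal (?H + \<delta>) * (\<integral>\<^sup>+x. ennreal (\<bar>\<phi> x\<bar> ^ ?n / (norm x ^ ?n * ln (R / norm x) ^ ?n)) \<partial>lborel) =
      ennreal (?H + \<delta>) * (\<integral>\<^sup>+r. (\<integral>\<^sup>+v. ennreal (\<bar>\<phi> (r *\<^sub>R v)\<bar> ^ ?n / (norm (r *\<^sub>R v) ^ ?n * ln (R / norm (r *\<^sub>R v)) ^ ?n)) \<partial>cone_measure) \<partial>radius_measure ?n)"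
      by (subst nn_integral_polar) auto
    also have "\<dots> = ennreal (?H + \<delta>) * (\<integral>\<^sup>+r. ennreal (w r) * indicator {0<..<R} r * F r \<partial>radius_measure ?n)"
    proof (rule arg_cong[where f = "\<lambda>x. ennreal (?H + \<delta>) * x"], rule nn_integral_cong_AE, use pos in eventually_elim)
      case (elim r)
      have "(\<integral>\<^sup>+v. ennreal (\<bar>\<phi> (r *\<^sub>R v)\<bar> ^ ?n / (norm (r *\<^sub>R v) ^ ?n * ln (R / norm (r *\<^sub>R v)) ^ ?n)) \<partial>cone_measure) =
         (\<integral>\<^sup>+v. ennreal (w r) * indicator {0<..<R} r * ennreal (\<bar>\<phi> (r *\<^sub>R v)\<bar> ^ ?n) \<partial>cone_measure)"
      proof (rule nn_integral_cong_AE, use AE_cone_measure in eventually_elim)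
        case (elim v)
        show ?case
        proof (cases "r < R")
          case True
          then show ?thesis using elim \<open>0 < r\<close> w_nonneg[of r] by (simp add: w_def ennreal_mult[symmetric])
        next
          case False
          then have "\<phi> (r *\<^sub>R v) = 0" using e elim \<open>0 < r\<close> by (intro e(3)) auto
          then show ?thesis using False by (simp add: power_0_left)
        qed
      qed
      then show ?case by (simp add: F_def nn_integral_cmult)
    qed
    also have "\<dots> = (\<integral>\<^sup>+r. ennreal (?H + \<delta>) * (ennreal (w r) * indicator {0<..<R} r * F r) \<partial>radius_measure ?n)"
      by (rule nn_integral_cmult[symmetric]) measurable
    also have "\<dots> \<le> (\<integral>\<^sup>+r. ennreal (G r * w r) * indicator {0<..<R} r * F r + T r \<partial>radius_measure ?n)"
    proof (rule nn_integral_mono)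
      fix r
      show "ennreal (?H + \<delta>) * (ennreal (w r) * indicator {0<..<R} r * F r) \<le> ennreal (G r * w r) * indicator {0<..<R} r * F r + T r"
        using sphere[of r] by (auto simp: indicator_def)
    qed
    also have "\<dots> = (\<integral>\<^sup>+r. ennreal (G r * w r) * indicator {0<..<R} r * F r \<partial>radius_measure ?n) + (\<integral>\<^sup>+r. T r \<partial>radius_measure ?n)"
      by (rule nn_integral_add) measurable
    also have "\<dots> \<le> (\<integral>\<^sup>+r. P r \<partial>radius_measure ?n) + (\<integral>\<^sup>+r. T r \<partial>radius_measure ?n)"
      using radial by (rule add_right_mono)
    also have "\<dots> = (\<integral>\<^sup>+r. P r + T r \<partial>radius_measure ?n)"
      by (rule nn_integral_add[symmetric]) measurable
    also have "\<dots> \<le> (\<integral>\<^sup>+r. (\<integral>\<^sup>+v. ennreal (norm (D\<phi> (r *\<^sub>R v)) ^ ?n) \<partial>cone_measure) \<partial>radius_measure ?n)"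
    proof (rule nn_integral_mono)
      fix r
      have "P r + T r = (\<integral>\<^sup>+v. ennreal (\<bar>v \<bullet> D\<phi> (r *\<^sub>R v)\<bar> ^ ?n) + ennreal (norm (tangential v (D\<phi> (r *\<^sub>R v))) ^ ?n) \<partial>cone_measure)"
        unfolding P_def T_def by (rule nn_integral_add[symmetric]) measurable
      also have "\<dots> \<le> (\<integral>\<^sup>+v. ennreal (norm (D\<phi> (r *\<^sub>R v)) ^ ?n) \<partial>cone_measure)"
      proof (rule nn_integral_mono_AE, use AE_cone_measure in eventually_elim)
        case (elim v)
        show ?case using norm_power_split_le[OF dim elim, of "D\<phi> (r *\<^sub>R v)"]
          by (simp add: inner_commute ennreal_leI flip: ennreal_plus)
      qed
      finally show "P r + T r \<le> (\<integral>\<^sup>+v. ennreal (norm (D\<phi> (r *\<^sub>R v)) ^ ?n) \<partial>cone_measure)" .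
    qed
    also have "\<dots> = (\<integral>\<^sup>+x. ennreal (norm (D\<phi> x) ^ ?n) \<partial>lborel)"
      by (rule nn_integral_polar[symmetric]) measurable
    finally show "ennreal (?H + \<delta>) * (\<integral>\<^sup>+x. ennreal (\<bar>\<phi> x\<bar> ^ ?n / (norm x ^ ?n * ln (R / norm x) ^ ?n)) \<partial>lborel) \<le>
      (\<integral>\<^sup>+x. ennreal (norm (D\<phi> x) ^ ?n) \<partial>lborel)" .
  qed
qed

section \<open>Bump functions and the fundamental lemma of the calculus of variations\<close>

text \<open>
  The functions that arise from \<open>exp (- 1 / x)\<close> by differentiation; the class is closed
  under derivatives and under multiplication by constants, which makes smoothness an induction.
\<close>

definition exp_germ :: "real poly \<Rightarrow> real \<Rightarrow> real" where
  "exp_germ p x = (if 0 < x then poly p (1 / x) * exp (- (1 / x)) else 0)"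

lemma exp_germ_tendsto_0: "(exp_germ p \<longlongrightarrow> 0) (at 0)"
proof -
  have "((\<lambda>y. \<Sum>i\<le>degree p. coeff p i * (y ^ i / exp y)) \<longlongrightarrow> (\<Sum>i\<le>degree p. coeff p i * 0)) at_top"
    by (intro tendsto_intros tendsto_power_div_exp_0)
  then have "((\<lambda>y. poly p y * exp (- y)) \<longlongrightarrow> 0) at_top"
    by (simp add: poly_altdef sum_distrib_right exp_minus divide_inverse mult.assoc)
  then have "((\<lambda>x. poly p (inverse x) * exp (- inverse x)) \<longlongrightarrow> 0) (at_right 0)"
    by (rule filterlim_compose[OF _ filterlim_inverse_at_top_right])
  then have "(exp_germ p \<longlongrightarrow> 0) (at_right 0)"
    by (rule Lim_transform_eventually)
       (auto simp: eventually_at_right_less exp_germ_def inverse_eq_divide intro: eventually_mono[OF eventually_at_right_less])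
  moreover have "(exp_germ p \<longlongrightarrow> 0) (at_left 0)"
    by (rule Lim_transform_eventually[OF tendsto_const])
       (auto simp: exp_germ_def eventually_at_filter)
  ultimately show ?thesis by (intro filterlim_split_at)
qed

lemma exp_germ_deriv: "(exp_germ p has_real_derivative exp_germ ([:0, 0, 1:] * (p - pderiv p)) x) (at x)"
proof -
  consider "0 < x" | "x < 0" | "x = 0" by linarith
  then show ?thesis
  proof cases
    case 1
    have inv: "((\<lambda>x. 1 / x) has_real_derivative - (1 / x)\<^sup>2) (at x)"
      using 1 by (auto intro!: derivative_eq_intros simp: power2_eq_square)
    have "((\<lambda>x. poly p (1 / x) * exp (- (1 / x))) has_real_derivative
        poly p (1 / x) * (exp (- (1 / x)) * - (- (1 / x)\<^sup>2)) + poly (pderiv p) (1 / x) * - (1 / x)\<^sup>2 * exp (- (1 / x))) (at x)"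
      by (rule DERIV_mult'[OF DERIV_chain2[OF poly_DERIV inv] DERIV_chain2[OF DERIV_exp DERIV_minus[OF inv]]])
    also have "poly p (1 / x) * (exp (- (1 / x)) * - (- (1 / x)\<^sup>2)) + poly (pderiv p) (1 / x) * - (1 / x)\<^sup>2 * exp (- (1 / x)) = exp_germ ([:0, 0, 1:] * (p - pderiv p)) x"
      using 1 by (simp add: exp_germ_def power2_eq_square field_simps)
    finally show ?thesis
      by (rule has_field_derivative_transform_within_open[of _ _ _ "{0<..}"]) (use 1 in \<open>auto simp: exp_germ_def\<close>)
  next
    case 2
    have "((\<lambda>x. 0) has_real_derivative exp_germ ([:0, 0, 1:] * (p - pderiv p)) x) (at x)"
      using 2 by (simp add: exp_germ_def)
    then show ?thesis
      by (rule has_field_derivative_transform_within_open[of _ _ _ "{..<0}"]) (use 2 in \<open>auto simp: exp_germ_def\<close>)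
  next
    case 3
    have "exp_germ p h / h = exp_germ ([:0, 1:] * p) h" for h
      by (simp add: exp_germ_def)
    then show ?thesis
      using exp_germ_tendsto_0[of "[:0, 1:] * p"] 3 by (simp add: DERIV_def exp_germ_def[of _ 0])
  qed
qed

text \<open>
  Allows any derivative that is at hand to be used in place of the Frechet derivative operator of the
  definition.
\<close>

lemma k_times_cont_differentiable_SucI:
  assumes "\<And>x. (f has_derivative f' x) (at x)" "\<And>v. k_times_cont_differentiable k (\<lambda>x. f' x v)"
  shows "k_times_cont_differentiable (Suc k) f"
proof -
  have "frechet_derivative f (at x) = f' x" for x
    using frechet_derivative_at[OF assms(1)] by simp
  with assms show ?thesis by (auto simp: differentiable_def)
qed

lemma k_times_cont_differentiable_SucD:
  assumes "k_times_cont_differentiable (Suc k) f"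
  shows "(f has_derivative frechet_derivative f (at x)) (at x)"
    and "k_times_cont_differentiable k (\<lambda>x. frechet_derivative f (at x) v)"
  using assms frechet_derivative_works by auto

lemma k_times_cont_differentiable_const: "k_times_cont_differentiable k (\<lambda>x. c)"
proof (induction k arbitrary: c)
  case (Suc k)
  show ?case by (rule k_times_cont_differentiable_SucI[OF has_derivative_const Suc.IH])
qed simp

lemma k_times_cont_differentiable_Suc_imp: "k_times_cont_differentiable (Suc k) f \<Longrightarrow> k_times_cont_differentiable k f"
proof (induction k arbitrary: f)
  case 0
  then show ?case by (auto intro!: continuous_at_imp_continuous_on differentiable_imp_continuous_within)
next
  case (Suc k)
  show ?case
    by (rule k_times_cont_differentiable_SucI[OF k_times_cont_differentiable_SucD(1)[OF Suc.prems]
         Suc.IH[OF k_times_cont_differentiable_SucD(2)[OF Suc.prems]]])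
qed

lemma k_times_cont_differentiable_add:
  "k_times_cont_differentiable k f \<Longrightarrow> k_times_cont_differentiable k g \<Longrightarrow> k_times_cont_differentiable k (\<lambda>x. f x + g x)"
proof (induction k arbitrary: f g)
  case 0
  then show ?case by (auto intro!: continuous_intros)
next
  case (Suc k)
  show ?case
    by (rule k_times_cont_differentiable_SucI[OF has_derivative_add[OF Suc.prems[THEN k_times_cont_differentiable_SucD(1)]]
       Suc.IH[OF Suc.prems[THEN k_times_cont_differentiable_SucD(2)]]])
qed

lemma k_times_cont_differentiable_mult:
  "k_times_cont_differentiable k f \<Longrightarrow> k_times_cont_differentiable k g \<Longrightarrow> k_times_cont_differentiable k (\<lambda>x. f x * g x)"
proof (induction k arbitrary: f g)
  case 0
  then show ?case by (auto intro!: continuous_intros)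
next
  case (Suc k)
  show ?case
    by (rule k_times_cont_differentiable_SucI[OF has_derivative_mult[OF Suc.prems[THEN k_times_cont_differentiable_SucD(1)]]
       k_times_cont_differentiable_add[OF
         Suc.IH[OF k_times_cont_differentiable_Suc_imp[OF Suc.prems(1)] k_times_cont_differentiable_SucD(2)[OF Suc.prems(2)]]
         Suc.IH[OF k_times_cont_differentiable_SucD(2)[OF Suc.prems(1)] k_times_cont_differentiable_Suc_imp[OF Suc.prems(2)]]]])
qed

lemma k_times_cont_differentiable_prod:
  assumes "finite I" "\<And>i. i \<in> I \<Longrightarrow> k_times_cont_differentiable k (f i)"
  shows "k_times_cont_differentiable k (\<lambda>x. \<Prod>i\<in>I. f i x)"
  using assms
  by (induction I rule: finite_induct) (auto intro: k_times_cont_differentiable_const k_times_cont_differentiable_mult)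

lemma k_times_cont_differentiable_exp_germ:
  "k_times_cont_differentiable k (\<lambda>x::'a::euclidean_space. exp_germ p (c * (x \<bullet> b) + d))"
proof (induction k arbitrary: p)
  case 0
  have "continuous_on UNIV (exp_germ p)"
    by (intro continuous_at_imp_continuous_on ballI DERIV_isCont[OF exp_germ_deriv])
  then show ?case
    by (auto intro!: continuous_on_compose2[of UNIV "exp_germ p"] continuous_intros)
next
  case (Suc k)
  let ?q = "[:0, 0, 1:] * (p - pderiv p)"
  have "((\<lambda>x::'a. exp_germ p (c * (x \<bullet> b) + d)) has_derivative (\<lambda>v. exp_germ (smult (c * (v \<bullet> b)) ?q) (c * (x \<bullet> b) + d))) (at x)" for x
  proof -
    have lin: "((\<lambda>x::'a. c * (x \<bullet> b) + d) has_derivative (\<lambda>v. c * (v \<bullet> b))) (at x)"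
      by (auto intro!: derivative_eq_intros)
    have "((\<lambda>x::'a. exp_germ p (c * (x \<bullet> b) + d)) has_derivative (\<lambda>v. exp_germ ?q (c * (x \<bullet> b) + d) * (c * (v \<bullet> b)))) (at x)"
      using has_derivative_compose[OF lin exp_germ_deriv[unfolded has_field_derivative_def]] .
    also have "(\<lambda>v. exp_germ ?q (c * (x \<bullet> b) + d) * (c * (v \<bullet> b))) = (\<lambda>v. exp_germ (smult (c * (v \<bullet> b)) ?q) (c * (x \<bullet> b) + d))"
      by (auto simp: exp_germ_def fun_eq_iff)
    finally show ?thesis .
  qed
  then show ?case by (rule k_times_cont_differentiable_SucI) (rule Suc.IH)
qed

text \<open>
  For \<open>k \<rightarrow> \<infinity>\<close> these functions increase to the indicator function of
  the box, since \<open>exp (- 1 / (k * s)) \<rightarrow> 1\<close> for \<open>s > 0\<close>.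
\<close>

definition box_bump :: "'a::euclidean_space \<Rightarrow> 'a \<Rightarrow> real \<Rightarrow> 'a \<Rightarrow> real" where
  "box_bump a b k x = (\<Prod>i\<in>Basis. exp_germ 1 (k * (x \<bullet> i) + - k * (a \<bullet> i)) * exp_germ 1 (- k * (x \<bullet> i) + k * (b \<bullet> i)))"

lemma exp_germ_1_range: "0 \<le> exp_germ 1 x" "exp_germ 1 x \<le> 1"
  by (auto simp: exp_germ_def)

lemma box_bump_range: "0 \<le> box_bump a b k x" "box_bump a b k x \<le> 1"
  unfolding box_bump_def using exp_germ_1_range by (auto intro!: prod_nonneg prod_le_1 mult_le_one)

lemma box_bump_outside: "0 < k \<Longrightarrow> x \<notin> box a b \<Longrightarrow> box_bump a b k x = 0"
  unfolding box_bump_def mem_box by (auto simp: not_less exp_germ_def intro!: prod_zero bexI) 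

lemma smooth_box_bump: "smooth (box_bump a b k)"
  unfolding smooth_def box_bump_def
  by (intro allI k_times_cont_differentiable_prod k_times_cont_differentiable_mult k_times_cont_differentiable_exp_germ finite_Basis)

lemma test_function_box_bump:
  assumes "0 < k" "cbox a b \<subseteq> \<Omega>"
  shows "test_function \<Omega> (box_bump a b k)"
proof -
  have "{x. box_bump a b k x \<noteq> 0} \<subseteq> cbox a b"
    using box_bump_outside[OF assms(1)] box_subset_cbox by blast
  then have cl: "closure {x. box_bump a b k x \<noteq> 0} \<subseteq> cbox a b"
    by (rule closure_minimal) (rule closed_cbox)
  moreover have "compact (closure {x. box_bump a b k x \<noteq> 0})"
    using cl by (meson bounded_cbox bounded_subset closed_closure compact_eq_bounded_closed)
  ultimately show ?thesis using assms(2) smooth_box_bump by (auto simp: test_function_def)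
qed

lemma box_bump_tendsto: "(\<lambda>k. box_bump a b (real (Suc k)) x) \<longlonglongrightarrow> indicator (box a b) x"
proof (cases "x \<in> box a b")
  case True
  have 1: "(\<lambda>k. exp_germ 1 (real (Suc k) * s)) \<longlonglongrightarrow> 1" if "0 < s" for s
  proof -
    have "(\<lambda>k. exp (- (inverse (real (Suc k)) * (1 / s)))) \<longlonglongrightarrow> exp (- (0 * (1 / s)))"
      by (intro tendsto_intros LIMSEQ_inverse_real_of_nat)
    then show ?thesis using that by (simp add: exp_germ_def inverse_eq_divide)
  qed
  have "(\<lambda>k. \<Prod>i\<in>Basis. exp_germ 1 (real (Suc k) * (x \<bullet> i - a \<bullet> i)) * exp_germ 1 (real (Suc k) * (b \<bullet> i - x \<bullet> i))) \<longlonglongrightarrow> (\<Prod>i\<in>(Basis :: 'a set). 1 * 1)"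
    using True by (intro tendsto_prod tendsto_mult 1) (auto simp: mem_box)
  then show ?thesis using True by (simp add: box_bump_def algebra_simps)
qed (simp add: box_bump_outside)

text \<open>
  Dominated convergence along \<^const>\<open>box_bump\<close>.
\<close>

lemma fundamental_lemma_box:
  fixes h :: "'a::euclidean_space \<Rightarrow> real"
  assumes h: "locally_integrable_on h \<Omega>"
    and test: "\<And>\<phi>. test_function \<Omega> \<phi> \<Longrightarrow> (LINT x:\<Omega>|lebesgue. h x * \<phi> x) = 0"
    and sub: "cbox a b \<subseteq> \<Omega>"
  shows "(LINT x:box a b|lebesgue. h x) = 0"
proof -
  have hK: "set_integrable lebesgue (cbox a b) h" using h sub by (auto simp: locally_integrable_on_def)
  have cont: "continuous_on UNIV (box_bump a b k)" for k
    using smooth_box_bump[of a b k] unfolding smooth_def by (metis k_times_cont_differentiable.simps(1))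
  have "(\<lambda>k. LINT x|lebesgue. indicator (cbox a b) x * h x * box_bump a b (real (Suc k)) x) \<longlonglongrightarrow> (LINT x|lebesgue. indicator (cbox a b) x * h x * indicator (box a b) x)"
  proof (rule integral_dominated_convergence[where w="\<lambda>x. norm (indicator (cbox a b) x * h x)"])
    have hm: "(\<lambda>x. indicator (cbox a b) x * h x) \<in> borel_measurable lebesgue"
      using hK by (simp add: set_integrable_def borel_measurable_integrable)
    have [measurable]: "box_bump a b k \<in> borel_measurable lebesgue" for k
      using borel_measurable_continuous_onI[OF cont] by (simp add: measurable_completion)
    show "(\<lambda>x. indicator (cbox a b) x * h x * indicator (box a b) x) \<in> borel_measurable lebesgue"
      by (intro borel_measurable_times hm borel_measurable_indicator) auto
    show "(\<lambda>x. indicator (cbox a b) x * h x * box_bump a b (real (Suc k)) x) \<in> borel_measurable lebesgue" for k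
      by (rule borel_measurable_times[OF hm]) measurable
    show "integrable lebesgue (\<lambda>x. norm (indicator (cbox a b) x * h x))"
      using hK by (simp add: set_integrable_def)
    show "AE x in lebesgue. (\<lambda>k. indicator (cbox a b) x * h x * box_bump a b (real (Suc k)) x) \<longlonglongrightarrow> indicator (cbox a b) x * h x * indicator (box a b) x"
      by (intro AE_I2 tendsto_mult tendsto_const box_bump_tendsto)
    show "AE x in lebesgue. norm (indicator (cbox a b) x * h x * box_bump a b (real (Suc k)) x) \<le> norm (indicator (cbox a b) x * h x)" for k
      using box_bump_range[of a b "real (Suc k)"] by (intro AE_I2) (auto simp: abs_mult mult_left_le)
  qed
  moreover have "(LINT x|lebesgue. indicator (cbox a b) x * h x * box_bump a b (real (Suc k)) x) = 0" for k
  proof -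
    have "(LINT x|lebesgue. indicator (cbox a b) x * h x * box_bump a b (real (Suc k)) x) = (LINT x:\<Omega>|lebesgue. h x * box_bump a b (real (Suc k)) x)"
      unfolding set_lebesgue_integral_def
      by (rule Bochner_Integration.integral_cong[OF refl]) (use sub box_bump_outside[of "real (Suc k)" _ a b] box_subset_cbox[of a b] in \<open>auto simp: indicator_def\<close>)
    then show ?thesis using test[OF test_function_box_bump[OF _ sub, of "real (Suc k)"]] by simp
  qed
  ultimately have "(LINT x|lebesgue. indicator (cbox a b) x * h x * indicator (box a b) x) = 0"
    by (simp add: LIMSEQ_const_iff)
  moreover have "(LINT x|lebesgue. indicator (cbox a b) x * h x * indicator (box a b) x) = (LINT x:box a b|lebesgue. h x)"
    unfolding set_lebesgue_integral_def
    by (rule Bochner_Integration.integral_cong[OF refl]) (use box_subset_cbox[of a b] in \<open>auto simp: indicator_def\<close>)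
  ultimately show ?thesis by simp
qed

lemma sigma_finite_measure_lebesgue: "sigma_finite_measure (lebesgue :: 'a::euclidean_space measure)"
proof
  show "\<exists>A. countable A \<and> A \<subseteq> sets lebesgue \<and> \<Union>A = space (lebesgue :: 'a measure) \<and> (\<forall>a\<in>A. emeasure lebesgue a \<noteq> \<infinity>)"
    using emeasure_lborel_cball_finite[of "0 :: 'a"]
    by (intro exI[of _ "range (\<lambda>k::nat. cball (0::'a) (real k))"])
       (auto simp: emeasure_completion real_arch_simple simp flip: top.not_eq_extremum)
qed

text \<open>
  Boxes are an intersection-stable generator of the Borel sets, so all integrals over Borel sets vanish;
  Lebesgue sets differ from Borel sets by null sets.
\<close>

lemma AE_0_if_integral_boxes_0:
  fixes f :: "'a::euclidean_space \<Rightarrow> real"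
  assumes f: "integrable lebesgue f" and boxes: "\<And>c d. (LINT x:box c d|lebesgue. f x) = 0" and total: "(LINT x|lebesgue. f x) = 0"
  shows "AE x in lebesgue. f x = 0"
proof (rule sigma_finite_measure.density_zero[OF sigma_finite_measure_lebesgue f])
  have int: "set_integrable lebesgue A f" if "A \<in> sets lebesgue" for A
    unfolding set_integrable_def using that f by (rule integrable_mult_indicator)
  have borel_sets: "(LINT x:A|lebesgue. f x) = 0" if "A \<in> sets borel" for A
  proof -
    let ?G = "range (\<lambda>(a, b). box a b :: 'a set)"
    have stable: "Int_stable ?G" by (auto simp: Int_stable_def box_Int_box)
    have "A \<in> sigma_sets UNIV ?G" using that by (simp add: borel_eq_box)
    have sigma: "S \<in> sets lebesgue" if "S \<in> sigma_sets UNIV ?G" for S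
    proof -
      have "S \<in> sets borel" using that by (simp add: borel_eq_box)
      then show ?thesis by simp
    qed
    have "A \<in> sigma_sets UNIV ?G" by fact
    with stable subset_Pow_Union[of ?G, THEN order_trans, OF Pow_mono[OF subset_UNIV]] show ?thesis
    proof (induction rule: sigma_sets_induct_disjoint)
      case (basic A)
      then show ?case using boxes by auto
    next
      case empty
      show ?case by (simp add: set_lebesgue_integral_def)
    next
      case (compl A)
      then have A: "A \<in> sets lebesgue" by (intro sigma)
      have "(LINT x:UNIV|lebesgue. f x) = (LINT x:A|lebesgue. f x) + (LINT x:UNIV - A|lebesgue. f x)"
      proof -
        have "UNIV - A \<in> sets lebesgue" using sets.compl_sets[OF A] by simp
        then show ?thesis using A set_integral_Un[of A "UNIV - A" lebesgue f] int by simp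
      qed
      then show ?case using compl total by (simp add: set_lebesgue_integral_def)
    next
      case (union A)
      then have A: "A i \<in> sets lebesgue" for i using union(2) by (intro sigma) auto
      have "(LINT x:(\<Union>i. A i)|lebesgue. f x) = (\<Sum>i. LINT x:A i|lebesgue. f x)"
        using A union(1) int by (intro lebesgue_integral_countable_add) (auto simp: disjoint_family_on_def)
      then show ?case using union(3) by simp
    qed
  qed
  fix A :: "'a set" assume "A \<in> sets lebesgue"
  define C where "C = main_part lborel A"
  have C: "C \<in> sets borel" "C \<in> sets lebesgue"
    unfolding C_def using main_part_sets[OF \<open>A \<in> sets lebesgue\<close>] by simp_all
  have "AE x in lebesgue. x \<in> C \<longleftrightarrow> x \<in> A"
    unfolding C_def by (rule AE_completion[OF AE_in_main_part]) (use \<open>A \<in> sets lebesgue\<close> in simp)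
  then have "AE x in lebesgue. indicator A x *\<^sub>R f x = indicator C x *\<^sub>R f x"
    by eventually_elim (simp add: indicator_def)
  then have "(LINT x:A|lebesgue. f x) = (LINT x:C|lebesgue. f x)"
    unfolding set_lebesgue_integral_def using int[OF \<open>A \<in> sets lebesgue\<close>] int[OF C(2)]
    by (intro integral_cong_AE) (simp_all add: set_integrable_def borel_measurable_integrable)
  then show "(LINT x:A|lebesgue. f x) = 0" using borel_sets[OF C(1)] by simp
qed

text \<open>
  Work in one closed box at a time; countably many of them cover \<open>\<Omega>\<close>.
\<close>

lemma fundamental_lemma:
  fixes h :: "'a::euclidean_space \<Rightarrow> real"
  assumes "open \<Omega>" and h: "locally_integrable_on h \<Omega>"
    and test: "\<And>\<phi>. test_function \<Omega> \<phi> \<Longrightarrow> (LINT x:\<Omega>|lebesgue. h x * \<phi> x) = 0"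
  shows "AE x in lebesgue. x \<in> \<Omega> \<longrightarrow> h x = 0"
proof -
  have box0: "AE x in lebesgue. x \<in> cbox a b \<longrightarrow> h x = 0" if sub: "cbox a b \<subseteq> \<Omega>" for a b
  proof -
    have "set_integrable lebesgue (cbox a b) h" using h sub by (auto simp: locally_integrable_on_def)
    then have int: "integrable lebesgue (\<lambda>x. indicator (box a b) x *\<^sub>R h x)"
      using box_subset_cbox[of a b] unfolding set_integrable_def[symmetric] by (rule_tac set_integrable_subset) auto
    have inter: "(LINT x:box c d|lebesgue. indicator (box a b) x *\<^sub>R h x) = 0" for c d
    proof -
      obtain a' b' where ab: "box a b \<inter> box c d = box a' b'" using box_Int_box[of a b c d] by blast
      have "(LINT x:box c d|lebesgue. indicator (box a b) x *\<^sub>R h x) = (LINT x:box a' b'|lebesgue. h x)"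
        unfolding set_lebesgue_integral_def ab[symmetric]
        by (rule Bochner_Integration.integral_cong[OF refl]) (auto simp: indicator_def)
      also have "\<dots> = 0"
      proof (cases "box a' b' = {}")
        case False
        have "box a' b' \<subseteq> cbox a b" using ab box_subset_cbox[of a b] by blast
        then have "cbox a' b' \<subseteq> cbox a b" using False by (metis closure_box closure_minimal closed_cbox)
        then show ?thesis using sub by (intro fundamental_lemma_box[OF h test]) auto
      qed (simp add: set_lebesgue_integral_def)
      finally show ?thesis .
    qed
    have "(LINT x|lebesgue. indicator (box a b) x *\<^sub>R h x) = 0"
      using fundamental_lemma_box[OF h test sub] by (simp add: set_lebesgue_integral_def)
    from AE_0_if_integral_boxes_0[OF int inter this]
    have "AE x in lebesgue. indicator (box a b) x *\<^sub>R h x = 0" .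
    moreover have "AE x in lebesgue. x \<notin> cbox a b - box a b"
      using negligible_frontier_interval[of a b] unfolding negligible_iff_null_sets by (rule AE_not_in)
    ultimately show ?thesis by eventually_elim (auto simp: indicator_def split: if_splits)
  qed
  obtain \<D> where D: "countable \<D>" "\<D> \<subseteq> Pow \<Omega>" "\<And>X. X \<in> \<D> \<Longrightarrow> \<exists>a b. X = cbox a b" "\<Union>\<D> = \<Omega>"
    using open_countable_Union_open_cbox[OF \<open>open \<Omega>\<close>] by metis
  have "AE x in lebesgue. \<forall>X\<in>\<D>. x \<in> X \<longrightarrow> h x = 0"
  proof (rule AE_ball_countable'[OF _ D(1)])
    fix X assume "X \<in> \<D>"
    then obtain a b where "X = cbox a b" "cbox a b \<subseteq> \<Omega>" using D(2,3) by blast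
    then show "AE x in lebesgue. x \<in> X \<longrightarrow> h x = 0" using box0 by simp
  qed
  then show ?thesis by eventually_elim (use D(4) in blast)
qed

lemma test_function_continuous: "test_function \<Omega> \<phi> \<Longrightarrow> continuous_on UNIV \<phi>"
  unfolding test_function_def smooth_def by (metis k_times_cont_differentiable.simps(1))

lemma integrable_times_test_function:
  fixes h :: "'a::euclidean_space \<Rightarrow> real"
  assumes h: "locally_integrable_on h \<Omega>" and \<phi>: "test_function \<Omega> \<phi>"
  shows "set_integrable lebesgue \<Omega> (\<lambda>x. h x * \<phi> x)"
proof -
  let ?K = "closure {x. \<phi> x \<noteq> 0}"
  have K: "compact ?K" "?K \<subseteq> \<Omega>" using \<phi> by (auto simp: test_function_def)
  have cont: "continuous_on UNIV \<phi>" by (rule test_function_continuous[OF \<phi>])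
  have out: "\<phi> x = 0" if "x \<notin> ?K" for x using that closure_subset[of "{x. \<phi> x \<noteq> 0}"] by auto
  have "compact (\<phi> ` ?K)" by (rule compact_continuous_image[OF continuous_on_subset[OF cont] K(1)]) simp
  then obtain B where B: "\<And>x. x \<in> ?K \<Longrightarrow> \<bar>\<phi> x\<bar> \<le> B" using compact_imp_bounded by (fastforce simp: bounded_iff)
  have hK: "integrable lebesgue (\<lambda>x. indicator ?K x *\<^sub>R h x)"
    using h K by (auto simp: locally_integrable_on_def set_integrable_def)
  have "integrable lebesgue (\<lambda>x. (indicator ?K x *\<^sub>R h x) * \<phi> x)"
  proof (rule Bochner_Integration.integrable_bound[OF integrable_mult_right[OF hK, of B]])
    have [measurable]: "\<phi> \<in> borel_measurable lebesgue"
      using borel_measurable_continuous_onI[OF cont] by (simp add: measurable_completion)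
    have hm [measurable]: "(\<lambda>x. indicator ?K x *\<^sub>R h x) \<in> borel_measurable lebesgue" using hK by (rule borel_measurable_integrable)
    show "(\<lambda>x. (indicator ?K x *\<^sub>R h x) * \<phi> x) \<in> borel_measurable lebesgue"
      by (rule borel_measurable_times) measurable
    show "AE x in lebesgue. norm ((indicator ?K x *\<^sub>R h x) * \<phi> x) \<le> norm (B * (indicator ?K x *\<^sub>R h x))"
    proof (rule AE_I2)
      fix x
      show "norm ((indicator ?K x *\<^sub>R h x) * \<phi> x) \<le> norm (B * (indicator ?K x *\<^sub>R h x))"
        using B[of x] by (cases "x \<in> ?K") (auto simp: abs_mult mult.commute intro!: mult_right_mono)
    qed
  qed
  moreover have "(\<lambda>x. (indicator ?K x *\<^sub>R h x) * \<phi> x) = (\<lambda>x. indicator \<Omega> x *\<^sub>R (h x * \<phi> x))"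
  proof
    fix x
    show "(indicator ?K x *\<^sub>R h x) * \<phi> x = indicator \<Omega> x *\<^sub>R (h x * \<phi> x)"
    proof (cases "x \<in> ?K")
      case True
      then have "x \<in> \<Omega>" using K(2) by blast
      then show ?thesis using True by simp
    next
      case False
      then show ?thesis using out[OF False] by simp
    qed
  qed
  ultimately show ?thesis by (simp add: set_integrable_def)
qed

lemma weak_gradient_unique:
  fixes \<Omega> :: "'a::euclidean_space set"
  assumes "open \<Omega>" and g: "weak_gradient \<Omega> u g" and g': "weak_gradient \<Omega> u g'"
  shows "AE x in lebesgue. x \<in> \<Omega> \<longrightarrow> g x = g' x"
proof -
  have comp: "AE x in lebesgue. x \<in> \<Omega> \<longrightarrow> (g x - g' x) \<bullet> b = 0" if b: "b \<in> Basis" for b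
  proof (rule fundamental_lemma[OF \<open>open \<Omega>\<close>])
    have li: "locally_integrable_on g \<Omega>" "locally_integrable_on g' \<Omega>" using g g' by (auto simp: weak_gradient_def)
    have lib: "locally_integrable_on (\<lambda>x. f x \<bullet> b) \<Omega>" if "locally_integrable_on f \<Omega>" for f
      using that unfolding locally_integrable_on_def set_integrable_def
      by (auto simp flip: inner_scaleR_left intro: integrable_inner_left)
    have "locally_integrable_on (\<lambda>x. g x - g' x) \<Omega>"
      using li unfolding locally_integrable_on_def by (auto intro: set_integral_diff(1))
    then show "locally_integrable_on (\<lambda>x. (g x - g' x) \<bullet> b) \<Omega>" by (rule lib)
    fix \<phi> assume \<phi>: "test_function \<Omega> \<phi>"
    have "(LINT x:\<Omega>|lebesgue. (g x \<bullet> b) * \<phi> x) = (LINT x:\<Omega>|lebesgue. (g' x \<bullet> b) * \<phi> x)"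
    proof -
      have "(LINT x:\<Omega>|lebesgue. u x * (grad \<phi> x \<bullet> b)) = - (LINT x:\<Omega>|lebesgue. (f x \<bullet> b) * \<phi> x)"
        if "weak_gradient \<Omega> u f" for f
        using that \<phi> b unfolding weak_gradient_def by blast
      from this[OF g] this[OF g'] show ?thesis by simp
    qed
    moreover have "(LINT x:\<Omega>|lebesgue. ((g x - g' x) \<bullet> b) * \<phi> x) = (LINT x:\<Omega>|lebesgue. (g x \<bullet> b) * \<phi> x) - (LINT x:\<Omega>|lebesgue. (g' x \<bullet> b) * \<phi> x)"
      unfolding inner_diff_left left_diff_distrib
      by (rule set_integral_diff(2)) (intro integrable_times_test_function lib li \<phi>)+
    ultimately show "(LINT x:\<Omega>|lebesgue. ((g x - g' x) \<bullet> b) * \<phi> x) = 0" by simp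
  qed
  have "AE x in lebesgue. \<forall>b\<in>Basis. x \<in> \<Omega> \<longrightarrow> (g x - g' x) \<bullet> b = 0"
    by (rule AE_ball_countable'[OF comp]) (auto simp: countable_finite)
  then show ?thesis
  proof eventually_elim
    case (elim x)
    then show ?case using euclidean_eqI[of "g x" "g' x"] by (auto simp: inner_diff_left)
  qed
qed

section \<open>From test functions to the Sobolev space\<close>

lemma grad_outside_support:
  assumes "x \<notin> closure {x. \<phi> x \<noteq> 0}"
  shows "grad \<phi> x = 0"
proof -
  have "((\<lambda>x. 0) has_derivative (\<lambda>h. 0)) (at x)" by simp
  then have "(\<phi> has_derivative (\<lambda>h. 0)) (at x)"
  proof (rule has_derivative_transform_within_open)
    show "open (- closure {x. \<phi> x \<noteq> 0})" by (simp add: open_Compl)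
    show "x \<in> - closure {x. \<phi> x \<noteq> 0}" using assms by simp
    show "0 = \<phi> y" if "y \<in> - closure {x. \<phi> x \<noteq> 0}" for y
      using that closure_subset[of "{x. \<phi> x \<noteq> 0}"] by auto
  qed
  then have "frechet_derivative \<phi> (at x) = (\<lambda>h. 0)" using frechet_derivative_at by metis
  then show ?thesis by (simp add: grad_def)
qed

lemma test_function_C1:
  assumes "test_function \<Omega> \<phi>"
  shows "GDERIV \<phi> x :> grad \<phi> x" "continuous_on UNIV (grad \<phi>)"
proof -
  have k1: "k_times_cont_differentiable (Suc 0) \<phi>" using assms by (simp add: test_function_def smooth_def)
  then show "GDERIV \<phi> x :> grad \<phi> x" by (intro GDERIV_grad) simp
  show "continuous_on UNIV (grad \<phi>)"
    unfolding grad_def using k1 by (intro continuous_intros) simp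
qed

text \<open>
  An elementary substitute for Minkowski's inequality: distinguish whether \<open>b\<close> is small
  compared with \<open>a\<close>.
\<close>

lemma norm_add_power_le:
  fixes a b :: "'a::real_normed_vector"
  assumes s: "0 < s"
  shows "norm (a + b) ^ n \<le> (1 + s) ^ n * norm a ^ n + (1 + 1 / s) ^ n * norm b ^ n"
proof (cases "norm b \<le> s * norm a")
  case True
  have "norm (a + b) \<le> (1 + s) * norm a" using norm_triangle_ineq[of a b] True by (simp add: algebra_simps)
  then have "norm (a + b) ^ n \<le> ((1 + s) * norm a) ^ n" by (intro power_mono) auto
  then show ?thesis using s by (simp add: power_mult_distrib add_increasing2)
next
  case False
  then have "norm a \<le> norm b / s" using s by (simp add: field_simps)
  then have "norm (a + b) \<le> (1 + 1 / s) * norm b" using norm_triangle_ineq[of a b] by (simp add: algebra_simps)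
  then have "norm (a + b) ^ n \<le> ((1 + 1 / s) * norm b) ^ n" by (intro power_mono) auto
  then show ?thesis using s by (simp add: power_mult_distrib add_increasing)
qed

lemma ennreal_norm_add_power_le:
  fixes a b :: "'a::real_normed_vector"
  assumes s: "0 < s"
  shows "ennreal (norm (a + b) ^ n) \<le> ennreal ((1 + s) ^ n) * ennreal (norm a ^ n) + ennreal ((1 + 1 / s) ^ n) * ennreal (norm b ^ n)"
  using norm_add_power_le[OF s, of a b n] s
  by (simp add: ennreal_mult[symmetric] ennreal_plus[symmetric] ennreal_leI del: ennreal_plus)

lemma nn_integral_norm_add_power_le:
  fixes f h :: "'a \<Rightarrow> 'b::euclidean_space"
  assumes s: "0 < s" and [measurable]: "f \<in> borel_measurable M" "h \<in> borel_measurable M" "w \<in> borel_measurable M"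
  shows "(\<integral>\<^sup>+x. w x * ennreal (norm (f x + h x) ^ n) \<partial>M) \<le>
    ennreal ((1 + s) ^ n) * (\<integral>\<^sup>+x. w x * ennreal (norm (f x) ^ n) \<partial>M) + ennreal ((1 + 1 / s) ^ n) * (\<integral>\<^sup>+x. w x * ennreal (norm (h x) ^ n) \<partial>M)"
proof -
  have "(\<integral>\<^sup>+x. w x * ennreal (norm (f x + h x) ^ n) \<partial>M) \<le>
    (\<integral>\<^sup>+x. ennreal ((1 + s) ^ n) * (w x * ennreal (norm (f x) ^ n)) + ennreal ((1 + 1 / s) ^ n) * (w x * ennreal (norm (h x) ^ n)) \<partial>M)"
  proof (rule nn_integral_mono)
    fix x
    have "w x * ennreal (norm (f x + h x) ^ n) \<le> w x * (ennreal ((1 + s) ^ n) * ennreal (norm (f x) ^ n) + ennreal ((1 + 1 / s) ^ n) * ennreal (norm (h x) ^ n))"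
      by (rule mult_left_mono[OF ennreal_norm_add_power_le[OF s]]) simp
    then show "w x * ennreal (norm (f x + h x) ^ n) \<le> ennreal ((1 + s) ^ n) * (w x * ennreal (norm (f x) ^ n)) + ennreal ((1 + 1 / s) ^ n) * (w x * ennreal (norm (h x) ^ n))"
      by (simp only: distrib_left mult_ac)
  qed
  also have "\<dots> = ennreal ((1 + s) ^ n) * (\<integral>\<^sup>+x. w x * ennreal (norm (f x) ^ n) \<partial>M) + ennreal ((1 + 1 / s) ^ n) * (\<integral>\<^sup>+x. w x * ennreal (norm (h x) ^ n) \<partial>M)"
    by (subst nn_integral_add) (auto simp: nn_integral_cmult)
  finally show ?thesis .
qed

text \<open>
  First let \<open>e\<close> tend to \<open>0\<close> for a fixed \<open>s\<close>, then let
  \<open>s\<close> tend to \<open>0\<close>.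
\<close>

lemma ennreal_le_of_approx:
  fixes X :: ennreal
  assumes b: "0 \<le> b" and le: "\<And>s e. 0 < s \<Longrightarrow> 0 < e \<Longrightarrow> X \<le> ennreal ((1 + s) ^ k * b) + ennreal (C s * e)"
    and C: "\<And>s. 0 < s \<Longrightarrow> 0 < C s"
  shows "X \<le> ennreal b"
proof -
  have 1: "X \<le> ennreal ((1 + s) ^ k * b)" if s: "0 < s" for s
  proof (rule ennreal_le_epsilon)
    fix e :: real assume "0 < e"
    then show "X \<le> ennreal ((1 + s) ^ k * b) + ennreal e"
      using le[OF s, of "e / C s"] C[OF s] by simp
  qed
  have "(\<lambda>j. (1 + inverse (real (Suc j))) ^ k * b) \<longlonglongrightarrow> (1 + 0) ^ k * b"
    by (intro tendsto_intros LIMSEQ_inverse_real_of_nat)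
  then have "(\<lambda>j. ennreal ((1 + inverse (real (Suc j))) ^ k * b)) \<longlonglongrightarrow> ennreal ((1 + 0) ^ k * b)"
    by (rule tendsto_ennrealI)
  then have "X \<le> ennreal ((1 + 0) ^ k * b)"
    by (rule LIMSEQ_le_const) (use 1 in auto)
  then show ?thesis by simp
qed

text \<open>
  Approximation of \<open>u\<close> by test functions controls the integral of \<open>\<bar>u\<bar> ^
  n\<close> only for bounded weights, so the weight is truncated at \<open>k\<close> first and the
  truncation is removed by monotone convergence.  Since weak gradients are unique, the gradient in the
  definition of \<^const>\<open>W1_0\<close> may be replaced by any other.
\<close>

lemma hardy_extends_to_W1_0:
  fixes \<Omega> :: "'a::euclidean_space set" and w :: "'a \<Rightarrow> real"
  assumes \<Omega>: "open \<Omega>" and n: "1 \<le> n" and H: "0 < H"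
    and w: "w \<in> borel_measurable borel" "\<And>x. x \<in> \<Omega> \<Longrightarrow> 0 \<le> w x"
    and hardy: "\<And>\<phi>. test_function \<Omega> \<phi> \<Longrightarrow> ennreal H * (\<integral>\<^sup>+x. ennreal (w x * \<bar>\<phi> x\<bar> ^ n) \<partial>lebesgue_on \<Omega>) \<le> (\<integral>\<^sup>+x. ennreal (norm (grad \<phi> x) ^ n) \<partial>lebesgue_on \<Omega>)"
    and u: "u \<in> W1_0 n \<Omega>" and g: "weak_gradient \<Omega> u g"
  shows "ennreal H * (\<integral>\<^sup>+x. ennreal (w x * \<bar>u x\<bar> ^ n) \<partial>lebesgue_on \<Omega>) \<le> (\<integral>\<^sup>+x. ennreal (norm (g x) ^ n) \<partial>lebesgue_on \<Omega>)"
    and "(\<integral>\<^sup>+x. ennreal (norm (g x) ^ n) \<partial>lebesgue_on \<Omega>) < \<infinity>"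
proof -
  let ?M = "lebesgue_on \<Omega>"
  let ?E = "\<lambda>f. \<integral>\<^sup>+x. ennreal (norm (f x) ^ n) \<partial>lebesgue_on \<Omega>"
  have [measurable]: "\<Omega> \<in> sets lebesgue" using \<Omega> by simp
  obtain g0 where g0: "g0 \<in> Lp n \<Omega>" "weak_gradient \<Omega> u g0"
    and approx: "\<And>e. 0 < e \<Longrightarrow> \<exists>\<phi>. test_function \<Omega> \<phi> \<and>
        ?E (\<lambda>x. u x - \<phi> x) + ?E (\<lambda>x. g0 x - grad \<phi> x) < ennreal e"
    using u unfolding W1_0_def by blast
  have um [measurable]: "u \<in> borel_measurable ?M" using u by (auto simp: W1_0_def W1_def Lp_def)
  have g0m [measurable]: "g0 \<in> borel_measurable ?M" using g0 by (auto simp: Lp_def)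
  have borel_M: "f \<in> borel_measurable ?M" if "f \<in> borel_measurable borel" for f :: "'a \<Rightarrow> 'c::topological_space"
    using that by (intro measurable_restrict_space1 measurable_completion) simp
  have wm [measurable]: "w \<in> borel_measurable ?M" using w(1) by (rule borel_M)
  have "AE x in lebesgue. x \<in> \<Omega> \<longrightarrow> g x = g0 x" by (rule weak_gradient_unique[OF \<Omega> g g0(2)])
  then have "AE x in ?M. g x = g0 x" by (simp add: AE_restrict_space_iff)
  then have gg0: "?E g = ?E g0"
    by (intro nn_integral_cong_AE) (auto elim: eventually_mono)
  have fin: "?E g0 < \<infinity>" using g0 by (auto simp: Lp_def)
  then show "?E g < \<infinity>" by (simp add: gg0)
  obtain B where B: "?E g0 = ennreal B" "0 \<le> B"
    using fin by (cases "\<integral>\<^sup>+x. ennreal (norm (g0 x) ^ n) \<partial>?M") auto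
  define wk where "wk k x = ennreal (min (w x) (real k))" for k x
  let ?W = "\<lambda>k f. \<integral>\<^sup>+x. wk k x * ennreal (norm (f x) ^ n) \<partial>?M"
  have [measurable]: "wk k \<in> borel_measurable ?M" for k unfolding wk_def by measurable
  have trunc: "ennreal H * ?W k u \<le> ennreal B" for k
  proof (rule ennreal_le_of_approx[where k = "n + n" and C = "\<lambda>s. (1 + s) ^ n * (1 + 1 / s) ^ n + H * ((1 + 1 / s) ^ n * (real k + 1))"])
    fix s e :: real assume s: "0 < s" and e: "0 < e"
    let ?a = "ennreal ((1 + s) ^ n)" and ?b = "ennreal ((1 + 1 / s) ^ n)"
    obtain \<phi> where \<phi>: "test_function \<Omega> \<phi>" and
      close: "?E (\<lambda>x. u x - \<phi> x) + ?E (\<lambda>x. g0 x - grad \<phi> x) < ennreal e"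
      using approx[OF e] by blast
    have \<phi>m [measurable]: "\<phi> \<in> borel_measurable ?M" and grm [measurable]: "grad \<phi> \<in> borel_measurable ?M"
      using test_function_continuous[OF \<phi>] test_function_C1(2)[OF \<phi>] by (auto intro!: borel_M borel_measurable_continuous_onI)
    have cu: "?E (\<lambda>x. u x - \<phi> x) \<le> ennreal e" and cg: "?E (\<lambda>x. grad \<phi> x - g0 x) \<le> ennreal e"
      using close by (auto simp: norm_minus_commute[of "grad \<phi> _"] intro: order_trans[OF _ less_imp_le[OF close]])
    have "?W k u = ?W k (\<lambda>x. \<phi> x + (u x - \<phi> x))" by simp
    also have "\<dots> \<le> ?a * ?W k \<phi> + ?b * ?W k (\<lambda>x. u x - \<phi> x)"
      by (rule nn_integral_norm_add_power_le[OF s]) measurable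
    also have "\<dots> \<le> ?a * (\<integral>\<^sup>+x. ennreal (w x * \<bar>\<phi> x\<bar> ^ n) \<partial>?M) + ?b * (ennreal (real k + 1) * ennreal e)"
    proof (intro add_mono mult_left_mono)
      show "?W k \<phi> \<le> (\<integral>\<^sup>+x. ennreal (w x * \<bar>\<phi> x\<bar> ^ n) \<partial>?M)"
      proof (rule nn_integral_mono)
        fix x assume "x \<in> space ?M"
        then have "0 \<le> w x" using w(2) by (simp add: space_restrict_space)
        then show "wk k x * ennreal (norm (\<phi> x) ^ n) \<le> ennreal (w x * \<bar>\<phi> x\<bar> ^ n)"
          by (simp add: wk_def ennreal_mult[symmetric] ennreal_leI mult_right_mono)
      qed
      have "?W k (\<lambda>x. u x - \<phi> x) \<le> (\<integral>\<^sup>+x. ennreal (real k + 1) * ennreal (norm (u x - \<phi> x) ^ n) \<partial>?M)"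
        unfolding wk_def by (intro nn_integral_mono mult_right_mono ennreal_leI) auto
      also have "\<dots> = ennreal (real k + 1) * ?E (\<lambda>x. u x - \<phi> x)"
        by (rule nn_integral_cmult) measurable
      also have "\<dots> \<le> ennreal (real k + 1) * ennreal e" using cu by (rule mult_left_mono) simp
      finally show "?W k (\<lambda>x. u x - \<phi> x) \<le> ennreal (real k + 1) * ennreal e" .
    qed simp_all
    finally have 1: "ennreal H * ?W k u \<le>
      ennreal H * (?a * (\<integral>\<^sup>+x. ennreal (w x * \<bar>\<phi> x\<bar> ^ n) \<partial>?M) + ?b * (ennreal (real k + 1) * ennreal e))"
      by (rule mult_left_mono) simp
    have "?E (\<lambda>x. grad \<phi> x) = (\<integral>\<^sup>+x. 1 * ennreal (norm (g0 x + (grad \<phi> x - g0 x)) ^ n) \<partial>?M)" by simp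
    also have "\<dots> \<le> ?a * (\<integral>\<^sup>+x. 1 * ennreal (norm (g0 x) ^ n) \<partial>?M) + ?b * (\<integral>\<^sup>+x. 1 * ennreal (norm (grad \<phi> x - g0 x) ^ n) \<partial>?M)"
      by (rule nn_integral_norm_add_power_le[OF s]) measurable
    also have "\<dots> \<le> ?a * ennreal B + ?b * ennreal e"
      using cg B by (intro add_mono mult_left_mono) auto
    finally have 2: "ennreal H * (\<integral>\<^sup>+x. ennreal (w x * \<bar>\<phi> x\<bar> ^ n) \<partial>?M) \<le> ?a * ennreal B + ?b * ennreal e"
      using hardy[OF \<phi>] by (rule order_trans[rotated])
    note 1
    also have "ennreal H * (?a * (\<integral>\<^sup>+x. ennreal (w x * \<bar>\<phi> x\<bar> ^ n) \<partial>?M) + ?b * (ennreal (real k + 1) * ennreal e)) =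
       ?a * (ennreal H * (\<integral>\<^sup>+x. ennreal (w x * \<bar>\<phi> x\<bar> ^ n) \<partial>?M)) + ennreal H * (?b * (ennreal (real k + 1) * ennreal e))"
      by (simp only: distrib_left mult_ac)
    also have "\<dots> \<le> ?a * (?a * ennreal B + ?b * ennreal e) + ennreal H * (?b * (ennreal (real k + 1) * ennreal e))"
      using 2 by (intro add_right_mono mult_left_mono) auto
    also have "\<dots> = ennreal ((1 + s) ^ n * ((1 + s) ^ n * B + (1 + 1 / s) ^ n * e) + H * ((1 + 1 / s) ^ n * ((real k + 1) * e)))"
      using s e B H by (simp add: ennreal_mult ennreal_plus del: of_nat_Suc)
    also have "\<dots> = ennreal ((1 + s) ^ (n + n) * B + ((1 + s) ^ n * (1 + 1 / s) ^ n + H * ((1 + 1 / s) ^ n * (real k + 1))) * e)"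
      by (rule arg_cong[where f = ennreal]) (simp add: power_add algebra_simps)
    also have "\<dots> = ennreal ((1 + s) ^ (n + n) * B) + ennreal (((1 + s) ^ n * (1 + 1 / s) ^ n + H * ((1 + 1 / s) ^ n * (real k + 1))) * e)"
      using s e B H by (intro ennreal_plus mult_nonneg_nonneg add_nonneg_nonneg) auto
    finally show "ennreal H * ?W k u \<le>
      ennreal ((1 + s) ^ (n + n) * B) + ennreal (((1 + s) ^ n * (1 + 1 / s) ^ n + H * ((1 + 1 / s) ^ n * (real k + 1))) * e)" .
  next
    fix s :: real assume "0 < s"
    then show "0 < (1 + s) ^ n * (1 + 1 / s) ^ n + H * ((1 + 1 / s) ^ n * (real k + 1))"
      using H by (intro add_pos_nonneg mult_nonneg_nonneg mult_pos_pos zero_less_power) (auto intro!: add_pos_pos)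
  qed (rule B(2))
  have "(\<integral>\<^sup>+x. ennreal (w x * \<bar>u x\<bar> ^ n) \<partial>?M) \<le> (\<integral>\<^sup>+x. (SUP k. wk k x * ennreal (norm (u x) ^ n)) \<partial>?M)"
  proof (rule nn_integral_mono)
    fix x assume "x \<in> space ?M"
    then have w0: "0 \<le> w x" using w(2) by (simp add: space_restrict_space)
    obtain k :: nat where "w x < real k" using reals_Archimedean2 by blast
    then have "ennreal (w x * \<bar>u x\<bar> ^ n) = wk k x * ennreal (norm (u x) ^ n)"
      using w0 by (simp add: wk_def ennreal_mult)
    also have "\<dots> \<le> (SUP k. wk k x * ennreal (norm (u x) ^ n))" by (rule SUP_upper) simp
    finally show "ennreal (w x * \<bar>u x\<bar> ^ n) \<le> (SUP k. wk k x * ennreal (norm (u x) ^ n))" .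
  qed
  also have "\<dots> = (SUP k. \<integral>\<^sup>+x. wk k x * ennreal (norm (u x) ^ n) \<partial>?M)"
  proof (rule nn_integral_monotone_convergence_SUP)
    show "incseq (\<lambda>k x. wk k x * ennreal (norm (u x) ^ n))"
      unfolding wk_def by (intro incseq_SucI le_funI mult_right_mono ennreal_leI) auto
  qed measurable
  finally have "ennreal H * (\<integral>\<^sup>+x. ennreal (w x * \<bar>u x\<bar> ^ n) \<partial>?M) \<le> ennreal H * (SUP k. \<integral>\<^sup>+x. wk k x * ennreal (norm (u x) ^ n) \<partial>?M)"
    by (rule mult_left_mono) simp
  also have "\<dots> \<le> ennreal B"
    unfolding SUP_mult_left_ennreal using trunc by (intro SUP_least)
  finally show "ennreal H * (\<integral>\<^sup>+x. ennreal (w x * \<bar>u x\<bar> ^ n) \<partial>?M) \<le> ?E g"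
    by (simp add: gg0 B(1))
qed

section \<open>Consequences of the two density conditions\<close>

text \<open>
  A point of an open set can be moved a little away from the origin.
\<close>

lemma norm_less_outer_radius:
  fixes \<Omega> :: "'a::euclidean_space set"
  assumes "open \<Omega>" "bounded \<Omega>" "x \<in> \<Omega>"
  shows "norm x < outer_radius \<Omega>"
proof -
  obtain e where e: "0 < e" "ball x e \<subseteq> \<Omega>" using assms by (auto simp: open_contains_ball)
  obtain b :: 'a where b: "b \<in> Basis" using nonempty_Basis by blast
  define v where "v = (if x = 0 then b else sgn x)"
  define y where "y = x + (e / 2) *\<^sub>R v"
  have v: "norm v = 1" "norm x *\<^sub>R v = x" using b by (auto simp: v_def norm_sgn norm_scaleR_sgn)
  have "dist x y < e" using e v by (simp add: y_def dist_norm)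
  then have "y \<in> \<Omega>" using e by auto
  have "y = (norm x + e / 2) *\<^sub>R v" unfolding y_def scaleR_add_left v(2) ..
  then have "norm y = norm x + e / 2" using e v by simp
  then have "norm x < norm y" using e by simp
  also have "norm y \<le> outer_radius \<Omega>"
    unfolding outer_radius_def using \<open>y \<in> \<Omega>\<close> assms(2) by (intro cSUP_upper) (auto simp: bounded_norm_comp bounded_imp_bdd_above)
  finally show ?thesis .
qed

lemma outer_radius_pos:
  fixes \<Omega> :: "'a::euclidean_space set"
  assumes "open \<Omega>" "bounded \<Omega>" "\<Omega> \<noteq> {}"
  shows "0 < outer_radius \<Omega>"
  using norm_less_outer_radius[OF assms(1,2)] assms(3) norm_ge_zero by (metis all_not_in_conv le_less_trans)

text \<open>
  The section of \<open>\<Omega>\<close> by the sphere of radius \<open>r\<close>, projected to the unit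
  sphere.
\<close>

definition radial_section :: "'a::real_normed_vector set \<Rightarrow> real \<Rightarrow> 'a set" where
  "radial_section \<Omega> r = {w \<in> sphere 0 1. r *\<^sub>R w \<in> \<Omega>}"

lemma hausdorff_radial_section_le:
  fixes \<Omega> :: "'a::euclidean_space set"
  assumes "0 < r"
  shows "hausdorff_measure k (radial_section \<Omega> r) \<le> ennreal ((1 / r) ^ k) * hausdorff_measure k {x \<in> \<Omega>. norm x = r}"
proof -
  have "radial_section \<Omega> r = (\<lambda>x. (1 / r) *\<^sub>R x) ` {x \<in> \<Omega>. norm x = r}"
  proof (intro equalityI subsetI)
    fix w assume "w \<in> radial_section \<Omega> r"
    then show "w \<in> (\<lambda>x. (1 / r) *\<^sub>R x) ` {x \<in> \<Omega>. norm x = r}"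
      using assms by (intro image_eqI[of _ _ "r *\<^sub>R w"]) (auto simp: radial_section_def)
  qed (use assms in \<open>auto simp: radial_section_def\<close>)
  then show ?thesis using hausdorff_measure_scaleR_le[of "1 / r" k] assms by simp
qed

lemma radial_section_borel:
  fixes \<Omega> :: "'a::euclidean_space set"
  assumes "open \<Omega>"
  shows "radial_section \<Omega> r \<in> sets borel"
proof -
  have [measurable]: "\<Omega> \<in> sets borel" using assms by simp
  have "radial_section \<Omega> r = {w. norm w = 1 \<and> r *\<^sub>R w \<in> \<Omega>}" by (auto simp: radial_section_def)
  then show ?thesis by simp
qed

lemma compact_radial_section_complement:
  fixes \<Omega> :: "'a::euclidean_space set"
  assumes "open \<Omega>"
  shows "compact (sphere 0 1 - radial_section \<Omega> r)"
proof -
  have "sphere 0 1 - radial_section \<Omega> r = sphere 0 1 - (\<lambda>w. r *\<^sub>R w) -` \<Omega>"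
    by (auto simp: radial_section_def)
  moreover have "open ((\<lambda>w. r *\<^sub>R w) -` \<Omega>)"
    by (rule open_vimage[OF assms]) (intro continuous_intros)
  ultimately show ?thesis using compact_diff[OF compact_sphere, of _ 0 1] by simp
qed

lemma hausdorff_le_cone_const_pos: "0 < hausdorff_le_cone_const TYPE('a::euclidean_space)"
  unfolding hausdorff_le_cone_const_def by (intro mult_pos_pos divide_pos_pos) auto

text \<open>
  By subadditivity, the complement of the section in the sphere has Hausdorff measure at least
  \<open>\<omega> - q\<close> for some \<open>q < \<omega>\<close>, and it is compact, so
  \<open>hausdorff_le_emeasure_cone\<close> applies.
\<close>

lemma zero_set_near_0:
  fixes \<Omega> :: "'a::euclidean_space set"
  assumes dim: "2 \<le> DIM('a)" and \<Omega>: "open \<Omega>" and R: "0 < R"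
    and m: "\<And>r. r \<in> {0<..<R} \<Longrightarrow> m r = hausdorff_measure (DIM('a) - 1) {x \<in> \<Omega>. norm x = r}"
    and lim: "Limsup (at_right 0) (\<lambda>r. m r / ennreal (r ^ (DIM('a) - 1))) < hausdorff_measure (DIM('a) - 1) (sphere (0::'a) 1)"
  obtains \<epsilon> \<rho> where "0 < \<epsilon>" "0 < \<rho>" "\<rho> \<le> R"
    "\<And>r. 0 < r \<Longrightarrow> r < \<rho> \<Longrightarrow> ennreal \<epsilon> \<le> emeasure cone_measure (sphere 0 1 - radial_section \<Omega> r)"
proof -
  let ?k = "DIM('a) - 1" and ?K = "hausdorff_le_cone_const TYPE('a)"
  let ?\<omega> = "hausdorff_measure ?k (sphere (0::'a) 1)"
  obtain q where q: "Limsup (at_right 0) (\<lambda>r. m r / ennreal (r ^ ?k)) < q" "q < ?\<omega>"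
    using dense[OF lim] by blast
  obtain q1 where q1: "q < q1" "q1 < ?\<omega>" using dense[OF q(2)] by blast
  obtain b where b: "q1 = ennreal b" "0 \<le> b" using q1(2) by (cases q1) auto
  obtain a where a: "q = ennreal a" "0 \<le> a" using q1(1) b by (cases q) auto
  have ab: "a < b" using q1(1) a b by (simp add: ennreal_less_iff)
  have K: "0 < ?K" by (rule hausdorff_le_cone_const_pos)
  have "\<forall>\<^sub>F r in at_right 0. m r / ennreal (r ^ ?k) < q" by (rule Limsup_lessD[OF q(1)])
  then obtain \<rho>0 where \<rho>0: "0 < \<rho>0" "\<And>r. 0 < r \<Longrightarrow> r < \<rho>0 \<Longrightarrow> m r / ennreal (r ^ ?k) < q"
    unfolding eventually_at_right_field by auto
  show thesis
  proof (rule that[of "(b - a) / ?K" "min \<rho>0 R"])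
    show "0 < (b - a) / ?K" "0 < min \<rho>0 R" "min \<rho>0 R \<le> R" using ab K \<rho>0 R by auto
    fix r assume r: "0 < r" "r < min \<rho>0 R"
    let ?A = "radial_section \<Omega> r"
    have "0 < r ^ ?k" "m r / ennreal (r ^ ?k) < q" using \<rho>0(2)[of r] r by simp_all
    then have "m r < q * ennreal (r ^ ?k)"
      by (subst (asm) divide_less_ennreal) (use r in simp_all)
    then have "ennreal ((1 / r) ^ ?k) * m r \<le> ennreal ((1 / r) ^ ?k) * (q * ennreal (r ^ ?k))"
      by (intro mult_left_mono) auto
    also have "\<dots> = q * ennreal ((1 / r) ^ ?k * r ^ ?k)"
      using r by (simp add: ennreal_mult mult_ac)
    also have "(1 / r) ^ ?k * r ^ ?k = 1" using r by (simp add: power_one_over)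
    finally have HA: "hausdorff_measure ?k ?A \<le> q"
      using hausdorff_radial_section_le[OF r(1), of ?k \<Omega>] m[of r] r by simp
    have HB: "hausdorff_measure ?k (sphere 0 1 - ?A) \<le> ennreal ?K * emeasure cone_measure (sphere 0 1 - ?A)"
      by (rule hausdorff_le_emeasure_cone[OF dim compact_radial_section_complement[OF \<Omega>]]) auto
    obtain s where s: "emeasure cone_measure (sphere 0 1 - ?A) = ennreal s" "0 \<le> s"
      using cone_measure.emeasure_finite[of "sphere 0 1 - ?A"] by (cases "emeasure cone_measure (sphere 0 1 - ?A)") auto
    have "?A \<union> (sphere 0 1 - ?A) = sphere 0 1" by (auto simp: radial_section_def)
    then have "?\<omega> \<le> hausdorff_measure ?k ?A + hausdorff_measure ?k (sphere 0 1 - ?A)"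
      using hausdorff_measure_Un[of ?k ?A "sphere 0 1 - ?A"] by simp
    also have "\<dots> \<le> ennreal a + ennreal ?K * ennreal s"
      using HA HB by (intro add_mono) (simp_all add: a s)
    also have "\<dots> = ennreal (a + ?K * s)" using a s K by (simp add: ennreal_mult ennreal_plus)
    finally have "ennreal b < ennreal (a + ?K * s)" using q1(2) b by (auto intro: less_le_trans)
    then have "b < a + ?K * s" using b by (simp add: ennreal_less_iff)
    then have "(b - a) / ?K \<le> s" using K by (simp add: field_simps)
    then show "ennreal ((b - a) / ?K) \<le> emeasure cone_measure (sphere 0 1 - ?A)"
      unfolding s(1) by (rule ennreal_leI)
  qed
qed

lemma cone_le_hausdorff_const_pos: "0 < cone_le_hausdorff_const TYPE('a::euclidean_space)"
  unfolding cone_le_hausdorff_const_def by (intro mult_pos_pos divide_pos_pos) auto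

text \<open>
  For \<open>r \<ge> R / 2\<close> the projection to the unit sphere costs at most the constant factor
  \<open>(2 / R) ^ (n - 1)\<close>.
\<close>

lemma small_sections_near_boundary:
  fixes \<Omega> :: "'a::euclidean_space set"
  assumes dim: "2 \<le> DIM('a)" and \<Omega>: "open \<Omega>" and R: "0 < R"
    and m: "\<And>r. r \<in> {0<..<R} \<Longrightarrow> m r = hausdorff_measure (DIM('a) - 1) {x \<in> \<Omega>. norm x = r}"
    and lim: "Limsup (at_left R) (\<lambda>r. m r / ennreal ((R - r) ^ (DIM('a) - 1))) < \<infinity>"
  obtains C \<rho> where "0 \<le> C" "0 < \<rho>" "\<rho> < R"
    "\<And>r. \<rho> < r \<Longrightarrow> r < R \<Longrightarrow> emeasure cone_measure (radial_section \<Omega> r) \<le> ennreal (C * (R - r) ^ (DIM('a) - 1))"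
proof -
  let ?k = "DIM('a) - 1" and ?K = "cone_le_hausdorff_const TYPE('a)"
  obtain q where q: "Limsup (at_left R) (\<lambda>r. m r / ennreal ((R - r) ^ ?k)) < q" "q < \<infinity>"
    using dense[OF lim] by blast
  obtain a where a: "q = ennreal a" "0 \<le> a" using q(2) by (cases q) auto
  have K: "0 < ?K" by (rule cone_le_hausdorff_const_pos)
  have "\<forall>\<^sub>F r in at_left R. m r / ennreal ((R - r) ^ ?k) < q" by (rule Limsup_lessD[OF q(1)])
  then obtain \<rho>0 where \<rho>0: "\<rho>0 < R" "\<And>r. \<rho>0 < r \<Longrightarrow> r < R \<Longrightarrow> m r / ennreal ((R - r) ^ ?k) < q"
    unfolding eventually_at_left_field by auto
  show thesis
  proof (rule that[of "?K * ((2 / R) ^ ?k * a)" "max \<rho>0 (R / 2)"])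
    show "0 \<le> ?K * ((2 / R) ^ ?k * a)" "0 < max \<rho>0 (R / 2)" "max \<rho>0 (R / 2) < R" using K R a \<rho>0 by auto
    fix r assume r: "max \<rho>0 (R / 2) < r" "r < R"
    then have r0: "0 < r" using R by simp
    have "0 < (R - r) ^ ?k" "m r / ennreal ((R - r) ^ ?k) < q" using \<rho>0(2)[of r] r by simp_all
    then have "m r < q * ennreal ((R - r) ^ ?k)"
      by (subst (asm) divide_less_ennreal) (use r in simp_all)
    have "emeasure cone_measure (radial_section \<Omega> r) \<le> ennreal ?K * hausdorff_measure ?k (radial_section \<Omega> r)"
      by (rule emeasure_cone_le_hausdorff[OF dim radial_section_borel[OF \<Omega>]]) (auto simp: radial_section_def)
    also have "\<dots> \<le> ennreal ?K * (ennreal ((1 / r) ^ ?k) * m r)"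
      using hausdorff_radial_section_le[OF r0, of ?k \<Omega>] m[of r] r r0 by (intro mult_left_mono) auto
    also have "\<dots> \<le> ennreal ?K * (ennreal ((2 / R) ^ ?k) * (q * ennreal ((R - r) ^ ?k)))"
    proof (intro mult_left_mono mult_mono)
      show "ennreal ((1 / r) ^ ?k) \<le> ennreal ((2 / R) ^ ?k)"
        using r r0 R by (intro ennreal_leI power_mono) (auto simp: field_simps)
    qed (use \<open>m r < _\<close> in auto)
    also have "\<dots> = ennreal (?K * ((2 / R) ^ ?k * a) * (R - r) ^ ?k)"
      using K R a r by (simp add: ennreal_mult[symmetric] mult.assoc)
    finally show "emeasure cone_measure (radial_section \<Omega> r) \<le> ennreal (?K * ((2 / R) ^ ?k * a) * (R - r) ^ ?k)" .
  qed
qed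

text \<open>
  Near the origin the Poincare constant is of order \<open>r\<close>, and \<open>ln (R / r) \<ge>
  1\<close> there.  Near the outer sphere it is of order \<open>R - r\<close>, and \<open>R - r \<le> R
  * ln (R / r)\<close>.
\<close>

lemma sphere_bounds_at_ends:
  fixes \<Omega> :: "'a::euclidean_space set"
  assumes dim: "2 \<le> DIM('a)" and \<Omega>: "open \<Omega>" and R: "0 < R"
    and m: "\<And>r. r \<in> {0<..<R} \<Longrightarrow> m r = hausdorff_measure (DIM('a) - 1) {x \<in> \<Omega>. norm x = r}"
    and lim0: "Limsup (at_right 0) (\<lambda>r. m r / ennreal (r ^ (DIM('a) - 1))) < hausdorff_measure (DIM('a) - 1) (sphere (0::'a) 1)"
    and limR: "Limsup (at_left R) (\<lambda>r. m r / ennreal ((R - r) ^ (DIM('a) - 1))) < \<infinity>"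
  obtains M r1 r2 where "0 < M" "0 < r1" "r1 < R" "0 < r2" "r2 < R"
    "\<And>r. 0 < r \<Longrightarrow> r < R \<Longrightarrow> r < r1 \<or> r2 < r \<Longrightarrow> tangential_bound \<Omega> R M r"
proof -
  let ?n = "DIM('a)" and ?\<beta> = "unit_ball_vol (real DIM('a))" and ?P = "poincare_const TYPE('a)"
  obtain \<epsilon> \<rho>0 where \<epsilon>: "0 < \<epsilon>" "0 < \<rho>0" "\<rho>0 \<le> R"
    "\<And>r. 0 < r \<Longrightarrow> r < \<rho>0 \<Longrightarrow> ennreal \<epsilon> \<le> emeasure cone_measure (sphere 0 1 - radial_section \<Omega> r)"
    using zero_set_near_0[OF dim \<Omega> R m lim0] by blast
  obtain C \<rho>R where C: "0 \<le> C" "0 < \<rho>R" "\<rho>R < R"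
    "\<And>r. \<rho>R < r \<Longrightarrow> r < R \<Longrightarrow> emeasure cone_measure (radial_section \<Omega> r) \<le> ennreal (C * (R - r) ^ (?n - 1))"
    using small_sections_near_boundary[OF dim \<Omega> R m limR] by blast
  have P: "0 < ?P" using poincare_const_pos dim by blast
  define A where "A = 1 + real ?n * 2 ^ Suc ?n * C / ?\<beta>"
  have A: "1 \<le> A" using C by (simp add: A_def)
  define M0 where "M0 = 2 * (?P * 2 ^ Suc ?n / \<epsilon> * real ?n)"
  define M1 where "M1 = 2 * (2 * ?P / ?\<beta> * (A * R) * real ?n)"
  have M01: "0 < M0" "0 < M1" using P \<epsilon> A R by (simp_all add: M0_def M1_def)
  \<comment> \<open>the two radii where \<open>ln (R / r) = 1\<close> and where \<open>A * (R - r) = 1/2\<close>\<close>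
  define r1 where "r1 = min \<rho>0 (R * exp (- 1))"
  define r2 where "r2 = max \<rho>R (R - 1 / (2 * A))"
  show thesis
  proof (rule that[of "M0 + M1" r1 r2])
    have "R * exp (- 1) < R * 1" using R by (intro mult_strict_left_mono) auto
    then have "R * exp (- 1) < R" by (simp only: mult_1_right)
    then show "r1 < R" unfolding r1_def by linarith
    show "0 < M0 + M1" "0 < r1" "0 < r2" "r2 < R" using M01 \<epsilon> R C A by (auto simp: r1_def r2_def)
    fix r assume r: "0 < r" "r < R" and ends: "r < r1 \<or> r2 < r"
    show "tangential_bound \<Omega> R (M0 + M1) r"
      unfolding tangential_bound_def
    proof (intro allI impI)
      fix \<phi> :: "'a \<Rightarrow> real" and D\<phi>
      assume "C1_supported \<Omega> \<phi> D\<phi>"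
      then have \<phi>: "GDERIV \<phi> x :> D\<phi> x" and cont: "continuous_on UNIV D\<phi>" and out: "x \<notin> \<Omega> \<Longrightarrow> \<phi> x = 0" for x
        by (auto simp: C1_supported_def)
      have "continuous_on UNIV \<phi>" by (rule GDERIV_imp_continuous_on[OF \<phi>])
      then have [measurable]: "\<phi> \<in> borel_measurable borel" by (rule borel_measurable_continuous_onI)
      let ?F = "sphere_mass ?n \<phi> r"
      let ?T = "sphere_energy ?n D\<phi> r"
      have t: "0 < ln (R / r)" using r by simp
      have "\<exists>L. 0 \<le> L \<and> L \<le> (M0 + M1) * (r * ln (R / r)) \<and> ?F \<le> ennreal (L ^ ?n) * ?T"
      proof (cases "r < r1")
        case True
        have "ennreal \<epsilon> \<le> emeasure cone_measure (sphere 0 1 - radial_section \<Omega> r)"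
          using True r by (intro \<epsilon>(4)) (auto simp: r1_def)
        also have "\<dots> \<le> emeasure cone_measure {w. \<phi> (r *\<^sub>R w) = 0}"
          by (rule emeasure_mono) (auto simp: radial_section_def intro!: out)
        finally have "?F \<le> ennreal ((2 * (?P * 2 ^ Suc ?n / \<epsilon> * real ?n * r)) ^ ?n) * ?T"
          using \<epsilon> by (intro sphere_bound_near_0[OF dim \<phi> cont r(1)])
        moreover have "2 * (?P * 2 ^ Suc ?n / \<epsilon> * real ?n * r) = M0 * r" by (simp add: M0_def)
        moreover have "M0 * r \<le> (M0 + M1) * (r * ln (R / r))"
        proof (intro mult_mono)
          have "r \<le> R * exp (- 1)" using True by (simp add: r1_def)
          then have "exp 1 \<le> R / r" using r by (simp add: exp_minus field_simps)
          then have "1 \<le> ln (R / r)" using r by (subst ln_ge_iff) auto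
          then show "r \<le> r * ln (R / r)" using r by simp
        qed (use M01 r in auto)
        ultimately show ?thesis using M01 r by (intro exI[of _ "M0 * r"]) auto
      next
        case False
        then have rr: "\<rho>R < r" "R - 1 / (2 * A) < r" using ends by (auto simp: r2_def)
        have As: "A * (R - r) \<le> 1 / 2"
        proof -
          have "A * (R - r) \<le> A * (1 / (2 * A))" using rr A by (intro mult_left_mono) auto
          then show ?thesis using A by simp
        qed
        have "emeasure cone_measure {w. \<phi> (r *\<^sub>R w) \<noteq> 0} \<le> emeasure cone_measure (radial_section \<Omega> r)"
        proof (rule emeasure_mono_AE)
          show "AE w in cone_measure. w \<in> {w. \<phi> (r *\<^sub>R w) \<noteq> 0} \<longrightarrow> w \<in> radial_section \<Omega> r"
            using AE_cone_measure
          proof eventually_elim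
            case (elim w)
            then show ?case using out[of "r *\<^sub>R w"] by (auto simp: radial_section_def)
          qed
        qed (simp add: radial_section_borel[OF \<Omega>])
        also have "\<dots> \<le> ennreal (C * (R - r) ^ (?n - 1))" using rr r by (intro C(4))
        finally have "?F \<le> ennreal ((2 * (2 * ?P / ?\<beta> * (A * (R - r)) * real ?n * r)) ^ ?n) * ?T"
          using r C(1) As by (intro sphere_bound_near_boundary[OF dim \<phi> cont r(1) C(1) _ A_def]) auto
        moreover have "2 * (2 * ?P / ?\<beta> * (A * (R - r)) * real ?n * r) = M1 / R * (R - r) * r" using R by (simp add: M1_def)
        moreover have "M1 / R * (R - r) * r \<le> (M0 + M1) * (r * ln (R / r))"
        proof -
          have "ln (r / R) \<le> r / R - 1" using r R by (intro ln_le_minus_one) simp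
          moreover have "ln (r / R) = - ln (R / r)" using r R by (simp add: ln_div)
          ultimately have "(R - r) / R \<le> ln (R / r)" using R by (simp add: diff_divide_distrib)
          then have "M1 * ((R - r) / R * r) \<le> (M0 + M1) * (ln (R / r) * r)"
            using M01 r R t by (intro mult_mono mult_right_mono) auto
          then show ?thesis by (simp add: mult_ac)
        qed
        ultimately show ?thesis using M01 r R by (intro exI[of _ "M1 / R * (R - r) * r"]) auto
      qed
      then obtain L where L: "0 \<le> L" "L \<le> (M0 + M1) * (r * ln (R / r))" "?F \<le> ennreal (L ^ ?n) * ?T" by blast
      note L(3)
      also have "ennreal (L ^ ?n) * ?T \<le> ennreal (((M0 + M1) * (r * ln (R / r))) ^ ?n) * ?T"
        using L by (intro mult_right_mono ennreal_leI power_mono) auto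
      finally show "?F \<le> ennreal (((M0 + M1) * (r * ln (R / r))) ^ ?n) * ?T" .
    qed
  qed
qed

lemma test_function_vanishes_near_boundary:
  fixes \<Omega> :: "'a::euclidean_space set"
  assumes \<phi>: "test_function \<Omega> \<phi>" and R: "0 < R" "\<And>x. x \<in> \<Omega> \<Longrightarrow> norm x < R"
  obtains e where "0 < e" "e < R" "\<And>x::'a. e \<le> norm x \<Longrightarrow> \<phi> x = 0"
proof -
  let ?K = "closure {x. \<phi> x \<noteq> 0}"
  have K: "compact ?K" "?K \<subseteq> \<Omega>" using \<phi> by (auto simp: test_function_def)
  have out: "\<phi> x = 0" if "x \<notin> ?K" for x using that closure_subset[of "{x. \<phi> x \<noteq> 0}"] by auto
  have "\<exists>M<R. \<forall>x\<in>?K. norm x \<le> M"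
  proof (cases "?K = {}")
    case False
    from continuous_attains_sup[OF K(1) False continuous_on_norm_id] obtain x where "x \<in> ?K" "\<forall>y\<in>?K. norm y \<le> norm x" by blast
    then show ?thesis using R(2) K(2) by blast
  qed (use R(1) in auto)
  then obtain M where M: "M < R" "\<And>x. x \<in> ?K \<Longrightarrow> norm x \<le> M" by blast
  show thesis
  proof (rule that[of "(max M 0 + R) / 2"])
    show "0 < (max M 0 + R) / 2" "(max M 0 + R) / 2 < R" using M R by auto
    fix x :: 'a assume "(max M 0 + R) / 2 \<le> norm x"
    moreover have "M < (max M 0 + R) / 2" using M(1) R(1) by (auto simp: max_def)
    ultimately have "\<not> norm x \<le> M" by linarith
    then show "\<phi> x = 0" using out M(2) by blast
  qed
qed

lemma hardy_improved_test_functions: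
  fixes \<Omega> :: "'a::euclidean_space set"
  assumes dim: "2 \<le> DIM('a)" and \<Omega>: "open \<Omega>" and R: "0 < R" "\<And>x. x \<in> \<Omega> \<Longrightarrow> norm x < R"
    and m: "\<And>r. r \<in> {0<..<R} \<Longrightarrow> m r = hausdorff_measure (DIM('a) - 1) {x \<in> \<Omega>. norm x = r}"
    and lim0: "Limsup (at_right 0) (\<lambda>r. m r / ennreal (r ^ (DIM('a) - 1))) < hausdorff_measure (DIM('a) - 1) (sphere (0::'a) 1)"
    and limR: "Limsup (at_left R) (\<lambda>r. m r / ennreal ((R - r) ^ (DIM('a) - 1))) < \<infinity>"
  obtains \<delta> where "0 < \<delta>"
    "\<And>\<phi>. test_function \<Omega> \<phi> \<Longrightarrow>
      ennreal (((real DIM('a) - 1) / real DIM('a)) ^ DIM('a) + \<delta>) *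
        (\<integral>\<^sup>+x. ennreal (1 / (norm x ^ DIM('a) * ln (R / norm x) ^ DIM('a)) * \<bar>\<phi> x\<bar> ^ DIM('a)) \<partial>lebesgue_on \<Omega>) \<le>
      (\<integral>\<^sup>+x. ennreal (norm (grad \<phi> x) ^ DIM('a)) \<partial>lebesgue_on \<Omega>)"
proof -
  let ?n = "DIM('a)" and ?H = "((real DIM('a) - 1) / real DIM('a)) ^ DIM('a)"
  obtain M r1 r2 where M: "0 < M" "0 < r1" "r1 < R" "0 < r2" "r2 < R"
    and ends: "\<And>r. 0 < r \<Longrightarrow> r < R \<Longrightarrow> r < r1 \<or> r2 < r \<Longrightarrow> tangential_bound \<Omega> R M r"
    using sphere_bounds_at_ends[OF dim \<Omega> R(1) m lim0 limR] by blast
  obtain \<delta> where \<delta>: "0 < \<delta>" and hardy: "\<And>\<phi> D\<phi> e. C1_supported \<Omega> \<phi> D\<phi> \<Longrightarrow> 0 < e \<Longrightarrow> e < R \<Longrightarrow> (\<forall>x. e \<le> norm x \<longrightarrow> \<phi> x = 0) \<Longrightarrow>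
      ennreal (?H + \<delta>) * (\<integral>\<^sup>+x. ennreal (\<bar>\<phi> x\<bar> ^ ?n / (norm x ^ ?n * ln (R / norm x) ^ ?n)) \<partial>lborel) \<le>
      (\<integral>\<^sup>+x. ennreal (norm (D\<phi> x) ^ ?n) \<partial>lborel)"
    using hardy_improved_C1[OF dim R(1) M ends] by blast
  show thesis
  proof (rule that[OF \<delta>])
    fix \<phi> assume \<phi>: "test_function \<Omega> \<phi>"
    obtain e where e: "0 < e" "e < R" "\<And>x. e \<le> norm x \<Longrightarrow> \<phi> x = 0"
      using test_function_vanishes_near_boundary[OF \<phi> R] by blast
    have supp: "closure {x. \<phi> x \<noteq> 0} \<subseteq> \<Omega>" using \<phi> by (simp add: test_function_def)
    have C1: "C1_supported \<Omega> \<phi> (grad \<phi>)"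
      using test_function_C1[OF \<phi>] supp closure_subset[of "{x. \<phi> x \<noteq> 0}"] by (auto simp: C1_supported_def)
    have restrict: "(\<integral>\<^sup>+x. f x \<partial>lebesgue_on \<Omega>) = (\<integral>\<^sup>+x. f x * indicator \<Omega> x \<partial>lborel)" for f :: "'a \<Rightarrow> ennreal"
      using \<Omega> by (subst nn_integral_restrict_space) (simp_all add: nn_integral_completion)
    have "(\<integral>\<^sup>+x. ennreal (1 / (norm x ^ ?n * ln (R / norm x) ^ ?n) * \<bar>\<phi> x\<bar> ^ ?n) \<partial>lebesgue_on \<Omega>) \<le>
        (\<integral>\<^sup>+x. ennreal (\<bar>\<phi> x\<bar> ^ ?n / (norm x ^ ?n * ln (R / norm x) ^ ?n)) \<partial>lborel)"
      unfolding restrict by (intro nn_integral_mono) (auto simp: indicator_def)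
    then have "ennreal (?H + \<delta>) * (\<integral>\<^sup>+x. ennreal (1 / (norm x ^ ?n * ln (R / norm x) ^ ?n) * \<bar>\<phi> x\<bar> ^ ?n) \<partial>lebesgue_on \<Omega>) \<le>
        ennreal (?H + \<delta>) * (\<integral>\<^sup>+x. ennreal (\<bar>\<phi> x\<bar> ^ ?n / (norm x ^ ?n * ln (R / norm x) ^ ?n)) \<partial>lborel)"
      by (rule mult_left_mono) simp
    also have "\<dots> \<le> (\<integral>\<^sup>+x. ennreal (norm (grad \<phi> x) ^ ?n) \<partial>lborel)"
      using e by (intro hardy[OF C1]) auto
    also have "\<dots> = (\<integral>\<^sup>+x. ennreal (norm (grad \<phi> x) ^ ?n) \<partial>lebesgue_on \<Omega>)"
      unfolding restrict
    proof (rule nn_integral_cong)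
      fix x
      show "ennreal (norm (grad \<phi> x) ^ ?n) = ennreal (norm (grad \<phi> x) ^ ?n) * indicator \<Omega> x"
      proof (cases "x \<in> \<Omega>")
        case False
        then have "grad \<phi> x = 0" using supp by (intro grad_outside_support) auto
        then show ?thesis using False by (simp add: power_0_left)
      qed simp
    qed
    finally show "ennreal (?H + \<delta>) * (\<integral>\<^sup>+x. ennreal (1 / (norm x ^ ?n * ln (R / norm x) ^ ?n) * \<bar>\<phi> x\<bar> ^ ?n) \<partial>lebesgue_on \<Omega>) \<le>
      (\<integral>\<^sup>+x. ennreal (norm (grad \<phi> x) ^ ?n) \<partial>lebesgue_on \<Omega>)" .
  qed
qed

lemma ennreal_le_divide_if_mult_le:
  fixes a b c :: ennreal
  assumes "c * b \<le> a" "a < \<infinity>" "0 < b" "0 < c"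
  shows "c \<le> a / b"
proof -
  have "c * b < top" using assms by (auto intro: le_less_trans)
  then have "b < top" using assms by (auto simp: ennreal_mult_less_top)
  then have "c = c * b / b" using assms by (simp add: ennreal_mult_divide_eq)
  also have "\<dots> \<le> a / b" using assms by (intro divide_right_mono_ennreal)
  finally show ?thesis .
qed

text \<open>
  The quotient is well-behaved: its denominator is finite by the inequality itself, and positive since
  the weight is positive away from the origin.
\<close>

lemma hardy_constant_ge:
  fixes \<Omega> :: "'a::euclidean_space set"
  assumes \<Omega>: "open \<Omega>" "bounded \<Omega>" and c: "0 < c"
    and hardy: "\<And>\<phi>. test_function \<Omega> \<phi> \<Longrightarrow>
      ennreal c * (\<integral>\<^sup>+x. ennreal (1 / (norm x ^ DIM('a) * ln (outer_radius \<Omega> / norm x) ^ DIM('a)) * \<bar>\<phi> x\<bar> ^ DIM('a)) \<partial>lebesgue_on \<Omega>) \<le>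
      (\<integral>\<^sup>+x. ennreal (norm (grad \<phi> x) ^ DIM('a)) \<partial>lebesgue_on \<Omega>)"
  shows "ennreal c \<le> hardy_constant \<Omega>"
  unfolding hardy_constant_def Let_def
proof (rule Inf_greatest, clarify)
  let ?n = "DIM('a)" and ?R = "outer_radius \<Omega>"
  let ?w = "\<lambda>x::'a. 1 / (norm x ^ ?n * ln (?R / norm x) ^ ?n)"
  fix u :: "'a \<Rightarrow> real" and g
  assume u: "u \<in> W1_0 ?n \<Omega>" and g: "weak_gradient \<Omega> u g" and nz: "\<not> (AE x in lebesgue_on \<Omega>. u x = 0)"
  have R: "norm x < ?R" if "x \<in> \<Omega>" for x using norm_less_outer_radius[OF \<Omega> that] .
  have wm: "?w \<in> borel_measurable borel" by measurable
  have wpos: "0 < ?w x" if "x \<in> \<Omega>" "x \<noteq> 0" for x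
  proof -
    have "0 < norm x" "1 < ?R / norm x" using R[OF that(1)] that by simp_all
    then have "0 < norm x ^ ?n * ln (?R / norm x) ^ ?n" by (intro mult_pos_pos zero_less_power ln_gt_zero)
    then show ?thesis by (rule divide_pos_pos[OF zero_less_one])
  qed
  have w0: "0 \<le> ?w x" if "x \<in> \<Omega>" for x
    using wpos[OF that] by (cases "x = 0") (auto simp: power_0_left)
  note ext = hardy_extends_to_W1_0[OF \<Omega>(1) _ c wm w0 hardy u g]
  have le: "ennreal c * (\<integral>\<^sup>+x. ennreal (?w x * \<bar>u x\<bar> ^ ?n) \<partial>lebesgue_on \<Omega>) \<le> (\<integral>\<^sup>+x. ennreal (norm (g x) ^ ?n) \<partial>lebesgue_on \<Omega>)"
    and fin: "(\<integral>\<^sup>+x. ennreal (norm (g x) ^ ?n) \<partial>lebesgue_on \<Omega>) < \<infinity>"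
    by (rule ext; simp add: Suc_leI)+
  have um [measurable]: "u \<in> borel_measurable (lebesgue_on \<Omega>)" using u by (auto simp: W1_0_def W1_def Lp_def)
  have wM [measurable]: "?w \<in> borel_measurable (lebesgue_on \<Omega>)"
    using wm by (intro measurable_restrict_space1 measurable_completion) simp
  have "(\<integral>\<^sup>+x. ennreal (?w x * \<bar>u x\<bar> ^ ?n) \<partial>lebesgue_on \<Omega>) \<noteq> 0"
  proof
    assume "(\<integral>\<^sup>+x. ennreal (?w x * \<bar>u x\<bar> ^ ?n) \<partial>lebesgue_on \<Omega>) = 0"
    moreover have "(\<lambda>x. ennreal (?w x * \<bar>u x\<bar> ^ ?n)) \<in> borel_measurable (lebesgue_on \<Omega>)"
      by (intro measurable_compose[OF _ measurable_ennreal] borel_measurable_times borel_measurable_power borel_measurable_abs wM um)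
    ultimately have "AE x in lebesgue_on \<Omega>. ennreal (?w x * \<bar>u x\<bar> ^ ?n) = 0"
      by (subst (asm) nn_integral_0_iff_AE) auto
    moreover have "AE x in lebesgue_on \<Omega>. x \<noteq> 0"
    proof -
      have "AE x in lebesgue. x \<noteq> (0::'a)" by (rule AE_completion[OF AE_lborel_singleton])
      then show ?thesis using \<Omega> by (simp add: AE_restrict_space_iff eventually_mono)
    qed
    moreover have "AE x in lebesgue_on \<Omega>. x \<in> \<Omega>" using AE_space[of "lebesgue_on \<Omega>"] by (simp add: space_restrict_space)
    ultimately have "AE x in lebesgue_on \<Omega>. u x = 0"
    proof eventually_elim
      case (elim x)
      then have "?w x * \<bar>u x\<bar> ^ ?n \<le> 0" by (simp only: ennreal_eq_0_iff)
      then have "\<not> 0 < \<bar>u x\<bar> ^ ?n" using wpos[OF elim(3,2)] by (metis mult_pos_pos not_less)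
      then show ?case by (metis zero_less_abs_iff zero_less_power)
    qed
    with nz show False ..
  qed
  then have pos: "0 < (\<integral>\<^sup>+x. ennreal (\<bar>u x\<bar> ^ ?n / (norm x ^ ?n * ln (?R / norm x) ^ ?n)) \<partial>lebesgue_on \<Omega>)"
    by (simp add: zero_less_iff_neq_zero)
  show "ennreal c \<le> (\<integral>\<^sup>+x. ennreal (norm (g x) ^ ?n) \<partial>lebesgue_on \<Omega>) / (\<integral>\<^sup>+x. ennreal (\<bar>u x\<bar> ^ ?n / (norm x ^ ?n * ln (?R / norm x) ^ ?n)) \<partial>lebesgue_on \<Omega>)"
    using le fin pos c by (intro ennreal_le_divide_if_mult_le) simp_all
qed

theorem theorem4:
  fixes \<Omega> :: "(real ^ 'n::finite) set" and N :: nat and R :: real and m :: "real \<Rightarrow> ennreal"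
    and m\<^sub>0 m\<^sub>R \<omega> :: ennreal
  assumes "N = CARD('n)" and "N \<ge> 2"
    and "open \<Omega>" and "connected \<Omega>" and "\<Omega> \<noteq> {}" and "bounded \<Omega>"
    and "R = outer_radius \<Omega>"
    and "\<And>r. r \<in> {0<..<R} \<Longrightarrow> m r = hausdorff_measure (N - 1) {x \<in> \<Omega>. norm x = r}"
    and "\<omega> = hausdorff_measure (N - 1) (sphere (0 :: real ^ 'n) 1)"
    and "m\<^sub>0 = Limsup (at_right 0) (\<lambda>r. m r / ennreal (r ^ (N - 1)))"
    and "m\<^sub>0 < \<omega>"
    and "m\<^sub>R = Limsup (at_left R) (\<lambda>r. m r / ennreal ((R - r) ^ (N - 1)))"
    and "m\<^sub>R < \<infinity>"
  shows "hardy_constant \<Omega> > ennreal (((real N - 1) / real N) ^ N)"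
proof -
  have N: "N = DIM(real ^ 'n)" using assms(1) by simp
  have dim: "2 \<le> DIM(real ^ 'n)" using assms(2) N by simp
  have R: "0 < R" "\<And>x. x \<in> \<Omega> \<Longrightarrow> norm x < R"
    using outer_radius_pos[OF assms(3,6,5)] norm_less_outer_radius[OF assms(3,6)] by (simp_all add: assms(7))
  let ?H = "((real N - 1) / real N) ^ N"
  obtain \<delta> where \<delta>: "0 < \<delta>" and hardy: "\<And>\<phi>. test_function \<Omega> \<phi> \<Longrightarrow>
      ennreal (?H + \<delta>) * (\<integral>\<^sup>+x. ennreal (1 / (norm x ^ N * ln (R / norm x) ^ N) * \<bar>\<phi> x\<bar> ^ N) \<partial>lebesgue_on \<Omega>) \<le>
      (\<integral>\<^sup>+x. ennreal (norm (grad \<phi> x) ^ N) \<partial>lebesgue_on \<Omega>)"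
  proof (rule hardy_improved_test_functions[of \<Omega> R m])
    show "2 \<le> DIM(real ^ 'n)" "open \<Omega>" "0 < R" by (fact dim assms(3) R(1))+
    show "norm x < R" if "x \<in> \<Omega>" for x by (rule R(2)[OF that])
    show "m r = hausdorff_measure (DIM(real ^ 'n) - 1) {x \<in> \<Omega>. norm x = r}" if "r \<in> {0<..<R}" for r
      using assms(8)[OF that] N by simp
    show "Limsup (at_right 0) (\<lambda>r. m r / ennreal (r ^ (DIM(real ^ 'n) - 1))) < hausdorff_measure (DIM(real ^ 'n) - 1) (sphere (0 :: real ^ 'n) 1)"
      using assms(9-11) unfolding N by simp
    show "Limsup (at_left R) (\<lambda>r. m r / ennreal ((R - r) ^ (DIM(real ^ 'n) - 1))) < \<infinity>"
      using assms(12,13) unfolding N by simp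
  qed (use that in \<open>unfold N, blast\<close>)
  have "0 \<le> ?H" using assms(2) by simp
  then have "ennreal ?H < ennreal (?H + \<delta>)" using \<delta> by (simp add: ennreal_less_iff)
  also have "\<dots> \<le> hardy_constant \<Omega>"
  proof (rule hardy_constant_ge[OF assms(3,6)])
    show "0 < ?H + \<delta>" using \<open>0 \<le> ?H\<close> \<delta> by (rule add_nonneg_pos)
  qed (use hardy in \<open>simp only: N assms(7)\<close>)
  finally show ?thesis .
qed

end
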